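(* There exist universal constants $0<\eta<1/4$, $c>0$ and $c'>0$ such that for every $d\ge 1$ and every isotropic log-concave probability measure $\mu$ on $\mathbb{R}^d$, for all $\varepsilon$ with $d^{-\eta}<\varepsilon<1$, $$H_L^\mu(\varepsilon)\ \ge\ c'\binom{d}{\lfloor c/\varepsilon\rfloor^2}.$$ Moreover, if in addition $\mu$ is a product measure, then the same inequality holds for all $\varepsilon$ in the range $d^{-1/4}<\varepsilon<1$.
   Context: A probability measure $\mu$ on $\mathbb{R}^d$ is log-concave if $d\mu(x)=e^{-V(x)}dx$ with $V:\mathbb{R}^d\to\mathbb{R}\cup\{\infty\}$ convex. It is isotropic if it has mean zero and identity covariance matrix. It is a product measure if the coordinates $X_1,\dots,X_d$ of a random vector $X\sim\mu$ are independent. Let $B_{Lip}=\{f:\mathbb{R}^d\to\mathbb{R}: f\text{ is }1\text{-Lipschitz and }\int f^2d\mu\le1\}$ and $d_\mu(f,g)=\|f-g\|_{L^2(\mu)}$. For $0<\varepsilon<1$, let $\mathcal{N}(B_{Lip},\varepsilon,d_\mu)$ be the maximal cardinality of an $\varepsilon$-separated subset of $B_{Lip}$ with respect to $d_\mu$ (pairwise distances at least $\varepsilon$), and $H_L^\mu(\varepsilon)=\log\mathcal{N}(B_{Lip},\varepsilon,d_\mu)$. *)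

theory Defs
  imports "HOL-Probability.Probability"
begin

text \<open>
  The constants of the theorem do not depend on the dimension, so the dimension has to be a
  number rather than a type: a point of $R^d$ is an extensional function on \<open>{..<d}\<close>,
  i.e. an element of \<open>space (Rd d)\<close>, which equals \<open>{..<d} \<rightarrow>\<^sub>E UNIV\<close>.
\<close>

definition Rd :: "nat \<Rightarrow> (nat \<Rightarrow> real) measure" where
  "Rd d = (\<Pi>\<^sub>M i\<in>{..<d}. lborel)"

definition Rd_dist :: "nat \<Rightarrow> (nat \<Rightarrow> real) \<Rightarrow> (nat \<Rightarrow> real) \<Rightarrow> real" where
  "Rd_dist d x y = L2_set (\<lambda>i. x i - y i) {..<d}"

definition Rd_convex_fun :: "nat \<Rightarrow> ((nat \<Rightarrow> real) \<Rightarrow> ereal) \<Rightarrow> bool" where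
  "Rd_convex_fun d V \<longleftrightarrow>
     (\<forall>x\<in>space (Rd d). V x \<noteq> -\<infinity>) \<and>
     (\<forall>x\<in>space (Rd d). \<forall>y\<in>space (Rd d). \<forall>t::real. 0 < t \<and> t < 1 \<longrightarrow>
        V (\<lambda>i\<in>{..<d}. (1 - t) * x i + t * y i) \<le> ereal (1 - t) * V x + ereal t * V y)"

definition exp_minus :: "ereal \<Rightarrow> ennreal" where
  "exp_minus v = (if v = \<infinity> then 0 else ennreal (exp (- real_of_ereal v)))"

text \<open>
  A convex \<open>V\<close> is Lebesgue measurable but, because of its values on the boundary of its
  effective domain, not necessarily Borel measurable; hence the completion. The measurability
  condition on \<open>V\<close> is implied by convexity and is no restriction.
\<close>

definition log_concave_measure :: "nat \<Rightarrow> (nat \<Rightarrow> real) measure \<Rightarrow> bool" where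
  "log_concave_measure d \<mu> \<longleftrightarrow>
     prob_space \<mu> \<and> sets \<mu> = sets (Rd d) \<and>
     (\<exists>V. Rd_convex_fun d V \<and> V \<in> borel_measurable (completion (Rd d)) \<and>
        (\<forall>A\<in>sets \<mu>. emeasure \<mu> A = (\<integral>\<^sup>+x\<in>A. exp_minus (V x) \<partial>completion (Rd d))))"

definition covariance :: "'a measure \<Rightarrow> ('a \<Rightarrow> real) \<Rightarrow> ('a \<Rightarrow> real) \<Rightarrow> real" where
  "covariance M X Y = (LINT \<omega>|M. (X \<omega> - (LINT \<omega>'|M. X \<omega>')) * (Y \<omega> - (LINT \<omega>'|M. Y \<omega>')))"

text \<open>Integrability is required explicitly since the Bochner integral of a non-integrable
  function is 0. Square integrability of the coordinates makes all covariances meaningful.\<close>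

definition isotropic :: "nat \<Rightarrow> (nat \<Rightarrow> real) measure \<Rightarrow> bool" where
  "isotropic d \<mu> \<longleftrightarrow>
     (\<forall>i<d. integrable \<mu> (\<lambda>x. x i) \<and> integrable \<mu> (\<lambda>x. (x i)\<^sup>2)) \<and>
     (\<forall>i<d. (LINT x|\<mu>. x i) = 0) \<and>
     (\<forall>i<d. \<forall>j<d. covariance \<mu> (\<lambda>x. x i) (\<lambda>x. x j) = (if i = j then 1 else 0))"

definition product_measure :: "nat \<Rightarrow> (nat \<Rightarrow> real) measure \<Rightarrow> bool" where
  "product_measure d \<mu> \<longleftrightarrow> prob_space.indep_vars \<mu> (\<lambda>_. borel) (\<lambda>i x. x i) {..<d}"

definition B_Lip :: "nat \<Rightarrow> (nat \<Rightarrow> real) measure \<Rightarrow> ((nat \<Rightarrow> real) \<Rightarrow> real) set" where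
  "B_Lip d \<mu> = {f \<in> extensional (space (Rd d)).
     (\<forall>x\<in>space (Rd d). \<forall>y\<in>space (Rd d). \<bar>f x - f y\<bar> \<le> Rd_dist d x y) \<and>
     integrable \<mu> (\<lambda>x. (f x)\<^sup>2) \<and> (LINT x|\<mu>. (f x)\<^sup>2) \<le> 1}"

definition L2_dist :: "'a measure \<Rightarrow> ('a \<Rightarrow> real) \<Rightarrow> ('a \<Rightarrow> real) \<Rightarrow> real" where
  "L2_dist M f g = sqrt (LINT x|M. (f x - g x)\<^sup>2)"

definition eps_separated :: "('a \<Rightarrow> 'a \<Rightarrow> real) \<Rightarrow> real \<Rightarrow> 'a set \<Rightarrow> bool" where
  "eps_separated \<delta> \<epsilon> S \<longleftrightarrow> (\<forall>f\<in>S. \<forall>g\<in>S. f \<noteq> g \<longrightarrow> \<epsilon> \<le> \<delta> f g)"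

text \<open>The supremum is taken in \<open>enat\<close>, so that it is \<open>\<infinity>\<close> rather than a
  junk value if the cardinalities are unbounded.\<close>

definition packing_number :: "'a set \<Rightarrow> real \<Rightarrow> ('a \<Rightarrow> 'a \<Rightarrow> real) \<Rightarrow> enat" where
  "packing_number B \<epsilon> \<delta> = (SUP S\<in>{S. S \<subseteq> B \<and> finite S \<and> eps_separated \<delta> \<epsilon> S}. enat (card S))"

definition H_Lip :: "nat \<Rightarrow> (nat \<Rightarrow> real) measure \<Rightarrow> real \<Rightarrow> ereal" where
  "H_Lip d \<mu> \<epsilon> =
     (case packing_number (B_Lip d \<mu>) \<epsilon> (L2_dist \<mu>) of enat n \<Rightarrow> ereal (ln (real n)) | \<infinity> \<Rightarrow> \<infinity>)"

end

theory Submission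
  imports Defs
begin

text \<open>
  The packing consists of random polynomials that have been made globally Lipschitz. Put
  \<open>z = sqrt d * x / |x|\<close> and, for a choice of signs indexed by the \<open>m\<close>-element subsets \<open>S\<close> of
  the coordinates, let \<open>P(z)\<close> be the sum of \<open>\<plusminus> (\<Prod>i\<in>S. z i)\<close>, divided by \<open>sqrt (d ^ m / m!)\<close>. At
  a point whose coordinates are not too concentrated, \<open>P\<close> has mean square between \<open>1/2\<close> and \<open>1\<close>
  over the signs, and the derivatives of order \<open>j\<close> have mean square Hilbert-Schmidt norm at most
  \<open>m ^ j\<close>. Hence for most signs \<open>P\<close> varies by at most \<open>O(sqrt m * r)\<close> over the whole ball of
  radius \<open>r \<le> 1 / sqrt m\<close> around the point (\<open>rpoly_increment_le\<close>, \<open>rad_roughness_le\<close>). This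
  estimate is based at one point only, and beyond that radius the values clipped to \<open>[-3, 3]\<close>
  satisfy it trivially. So the clipped polynomial, divided by a multiple \<open>\<Lambda>\<close> of \<open>sqrt m\<close>, is
  \<open>1\<close>-Lipschitz on a large random set and extends to a \<open>1\<close>-Lipschitz function \<open>f\<close> of size
  \<open>O(1 / sqrt m)\<close>. The choice of \<open>m\<close> as a multiple of \<open>\<lfloor>c / \<epsilon>\<rfloor>\<^sup>2\<close> makes \<open>\<Lambda> * \<epsilon>\<close> a small
  constant.

  These functions are many for a reason of correlation. On average over the signs \<open>\<Lambda> f\<close> has
  inner product at least a constant with \<open>P\<close>. If a maximal \<open>\<epsilon>\<close>-separated set \<open>S\<close> of such
  functions were small, then some \<open>g\<close> in \<open>S\<close>, within \<open>\<epsilon>\<close> of \<open>f\<close>, would still correlate with \<open>P\<close>.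
  But for a fixed bounded \<open>g\<close> the inner product with \<open>P\<close> is a Rademacher sum. If its variance is
  at most \<open>v\<close> then the maximum over \<open>S\<close> is \<open>O(sqrt (v * ln (card S)))\<close>, so that \<open>ln (card S)\<close> is
  at least a constant divided by \<open>v\<close> (\<open>entropy_lower_bound\<close>).

  It remains to bound \<open>v\<close>, that is, the Gram operator of the monomials. For a product measure
  the monomials in \<open>x\<close> are orthonormal and the norm \<open>|x|\<close> deviates from \<open>sqrt d\<close> by \<open>O(1)\<close> with
  high probability, so that replacing \<open>x\<close> by \<open>z\<close> costs a constant factor as long as \<open>m\<close> is at
  most a small multiple of \<open>sqrt d\<close>; Bessel's inequality gives \<open>v = O(m! / d ^ m)\<close>
  (\<open>product_gram\<close>). For a general isotropic log-concave measure, the sum over all tuples of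
  coordinates of the squared coefficients is the double integral of
  \<open>g(x) g(y) \<langle>z(x), z(y)\<rangle> ^ m\<close>. The tails of \<open>y \<mapsto> \<langle>x, y\<rangle>\<close> show that the kernel is small off an
  event of tiny probability, and \<open>v\<close> is at most about \<open>d ^ (- m / 8)\<close> (\<open>log_concave_gram\<close>). This
  is a much larger bound than in the product case, but degree \<open>m = 8 n\<close> then yields entropy of
  order \<open>d ^ n\<close>, which exceeds the binomial coefficient with lower entry \<open>n\<close>; the loss is a
  constant factor in \<open>c\<close>.

  The only input from convexity is the midpoint form of the Prekopa-Leindler inequality
  (\<open>prekopa_leindler_PiM\<close>). By Borell's argument it makes the tail probabilities of a linear
  functional square, up to a constant, each time the level triples. This yields the fourth
  moments of the coordinates and the tails of inner products.
\<close>

section \<open>The Prekopa-Leindler inequality at midpoints\<close>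

text \<open>
  For \<open>a \<in> A\<close> and \<open>b \<in> B\<close> the midpoints of \<open>A \<inter> {..a}\<close> with \<open>b\<close> and of \<open>a\<close> with \<open>B \<inter> {b..}\<close> lie
  on opposite sides of \<open>(a + b) / 2\<close>, so their measures add up inside \<open>C\<close>. Then \<open>a\<close> exhausts \<open>A\<close>
  from below and \<open>b\<close> exhausts \<open>B\<close> from above. The set of all midpoints need not be measurable,
  hence the measurable set \<open>C\<close>.
\<close>

lemma brunn_minkowski_midpoint_real:
  fixes A B C :: "real set"
  assumes A: "A \<in> sets lborel" "A \<noteq> {}" and B: "B \<in> sets lborel" "B \<noteq> {}"
    and C: "C \<in> sets lborel"
    and mid: "\<And>a b. a \<in> A \<Longrightarrow> b \<in> B \<Longrightarrow> (a + b) / 2 \<in> C"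
  shows "emeasure lborel A + emeasure lborel B \<le> 2 * emeasure lborel C"
proof -
  have cut: "emeasure lborel (A \<inter> {..a}) + emeasure lborel (B \<inter> {b..}) \<le> 2 * emeasure lborel C"
    if ab: "a \<in> A" "b \<in> B" for a b
  proof -
    let ?TA = "(\<lambda>x. 2 * x - b) -` (A \<inter> {..a})" and ?TB = "(\<lambda>x. 2 * x - a) -` (B \<inter> {b<..})"
    have scale: "emeasure lborel X = 2 * emeasure lborel ((\<lambda>x. 2 * x - t) -` X)"
      if "X \<in> sets lborel" for X and t :: real
    proof -
      have "emeasure lborel X = emeasure (density (distr lborel borel (\<lambda>x. -t + 2 * x)) (\<lambda>_. ennreal (\<bar>2\<bar>))) X"
        using lborel_real_affine[of 2 "-t"] by simp
      also have "\<dots> = 2 * emeasure lborel ((\<lambda>x. -t + 2 * x) -` X)"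
        using that by (simp add: emeasure_density_const emeasure_distr)
      finally show ?thesis by (simp add: algebra_simps)
    qed
    have TB: "?TB \<subseteq> C"
    proof
      fix x assume "x \<in> ?TB"
      then have "(a + (2 * x - a)) / 2 \<in> C" using ab mid by blast
      then show "x \<in> C" by simp
    qed
    have TA_C: "?TA \<subseteq> C"
    proof
      fix x assume "x \<in> ?TA"
      then have "((2 * x - b) + b) / 2 \<in> C" using ab mid by blast
      then show "x \<in> C" by simp
    qed
    have meas: "?TA \<in> sets lborel" "?TB \<in> sets lborel"
      using A(1) B(1) by (auto intro!: measurable_sets_borel)
    have disj: "?TA \<inter> ?TB = {}" by auto
    have null: "emeasure lborel (B \<inter> {b..}) \<le> emeasure lborel (B \<inter> {b<..})"
    proof -
      have "emeasure lborel (B \<inter> {b..}) \<le> emeasure lborel ((B \<inter> {b<..}) \<union> {b})"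
        using B(1) by (intro emeasure_mono) auto
      also have "\<dots> \<le> emeasure lborel (B \<inter> {b<..}) + emeasure lborel {b}"
        using B(1) by (intro emeasure_subadditive) auto
      finally show ?thesis by simp
    qed
    have "emeasure lborel (A \<inter> {..a}) + emeasure lborel (B \<inter> {b..})
        \<le> 2 * (emeasure lborel ?TA + emeasure lborel ?TB)"
      using scale[of "A \<inter> {..a}" b] scale[of "B \<inter> {b<..}" a] null A(1) B(1)
      by (simp add: distrib_left)
    also have "emeasure lborel ?TA + emeasure lborel ?TB = emeasure lborel (?TA \<union> ?TB)"
      using plus_emeasure[OF meas disj] .
    also have "2 * \<dots> \<le> 2 * emeasure lborel C"
      using TA_C TB C by (intro mult_left_mono emeasure_mono) auto
    finally show ?thesis .
  qed
  (* Points of A approach its supremum, whether it is attained, finite but not attained, or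
     infinite. *)
  have supA: "\<exists>a. range a \<subseteq> A \<and> (\<lambda>n::nat. emeasure lborel (A \<inter> {..a n})) \<longlonglongrightarrow> emeasure lborel A"
    if "A \<in> sets lborel" "A \<noteq> {}" for A :: "real set"
  proof -
    have "\<exists>a. incseq a \<and> range a \<subseteq> A \<and> (\<forall>x\<in>A. \<exists>n::nat. x \<le> a n)"
    proof (cases "bdd_above A")
      case False
      then have unb: "\<forall>t. \<exists>x\<in>A. t < x" by (auto simp: bdd_above_def not_le)
      have "\<exists>a. \<forall>n. a n \<in> A \<and> (a n \<le> a (Suc n) \<and> real n \<le> a (Suc n))"
      proof (rule dependent_nat_choice[where P="\<lambda>_ x. x \<in> A" and Q="\<lambda>n x y. x \<le> y \<and> real n \<le> y"])
        show "\<exists>x. x \<in> A" using that by auto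
        show "\<exists>y. y \<in> A \<and> x \<le> y \<and> real n \<le> y" if "x \<in> A" for x n
          using unb[rule_format, of "max x (real n)"] by (auto intro: less_imp_le)
      qed
      then obtain a where a: "\<And>n. a n \<in> A" "\<And>n. a n \<le> a (Suc n)" "\<And>n. real n \<le> a (Suc n)"
        by blast
      have "\<exists>n. x \<le> a n" for x
        using a(3) real_arch_simple[of x] order_trans by blast
      then show ?thesis using a by (intro exI[of _ a]) (auto intro: incseq_SucI)
    next
      case True
      show ?thesis
      proof (cases "Sup A \<in> A")
        case T: True
        then show ?thesis using True
          by (intro exI[of _ "\<lambda>_. Sup A"]) (auto simp: incseq_def cSup_upper)
      next
        case False
        have lt: "x < Sup A" if "x \<in> A" for x
          using cSup_upper[OF that True] False that by (cases "x = Sup A") auto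
        have "\<exists>a. \<forall>n. a n \<in> A \<and> (a n \<le> a (Suc n) \<and> Sup A - 1 / real (Suc n) \<le> a (Suc n))"
        proof (rule dependent_nat_choice[where P="\<lambda>_ x. x \<in> A" and
              Q="\<lambda>n x y. x \<le> y \<and> Sup A - 1 / real (Suc n) \<le> y"])
          show "\<exists>x. x \<in> A" using that by auto
          show "\<exists>y. y \<in> A \<and> x \<le> y \<and> Sup A - 1 / real (Suc n) \<le> y" if xA: "x \<in> A" for x n
          proof -
            have "max x (Sup A - 1 / real (Suc n)) < Sup A" using lt[OF xA] by simp
            then have "\<exists>y\<in>A. max x (Sup A - 1 / real (Suc n)) < y"
              by (rule less_cSup_iff[OF \<open>A \<noteq> {}\<close> True, THEN iffD1])
            then obtain y where "y \<in> A" "max x (Sup A - 1 / real (Suc n)) < y" by blast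
            then show ?thesis by (intro exI[of _ y]) auto
          qed
        qed
        then obtain a where a: "\<And>n. a n \<in> A" "\<And>n. a n \<le> a (Suc n)"
          "\<And>n. Sup A - 1 / real (Suc n) \<le> a (Suc n)" by blast
        have "\<exists>n. x \<le> a n" if xA: "x \<in> A" for x
        proof -
          have "0 < Sup A - x" using lt[OF xA] by simp
          then obtain n where "1 / real (Suc n) < Sup A - x" by (rule nat_approx_posE)
          then have "x \<le> a (Suc n)" using a(3)[of n] by linarith
          then show ?thesis ..
        qed
        moreover have "incseq a" using a(2) by (rule incseq_SucI)
        ultimately show ?thesis using a(1) by (intro exI[of _ a]) blast
      qed
    qed
    then obtain a where a: "incseq a" "range a \<subseteq> A" "\<And>x. x \<in> A \<Longrightarrow> \<exists>n::nat. x \<le> a n" by blast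
    have "(\<lambda>n. emeasure lborel (A \<inter> {..a n})) \<longlonglongrightarrow> emeasure lborel (\<Union>n. A \<inter> {..a n})"
      using that a(1) by (intro Lim_emeasure_incseq) (auto simp: incseq_def intro: order_trans)
    moreover have "(\<Union>n. A \<inter> {..a n}) = A" using a(3) by auto
    ultimately show ?thesis using a(2) by auto
  qed
  obtain a where a: "range a \<subseteq> A" "(\<lambda>n::nat. emeasure lborel (A \<inter> {..a n})) \<longlonglongrightarrow> emeasure lborel A"
    using supA[OF A] by blast
  have neg: "emeasure lborel (uminus -` X) = emeasure lborel X" if "X \<in> sets lborel" for X :: "real set"
  proof -
    have "emeasure lborel X = emeasure (distr lborel borel uminus) X"
      using lborel_distr_uminus by simp
    also have "\<dots> = emeasure lborel (uminus -` X)"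
      using that by (simp add: emeasure_distr)
    finally show ?thesis by simp
  qed
  have B': "uminus -` B \<in> sets lborel" "uminus -` B \<noteq> {}"
  proof -
    show "uminus -` B \<in> sets lborel" using B(1) by (auto intro!: measurable_sets_borel)
    obtain x where "x \<in> B" using B(2) by auto
    then have "- x \<in> uminus -` B" by simp
    then show "uminus -` B \<noteq> {}" by blast
  qed
  obtain b where b: "range b \<subseteq> uminus -` B"
    "(\<lambda>n::nat. emeasure lborel (uminus -` B \<inter> {..b n})) \<longlonglongrightarrow> emeasure lborel (uminus -` B)"
    using supA[OF B'] by blast
  have eq: "emeasure lborel (uminus -` B \<inter> {..b n}) = emeasure lborel (B \<inter> {- b n..})" for n
  proof -
    have "uminus -` (B \<inter> {- b n..}) = uminus -` B \<inter> {..b n}" by auto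
    then show ?thesis using neg[of "B \<inter> {- b n..}"] B(1) by simp
  qed
  have lim: "(\<lambda>n. emeasure lborel (A \<inter> {..a n}) + emeasure lborel (B \<inter> {- b n..}))
     \<longlonglongrightarrow> emeasure lborel A + emeasure lborel B"
    using tendsto_add[OF a(2) b(2)] unfolding eq neg[OF B(1)] .
  have "emeasure lborel (A \<inter> {..a n}) + emeasure lborel (B \<inter> {- b n..}) \<le> 2 * emeasure lborel C" for n
    using a(1) b(1) by (intro cut) auto
  then show ?thesis
    by (intro LIMSEQ_le_const2[OF lim]) auto
qed

text \<open>
  Only the levels in the unit interval are integrated: an equality for functions bounded by \<open>1\<close>,
  and an inequality in the direction that is needed for an unbounded majorant.
\<close>

lemma nn_integral_unit_layers:
  fixes h :: "real \<Rightarrow> ennreal"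
  assumes [measurable]: "h \<in> borel_measurable borel"
  shows "(\<integral>\<^sup>+u. emeasure lborel {x. ennreal u < h x} * indicator {0<..<1} u \<partial>lborel) \<le> (\<integral>\<^sup>+x. h x \<partial>lborel)"
    and "(\<And>x. h x \<le> 1) \<Longrightarrow>
      (\<integral>\<^sup>+u. emeasure lborel {x. ennreal u < h x} * indicator {0<..<1} u \<partial>lborel) = (\<integral>\<^sup>+x. h x \<partial>lborel)"
proof -
  let ?I = "\<lambda>x u. indicator {x. ennreal u < h x} x * indicator {0<..<1} u :: ennreal"
  have "(\<integral>\<^sup>+u. emeasure lborel {x. ennreal u < h x} * indicator {0<..<1} u \<partial>lborel)
      = (\<integral>\<^sup>+u. \<integral>\<^sup>+x. ?I x u \<partial>lborel \<partial>lborel)"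
    by (subst nn_integral_multc) (auto)
  also have "\<dots> = (\<integral>\<^sup>+x. \<integral>\<^sup>+u. ?I x u \<partial>lborel \<partial>lborel)"
    by (rule lborel_pair.Fubini') (measurable)
  finally have eq: "(\<integral>\<^sup>+u. emeasure lborel {x. ennreal u < h x} * indicator {0<..<1} u \<partial>lborel)
     = (\<integral>\<^sup>+x. \<integral>\<^sup>+u. ?I x u \<partial>lborel \<partial>lborel)" .
  have inner: "(\<integral>\<^sup>+u. ?I x u \<partial>lborel) = min 1 (h x)" for x
  proof (cases "h x \<ge> 1")
    case True
    have "(\<integral>\<^sup>+u. ?I x u \<partial>lborel) = (\<integral>\<^sup>+u. indicator {0<..<1::real} u \<partial>lborel)"
      using True by (intro nn_integral_cong)
        (auto split: split_indicator intro: less_le_trans[of "ennreal _" 1])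
    then show ?thesis using True by (simp add: min_absorb1)
  next
    case False
    then obtain r where r: "h x = ennreal r" "0 \<le> r" "r < 1"
      by (cases "h x") (auto simp: not_le)
    have "(\<integral>\<^sup>+u. ?I x u \<partial>lborel) = (\<integral>\<^sup>+u. indicator {0<..<r} u \<partial>lborel)"
      using r by (intro nn_integral_cong) (auto split: split_indicator simp: ennreal_less_iff)
    then show ?thesis using r by (simp add: min_def)
  qed
  show "(\<integral>\<^sup>+u. emeasure lborel {x. ennreal u < h x} * indicator {0<..<1} u \<partial>lborel) \<le> (\<integral>\<^sup>+x. h x \<partial>lborel)"
    unfolding eq inner by (intro nn_integral_mono) simp
  show "(\<integral>\<^sup>+u. emeasure lborel {x. ennreal u < h x} * indicator {0<..<1} u \<partial>lborel) = (\<integral>\<^sup>+x. h x \<partial>lborel)"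
    if "\<And>x. h x \<le> 1"
    unfolding eq inner using that by (simp add: min_absorb2)
qed

lemma ennreal_four_mult_le_square_add: "4 * (a * b) \<le> (a + b)\<^sup>2" for a b :: ennreal
proof (cases "a = top \<or> b = top")
  case True
  then have "(a + b)\<^sup>2 = top" by (auto simp: power2_eq_square)
  then show ?thesis by simp
next
  case False
  then obtain x y where "a = ennreal x" "0 \<le> x" "b = ennreal y" "0 \<le> y"
    by (metis ennreal_cases)
  moreover have "4 * (x * y) \<le> (x + y)\<^sup>2"
    using sum_squares_bound[of x y] by (simp add: power2_eq_square algebra_simps)
  moreover have "4 * (ennreal x * ennreal y) = ennreal (4 * (x * y))" "(ennreal x + ennreal y)\<^sup>2 = ennreal ((x + y)\<^sup>2)"
    if "0 \<le> x" "0 \<le> y"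
    using that by (simp_all add: ennreal_mult ennreal_power flip: ennreal_plus)
  ultimately show ?thesis by (simp add: ennreal_leI)
qed

text \<open>
  Since both suprema are \<open>1\<close>, at every level in \<open>(0, 1)\<close> the superlevel sets of \<open>f\<close> and \<open>g\<close> are
  nonempty, so that the Brunn-Minkowski inequality compares them with the superlevel set of \<open>h\<close>.
\<close>

lemma prekopa_leindler_real_unit:
  fixes f g h :: "real \<Rightarrow> ennreal"
  assumes [measurable]: "f \<in> borel_measurable borel" "g \<in> borel_measurable borel" "h \<in> borel_measurable borel"
    and f1: "(SUP x. f x) = 1" and g1: "(SUP x. g x) = 1"
    and mid: "\<And>x y. f x * g y \<le> (h ((x + y) / 2))\<^sup>2"
  shows "(\<integral>\<^sup>+x. f x \<partial>lborel) + (\<integral>\<^sup>+x. g x \<partial>lborel) \<le> 2 * (\<integral>\<^sup>+x. h x \<partial>lborel)"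
proof -
  have le1: "f x \<le> 1" "g x \<le> 1" for x
    using f1 g1 by (metis SUP_upper UNIV_I)+
  have lev: "emeasure lborel {x. ennreal u < f x} + emeasure lborel {x. ennreal u < g x}
       \<le> 2 * emeasure lborel {x. ennreal u < h x}" if "0 < u" "u < 1" for u
  proof (rule brunn_minkowski_midpoint_real)
    have "ennreal u < 1" using that by (simp add: ennreal_less_one_iff)
    then show "{x. ennreal u < f x} \<noteq> {}" "{x. ennreal u < g x} \<noteq> {}"
      using f1 g1 less_SUP_iff[of "ennreal u" f UNIV] less_SUP_iff[of "ennreal u" g UNIV] by auto
    fix a b assume ab: "a \<in> {x. ennreal u < f x}" "b \<in> {x. ennreal u < g x}"
    obtain r s where rs: "f a = ennreal r" "0 \<le> r" "g b = ennreal s" "0 \<le> s"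
      using le1[of a] le1[of b] by (metis ennreal_cases ennreal_one_less_top not_le)
    have "u * u < r * s"
      using ab rs that by (intro mult_strict_mono) (auto simp: ennreal_less_iff)
    then have "(ennreal u)\<^sup>2 < f a * g b"
      using rs that by (simp add: power2_eq_square ennreal_less_iff flip: ennreal_mult)
    also have "\<dots> \<le> (h ((a + b) / 2))\<^sup>2" by (rule mid)
    finally have "ennreal u < h ((a + b) / 2)"
      by (metis (no_types) not_less power_mono zero_le)
    then show "(a + b) / 2 \<in> {x. ennreal u < h x}" by simp
  qed auto
  let ?J = "\<lambda>k u. emeasure lborel {x. ennreal u < k x} * indicator {0<..<1} u"
  have "(\<integral>\<^sup>+x. f x \<partial>lborel) + (\<integral>\<^sup>+x. g x \<partial>lborel) = (\<integral>\<^sup>+u. ?J f u \<partial>lborel) + (\<integral>\<^sup>+u. ?J g u \<partial>lborel)"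
    using le1 by (simp add: nn_integral_unit_layers(2))
  also have "\<dots> = (\<integral>\<^sup>+u. ?J f u + ?J g u \<partial>lborel)"
    by (rule nn_integral_add[symmetric]) measurable
  also have "\<dots> \<le> (\<integral>\<^sup>+u. 2 * ?J h u \<partial>lborel)"
    using lev by (intro nn_integral_mono) (auto split: split_indicator)
  also have "\<dots> = 2 * (\<integral>\<^sup>+u. ?J h u \<partial>lborel)"
    by (rule nn_integral_cmult) measurable
  also have "\<dots> \<le> 2 * (\<integral>\<^sup>+x. h x \<partial>lborel)"
    by (intro mult_left_mono nn_integral_unit_layers(1)) auto
  finally show ?thesis .
qed

text \<open>
  Dividing \<open>f\<close> and \<open>g\<close> by their suprema and \<open>h\<close> by the geometric mean of the two reduces to
  normalised functions; the arithmetic-geometric mean inequality turns the sum into a product.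
\<close>

lemma prekopa_leindler_real_bounded:
  fixes f g h :: "real \<Rightarrow> ennreal"
  assumes [measurable]: "f \<in> borel_measurable borel" "g \<in> borel_measurable borel" "h \<in> borel_measurable borel"
    and fb: "\<And>x. f x \<le> of_nat n" and gb: "\<And>x. g x \<le> of_nat k"
    and mid: "\<And>x y. f x * g y \<le> (h ((x + y) / 2))\<^sup>2"
  shows "(\<integral>\<^sup>+x. f x \<partial>lborel) * (\<integral>\<^sup>+x. g x \<partial>lborel) \<le> (\<integral>\<^sup>+x. h x \<partial>lborel)\<^sup>2"
proof (cases "(\<forall>x. f x = 0) \<or> (\<forall>x. g x = 0)")
  case True
  then have "(\<integral>\<^sup>+x. f x \<partial>lborel) = 0 \<or> (\<integral>\<^sup>+x. g x \<partial>lborel) = 0"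
    by (elim disjE) simp_all
  then show ?thesis by (elim disjE) simp_all
next
  case False
  define F G where "F = (SUP x. f x)" and "G = (SUP x. g x)"
  have "F \<le> of_nat n" "G \<le> of_nat k" unfolding F_def G_def using fb gb by (auto intro: SUP_least)
  then have fin: "F \<noteq> top" "G \<noteq> top"
    using of_nat_less_top by (metis leD)+
  have pos: "F \<noteq> 0" "G \<noteq> 0"
    using False SUP_upper[of _ UNIV f] SUP_upper[of _ UNIV g] unfolding F_def G_def
    by (metis UNIV_I le_zero_eq)+
  obtain F' G' where F': "F = ennreal F'" "0 < F'" and G': "G = ennreal G'" "0 < G'"
    using fin pos by (metis ennreal_cases ennreal_0 less_eq_real_def)
  define r where "r = ennreal (sqrt (F' * G'))"
  have r2: "r\<^sup>2 = F * G"
    using F' G' by (simp add: r_def ennreal_power ennreal_mult)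
  have r0: "r \<noteq> 0" "r \<noteq> top" using F' G' by (simp_all add: r_def ennreal_eq_0_iff not_le)
  have inv: "F * inverse F = 1" "G * inverse G = 1" "r * inverse r = 1"
    using fin pos r0 by (simp_all add: ennreal_mult_divide_eq divide_ennreal_def[symmetric] ennreal_divide_self top.not_eq_extremum)
  have inv_r: "inverse F * inverse G = (inverse r)\<^sup>2"
  proof -
    have "inverse F * inverse G = ennreal (inverse F') * ennreal (inverse G')"
      using F' G' by (simp add: inverse_ennreal)
    also have "\<dots> = ennreal (inverse F' * inverse G')"
      using F' G' by (intro ennreal_mult[symmetric]) simp_all
    also have "inverse F' * inverse G' = (inverse (sqrt (F' * G')))\<^sup>2"
      using F' G' by (simp add: power_inverse)
    also have "ennreal \<dots> = (ennreal (inverse (sqrt (F' * G'))))\<^sup>2"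
      using F' G' by (intro ennreal_power[symmetric]) simp
    also have "ennreal (inverse (sqrt (F' * G'))) = inverse r"
      using F' G' unfolding r_def by (intro inverse_ennreal[symmetric]) simp
    finally show ?thesis .
  qed
  have "(\<integral>\<^sup>+x. f x * inverse F \<partial>lborel) + (\<integral>\<^sup>+x. g x * inverse G \<partial>lborel)
      \<le> 2 * (\<integral>\<^sup>+x. h x * inverse r \<partial>lborel)"
  proof (rule prekopa_leindler_real_unit)
    show "(SUP x. f x * inverse F) = 1" "(SUP x. g x * inverse G) = 1"
      using inv by (simp_all add: SUP_mult_right_ennreal[symmetric] F_def[symmetric] G_def[symmetric])
    fix x y
    have "f x * inverse F * (g y * inverse G) = f x * g y * (inverse r)\<^sup>2"
      unfolding inv_r[symmetric] by (simp add: mult_ac)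
    also have "\<dots> \<le> (h ((x + y) / 2))\<^sup>2 * (inverse r)\<^sup>2"
      by (intro mult_right_mono mid) simp
    finally show "f x * inverse F * (g y * inverse G) \<le> (h ((x + y) / 2) * inverse r)\<^sup>2"
      by (simp add: power_mult_distrib)
  qed measurable
  then have sum: "(\<integral>\<^sup>+x. f x \<partial>lborel) * inverse F + (\<integral>\<^sup>+x. g x \<partial>lborel) * inverse G
      \<le> 2 * ((\<integral>\<^sup>+x. h x \<partial>lborel) * inverse r)"
    by (simp add: nn_integral_multc)
  define a b c where "a = (\<integral>\<^sup>+x. f x \<partial>lborel) * inverse F" and "b = (\<integral>\<^sup>+x. g x \<partial>lborel) * inverse G"
    and "c = (\<integral>\<^sup>+x. h x \<partial>lborel) * inverse r"
  have "4 * (a * b) \<le> (a + b)\<^sup>2" by (rule ennreal_four_mult_le_square_add)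
  also have "\<dots> \<le> (2 * c)\<^sup>2" using sum unfolding a_def b_def c_def by (intro power_mono) auto
  also have "\<dots> = 4 * c\<^sup>2" by (simp add: power_mult_distrib)
  finally have ab: "a * b \<le> c\<^sup>2" by (simp add: ennreal_mult_le_mult_iff)
  have "(\<integral>\<^sup>+x. f x \<partial>lborel) * (\<integral>\<^sup>+x. g x \<partial>lborel) = (a * b) * (F * G)"
  proof -
    have "(a * b) * (F * G) = (\<integral>\<^sup>+x. f x \<partial>lborel) * (\<integral>\<^sup>+x. g x \<partial>lborel) * (F * inverse F) * (G * inverse G)"
      unfolding a_def b_def by (simp only: mult_ac)
    then show ?thesis using inv by simp
  qed
  also have "\<dots> \<le> c\<^sup>2 * r\<^sup>2" unfolding r2 by (intro mult_right_mono ab) simp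
  also have "\<dots> = (\<integral>\<^sup>+x. h x \<partial>lborel)\<^sup>2 * (r * inverse r)\<^sup>2"
    unfolding c_def by (simp only: power_mult_distrib mult_ac)
  finally show ?thesis using inv by simp
qed

lemma nn_integral_eq_SUP_truncations:
  assumes [measurable]: "f \<in> borel_measurable M"
  shows "(\<integral>\<^sup>+x. f x \<partial>M) = (SUP n. \<integral>\<^sup>+x. min (f x) (of_nat n) \<partial>M)"
proof -
  have "(SUP n. min (f x) (of_nat n)) = f x" for x
  proof (cases "f x")
    case (real r)
    obtain n where "r \<le> real n" using real_arch_simple by blast
    then have "min (f x) (of_nat n) = f x"
      using real by (simp add: min_def ennreal_of_nat_eq_real_of_nat ennreal_leI)
    then show ?thesis by (intro antisym SUP_least SUP_upper2[of n]) auto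
  next
    case top
    then show ?thesis by (simp add: ennreal_SUP_of_nat_eq_top)
  qed
  then have "(\<integral>\<^sup>+x. f x \<partial>M) = (\<integral>\<^sup>+x. (SUP n. min (f x) (of_nat n)) \<partial>M)" by simp
  also have "\<dots> = (SUP n. \<integral>\<^sup>+x. min (f x) (of_nat n) \<partial>M)"
    by (rule nn_integral_monotone_convergence_SUP)
       (auto simp: incseq_def le_fun_def min.coboundedI2)
  finally show ?thesis .
qed

lemma SUP_times_SUP_le_ennreal:
  fixes a b :: "nat \<Rightarrow> ennreal"
  assumes "\<And>n k. a n * b k \<le> c"
  shows "(SUP n. a n) * (SUP k. b k) \<le> c"
proof -
  have "a n * (SUP k. b k) \<le> c" for n
    by (subst SUP_mult_left_ennreal) (intro SUP_least assms)
  then show ?thesis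
    by (subst SUP_mult_right_ennreal) (intro SUP_least)
qed

lemma prekopa_leindler_real:
  fixes f g h :: "real \<Rightarrow> ennreal"
  assumes [measurable]: "f \<in> borel_measurable borel" "g \<in> borel_measurable borel" "h \<in> borel_measurable borel"
    and mid: "\<And>x y. f x * g y \<le> (h ((x + y) / 2))\<^sup>2"
  shows "(\<integral>\<^sup>+x. f x \<partial>lborel) * (\<integral>\<^sup>+x. g x \<partial>lborel) \<le> (\<integral>\<^sup>+x. h x \<partial>lborel)\<^sup>2"
proof -
  have "(\<integral>\<^sup>+x. min (f x) (of_nat n) \<partial>lborel) * (\<integral>\<^sup>+x. min (g x) (of_nat k) \<partial>lborel)
      \<le> (\<integral>\<^sup>+x. h x \<partial>lborel)\<^sup>2" for n k :: nat
  proof (rule prekopa_leindler_real_bounded)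
    show "min (f x) (of_nat n) * min (g y) (of_nat k) \<le> (h ((x + y) / 2))\<^sup>2" for x y
      by (rule order_trans[OF mult_mono mid]) auto
  qed (auto intro!: min.cobounded2)
  moreover have "(\<integral>\<^sup>+x. f x \<partial>lborel) = (SUP n. \<integral>\<^sup>+x. min (f x) (of_nat n) \<partial>lborel)"
    by (rule nn_integral_eq_SUP_truncations) simp
  moreover have "(\<integral>\<^sup>+x. g x \<partial>lborel) = (SUP n. \<integral>\<^sup>+x. min (g x) (of_nat n) \<partial>lborel)"
    by (rule nn_integral_eq_SUP_truncations) simp
  ultimately show ?thesis
    using SUP_times_SUP_le_ennreal[of "\<lambda>n. \<integral>\<^sup>+x. min (f x) (of_nat n) \<partial>lborel"
        "\<lambda>n. \<integral>\<^sup>+x. min (g x) (of_nat n) \<partial>lborel" "(\<integral>\<^sup>+x. h x \<partial>lborel)\<^sup>2"] by simp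
qed

text \<open>
  Induction on the coordinates: for fixed values \<open>s\<close>, \<open>t\<close> and \<open>(s + t) / 2\<close> of the new
  coordinate the induction hypothesis is the one-dimensional hypothesis for the integrals over
  the other coordinates. The squared form avoids roots of extended reals.
\<close>

lemma prekopa_leindler_PiM:
  fixes f g h :: "('i \<Rightarrow> real) \<Rightarrow> ennreal"
  assumes "finite I"
    and "f \<in> borel_measurable (\<Pi>\<^sub>M i\<in>I. lborel)" "g \<in> borel_measurable (\<Pi>\<^sub>M i\<in>I. lborel)"
        "h \<in> borel_measurable (\<Pi>\<^sub>M i\<in>I. lborel)"
    and "\<And>x y. x \<in> space (\<Pi>\<^sub>M i\<in>I. (lborel :: real measure)) \<Longrightarrow> y \<in> space (\<Pi>\<^sub>M i\<in>I. (lborel :: real measure)) \<Longrightarrow>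
        f x * g y \<le> (h (\<lambda>i\<in>I. (x i + y i) / 2))\<^sup>2"
  shows "(\<integral>\<^sup>+x. f x \<partial>(\<Pi>\<^sub>M i\<in>I. lborel)) * (\<integral>\<^sup>+x. g x \<partial>(\<Pi>\<^sub>M i\<in>I. lborel))
     \<le> (\<integral>\<^sup>+x. h x \<partial>(\<Pi>\<^sub>M i\<in>I. lborel))\<^sup>2"
  using assms
proof (induction I arbitrary: f g h rule: finite_induct)
  case empty
  interpret product_sigma_finite "\<lambda>_::'i. lborel :: real measure" by standard
  have "f (\<lambda>_. undefined) * g (\<lambda>_. undefined) \<le> (h (\<lambda>i\<in>{}. (undefined + undefined) / 2))\<^sup>2"
    by (rule empty.prems(4)) simp_all
  also have "(\<lambda>i\<in>{}. (undefined + undefined) / 2) = (\<lambda>_::'i. undefined :: real)" by (simp add: restrict_def)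
  finally show ?case
    by (subst (1 2 3) nn_integral_empty) simp_all
next
  case (insert i I)
  interpret product_sigma_finite "\<lambda>_::'i. lborel :: real measure" by standard
  note [measurable] = insert.prems(1-3)
  let ?M = "\<Pi>\<^sub>M i\<in>I. (lborel :: real measure)"
  have upd: "(\<lambda>j\<in>insert i I. ((x(i := s)) j + (y(i := t)) j) / 2) = (\<lambda>j\<in>I. (x j + y j) / 2)(i := (s + t) / 2)"
    for x y :: "'i \<Rightarrow> real" and s t
    using insert.hyps by (auto simp: fun_eq_iff restrict_def)
  have sp: "x(i := s) \<in> space (\<Pi>\<^sub>M i\<in>insert i I. (lborel :: real measure))" if "x \<in> space ?M" for x s
    using that insert.hyps by (auto simp: space_PiM PiE_def extensional_def)
  have m_upd: "(\<lambda>x. x(i := s)) \<in> measurable ?M (\<Pi>\<^sub>M i\<in>insert i I. lborel)" for s :: real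
    by (rule measurable_fun_upd[where J=I]) auto
  interpret M: sigma_finite_measure ?M by (rule sigma_finite[OF insert.hyps(1)])
  have m_int: "(\<lambda>t. \<integral>\<^sup>+x. k (x(i := t)) \<partial>?M) \<in> borel_measurable borel"
    if k: "k \<in> borel_measurable (\<Pi>\<^sub>M i\<in>insert i I. lborel)" for k :: "('i \<Rightarrow> real) \<Rightarrow> ennreal"
  proof -
    have "(\<lambda>(t, x). k (x(i := t))) \<in> borel_measurable (lborel \<Otimes>\<^sub>M ?M)"
      unfolding case_prod_beta
      by (rule measurable_compose[OF _ k], rule measurable_fun_upd[where J=I]) auto
    then show ?thesis
      by (intro M.borel_measurable_nn_integral) simp
  qed
  have "(\<integral>\<^sup>+t. (\<integral>\<^sup>+x. f (x(i := t)) \<partial>?M) \<partial>lborel) * (\<integral>\<^sup>+t. (\<integral>\<^sup>+x. g (x(i := t)) \<partial>?M) \<partial>lborel)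
     \<le> (\<integral>\<^sup>+t. (\<integral>\<^sup>+x. h (x(i := t)) \<partial>?M) \<partial>lborel)\<^sup>2"
  proof (rule prekopa_leindler_real)
    fix s t
    show "(\<integral>\<^sup>+x. f (x(i := s)) \<partial>?M) * (\<integral>\<^sup>+x. g (x(i := t)) \<partial>?M)
       \<le> (\<integral>\<^sup>+x. h (x(i := (s + t) / 2)) \<partial>?M)\<^sup>2"
    proof (rule insert.IH)
      show "f (x(i := s)) * g (y(i := t)) \<le> (h ((\<lambda>j\<in>I. (x j + y j) / 2)(i := (s + t) / 2)))\<^sup>2"
        if "x \<in> space ?M" "y \<in> space ?M" for x y
        using insert.prems(4)[OF sp[OF that(1)] sp[OF that(2)], of s t] unfolding upd .
    qed (rule measurable_compose[OF m_upd], rule insert.prems)+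
  qed (rule m_int, rule insert.prems)+
  then show ?case
    by (simp only: product_nn_integral_insert_rev[OF insert.hyps insert.prems(1)]
        product_nn_integral_insert_rev[OF insert.hyps insert.prems(2)]
        product_nn_integral_insert_rev[OF insert.hyps insert.prems(3)])
qed

section \<open>Tails and moments of log-concave measures\<close>

lemma space_Rd: "space (Rd d) = {..<d} \<rightarrow>\<^sub>E UNIV"
  by (simp add: Rd_def space_PiM)

text \<open>
  The density is measurable only for the completed Lebesgue measure, and modifying it on a null
  set would destroy convexity. It is therefore enclosed between a Borel minorant, used for \<open>A\<close>
  and \<open>B\<close>, and a Borel majorant, used for \<open>C\<close>, both equal to it almost everywhere. Smaller
  functions on the left and a larger one on the right preserve the pointwise hypothesis of the
  Prekopa-Leindler inequality.
\<close>

lemma log_concave_midpoint: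
  assumes lc: "log_concave_measure d \<mu>"
    and A: "A \<in> sets \<mu>" and B: "B \<in> sets \<mu>" and C: "C \<in> sets \<mu>"
    and mid: "\<And>x y. x \<in> A \<Longrightarrow> y \<in> B \<Longrightarrow> (\<lambda>i\<in>{..<d}. (x i + y i) / 2) \<in> C"
  shows "emeasure \<mu> A * emeasure \<mu> B \<le> (emeasure \<mu> C)\<^sup>2"
proof -
  obtain V where V: "Rd_convex_fun d V" "V \<in> borel_measurable (completion (Rd d))"
    and dens: "\<And>A. A \<in> sets \<mu> \<Longrightarrow> emeasure \<mu> A = (\<integral>\<^sup>+x\<in>A. exp_minus (V x) \<partial>completion (Rd d))"
    and sets: "sets \<mu> = sets (Rd d)"
    using lc by (auto simp: log_concave_measure_def)
  note [measurable] = V(2)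
  have [measurable]: "exp_minus \<in> borel_measurable borel"
    unfolding exp_minus_def by measurable
  have "(\<lambda>x. exp_minus (V x)) \<in> borel_measurable (completion (Rd d))" by measurable
  then obtain w where w[measurable]: "w \<in> borel_measurable (Rd d)" and aew: "AE x in Rd d. exp_minus (V x) = w x"
    using completion_ex_borel_measurable by blast
  obtain N where N: "{x \<in> space (Rd d). exp_minus (V x) \<noteq> w x} \<subseteq> N" "emeasure (Rd d) N = 0" "N \<in> sets (Rd d)"
    using AE_E[OF aew] by auto
  note [measurable] = N(3)
  define lo hi :: "(nat \<Rightarrow> real) \<Rightarrow> ennreal"
    where "lo x = (if x \<in> N then 0 else w x)" and "hi x = (if x \<in> N then top else w x)" for x
  have [measurable]: "lo \<in> borel_measurable (Rd d)" "hi \<in> borel_measurable (Rd d)"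
    unfolding lo_def hi_def by measurable
  have lo: "lo x \<le> exp_minus (V x)" and hi: "exp_minus (V x) \<le> hi x" if "x \<in> space (Rd d)" for x
    using N(1) that by (auto simp: lo_def hi_def)
  have aeN: "AE x in Rd d. x \<notin> N"
    using N by (intro AE_not_in) (auto simp: null_sets_def)
  have em: "emeasure \<mu> X = (\<integral>\<^sup>+x. lo x * indicator X x \<partial>Rd d)" "emeasure \<mu> X = (\<integral>\<^sup>+x. hi x * indicator X x \<partial>Rd d)"
    if "X \<in> sets \<mu>" for X
  proof -
    have "emeasure \<mu> X = (\<integral>\<^sup>+x. exp_minus (V x) * indicator X x \<partial>Rd d)"
      using dens[OF that] by (simp add: nn_integral_completion)
    moreover have "(\<integral>\<^sup>+x. exp_minus (V x) * indicator X x \<partial>Rd d) = (\<integral>\<^sup>+x. lo x * indicator X x \<partial>Rd d)"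
      using aew aeN by (intro nn_integral_cong_AE) (auto simp: lo_def)
    moreover have "(\<integral>\<^sup>+x. exp_minus (V x) * indicator X x \<partial>Rd d) = (\<integral>\<^sup>+x. hi x * indicator X x \<partial>Rd d)"
      using aew aeN by (intro nn_integral_cong_AE) (auto simp: hi_def)
    ultimately show "emeasure \<mu> X = (\<integral>\<^sup>+x. lo x * indicator X x \<partial>Rd d)"
      "emeasure \<mu> X = (\<integral>\<^sup>+x. hi x * indicator X x \<partial>Rd d)" by simp_all
  qed
  have conv: "exp_minus (V x) * exp_minus (V y) \<le> (exp_minus (V (\<lambda>i\<in>{..<d}. (x i + y i) / 2)))\<^sup>2"
    if xy: "x \<in> space (Rd d)" "y \<in> space (Rd d)" for x y
  proof (cases "V x = \<infinity> \<or> V y = \<infinity>")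
    case True
    then show ?thesis by (auto simp: exp_minus_def)
  next
    case False
    let ?z = "\<lambda>i\<in>{..<d}. (x i + y i) / 2"
    have z: "(\<lambda>i\<in>{..<d}. (1 - 1/2) * x i + 1/2 * y i) = ?z"
      by (auto simp: fun_eq_iff restrict_def field_simps)
    have "V ?z \<le> ereal (1 - 1/2) * V x + ereal (1/2) * V y"
      using V(1) xy unfolding Rd_convex_fun_def z[symmetric]
      by (elim conjE) (drule (1) bspec, drule (1) bspec, drule spec[of _ "1/2"], simp)
    moreover have "V x \<noteq> -\<infinity>" "V y \<noteq> -\<infinity>" "V ?z \<noteq> -\<infinity>"
      using V(1) xy unfolding Rd_convex_fun_def by (auto simp: space_Rd)
    ultimately obtain a b c where abc: "V x = ereal a" "V y = ereal b" "V ?z = ereal c" "c \<le> (a + b) / 2"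
      using False by (cases "V x"; cases "V y"; cases "V ?z") (auto simp: field_simps)
    have "exp (- a) * exp (- b) \<le> (exp (- c))\<^sup>2"
      using abc(4) by (simp add: exp_add[symmetric] exp_double[symmetric])
    then show ?thesis
      unfolding abc exp_minus_def by (simp add: ennreal_power flip: ennreal_mult)
  qed
  note [measurable] = A[unfolded sets] B[unfolded sets] C[unfolded sets]
  have "(\<integral>\<^sup>+x. lo x * indicator A x \<partial>Rd d) * (\<integral>\<^sup>+x. lo x * indicator B x \<partial>Rd d)
      \<le> (\<integral>\<^sup>+x. hi x * indicator C x \<partial>Rd d)\<^sup>2"
    unfolding Rd_def
  proof (rule prekopa_leindler_PiM)
    fix x y assume "x \<in> space (Pi\<^sub>M {..<d} (\<lambda>i. lborel :: real measure))" "y \<in> space (Pi\<^sub>M {..<d} (\<lambda>i. lborel :: real measure))"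
    then have xy: "x \<in> space (Rd d)" "y \<in> space (Rd d)" by (simp_all add: Rd_def)
    let ?z = "\<lambda>i\<in>{..<d}. (x i + y i) / 2"
    have z: "?z \<in> space (Rd d)" by (auto simp: space_Rd)
    show "lo x * indicator A x * (lo y * indicator B y) \<le> (hi ?z * indicator C ?z)\<^sup>2"
    proof (cases "x \<in> A \<and> y \<in> B")
      case True
      have "lo x * lo y \<le> exp_minus (V x) * exp_minus (V y)"
        by (intro mult_mono lo xy) auto
      also have "\<dots> \<le> (exp_minus (V ?z))\<^sup>2" by (rule conv[OF xy])
      also have "\<dots> \<le> (hi ?z)\<^sup>2" by (intro power_mono hi z) auto
      finally show ?thesis using True mid by simp
    qed auto
  qed (use A B C in \<open>auto simp: Rd_def[symmetric] sets\<close>)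
  then show ?thesis using em A B C by simp
qed

text \<open>
  Borell's argument: if a linear functional is at least \<open>3 t\<close> in absolute value at one point and
  less than \<open>t\<close> at another, then it is at least \<open>t\<close> in absolute value at their midpoint.
\<close>

lemma log_concave_tail_step:
  fixes u :: "nat \<Rightarrow> real"
  assumes lc: "log_concave_measure d \<mu>" and t: "0 \<le> t"
  defines "T \<equiv> \<lambda>t. measure \<mu> {x \<in> space \<mu>. t \<le> \<bar>\<Sum>i<d. u i * x i\<bar>}"
  shows "T (3 * t) * (1 - T t) \<le> (T t)\<^sup>2"
proof -
  interpret prob_space \<mu> using lc by (auto simp: log_concave_measure_def)
  have sets: "sets \<mu> = sets (Rd d)" using lc by (auto simp: log_concave_measure_def)
  have sp: "space \<mu> = space (Rd d)" by (rule sets_eq_imp_space_eq[OF sets])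
  let ?l = "\<lambda>x. \<Sum>i<d. u i * x i"
  have [measurable]: "?l \<in> borel_measurable \<mu>"
    unfolding measurable_cong_sets[OF sets refl] Rd_def by measurable
  let ?A = "{x \<in> space \<mu>. 3 * t \<le> \<bar>?l x\<bar>}" and ?B = "{x \<in> space \<mu>. \<bar>?l x\<bar> < t}" and ?C = "{x \<in> space \<mu>. t \<le> \<bar>?l x\<bar>}"
  have "emeasure \<mu> ?A * emeasure \<mu> ?B \<le> (emeasure \<mu> ?C)\<^sup>2"
  proof (rule log_concave_midpoint[OF lc])
    fix x y assume xy: "x \<in> ?A" "y \<in> ?B"
    have "?l (\<lambda>i\<in>{..<d}. (x i + y i) / 2) = (?l x + ?l y) / 2"
    proof -
      have "?l (\<lambda>i\<in>{..<d}. (x i + y i) / 2) = (\<Sum>i<d. (u i * x i + u i * y i) / 2)"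
        by (intro sum.cong refl) (simp add: distrib_left)
      then show ?thesis by (simp only: sum_divide_distrib[symmetric] sum.distrib)
    qed
    moreover have "t \<le> \<bar>(?l x + ?l y) / 2\<bar>" using xy by simp linarith
    moreover have "(\<lambda>i\<in>{..<d}. (x i + y i) / 2) \<in> space \<mu>" by (simp add: sp space_Rd)
    ultimately show "(\<lambda>i\<in>{..<d}. (x i + y i) / 2) \<in> ?C"
      by (simp only: mem_Collect_eq)
  qed measurable
  then have "prob ?A * prob ?B \<le> (prob ?C)\<^sup>2"
    by (simp add: emeasure_eq_measure ennreal_power flip: ennreal_mult)
  moreover have "prob ?B = 1 - prob ?C"
    by (subst prob_compl[symmetric]) (auto intro!: arg_cong[where f=prob])
  ultimately show ?thesis by (simp add: T_def)
qed

text \<open>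
  Once \<open>T t \<le> 1/2\<close>, the previous lemma reads \<open>2 * T (3 * t) \<le> (2 * T t)\<^sup>2\<close>, which iterates to a
  doubly exponential decay in the number of triplings.
\<close>

lemma log_concave_tail:
  fixes u :: "nat \<Rightarrow> real"
  assumes lc: "log_concave_measure d \<mu>" and r: "0 \<le> r"
  defines "T \<equiv> \<lambda>t. measure \<mu> {x \<in> space \<mu>. t \<le> \<bar>\<Sum>i<d. u i * x i\<bar>}"
  assumes T: "T r \<le> 1/324"
  shows "2 * T (3 ^ j * r) \<le> (1/162) ^ (2 ^ j)"
proof (induction j)
  case 0
  then show ?case using T by simp
next
  case (Suc j)
  let ?t = "3 ^ j * r"
  have T0: "0 \<le> T t" for t by (simp add: T_def)
  have "(1/162 :: real) ^ (2 ^ j) \<le> (1/162) ^ 1" by (intro power_decreasing) auto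
  then have half: "T ?t \<le> 1/2" using Suc by simp
  have "T (3 * ?t) * (1 - T ?t) \<le> (T ?t)\<^sup>2"
    using log_concave_tail_step[OF lc, of ?t u] r by (simp add: T_def)
  moreover have "T (3 * ?t) * (1/2) \<le> T (3 * ?t) * (1 - T ?t)"
    using half by (intro mult_left_mono T0) simp
  ultimately have "2 * T (3 * ?t) \<le> (2 * T ?t)\<^sup>2"
    by (simp add: power_mult_distrib)
  also have "\<dots> \<le> ((1/162) ^ (2 ^ j))\<^sup>2"
    using Suc T0 by (intro power_mono) simp_all
  also have "\<dots> = (1/162) ^ (2 ^ Suc j)"
    by (simp add: power_mult[symmetric] mult.commute)
  finally show ?case by (simp add: mult.assoc)
qed

text \<open>
  By Chebyshev's inequality \<open>18\<close> standard deviations suffice to start the iteration, as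
  \<open>18\<^sup>2 = 324\<close>.
\<close>

lemma log_concave_tail_variance:
  fixes u :: "nat \<Rightarrow> real"
  assumes lc: "log_concave_measure d \<mu>" and s: "0 < s"
    and int: "integrable \<mu> (\<lambda>x. (\<Sum>i<d. u i * x i)\<^sup>2)"
    and var: "(LINT x|\<mu>. (\<Sum>i<d. u i * x i)\<^sup>2) \<le> s\<^sup>2"
  shows "2 * measure \<mu> {x \<in> space \<mu>. 3 ^ j * (18 * s) \<le> \<bar>\<Sum>i<d. u i * x i\<bar>} \<le> (1/162) ^ (2 ^ j)"
proof (rule log_concave_tail[OF lc])
  interpret prob_space \<mu> using lc by (auto simp: log_concave_measure_def)
  let ?l = "\<lambda>x. \<Sum>i<d. u i * x i"
  have "18 * s \<le> \<bar>l\<bar> \<longleftrightarrow> (18 * s)\<^sup>2 \<le> l\<^sup>2" for l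
    by (subst abs_le_square_iff[symmetric]) (use s in simp)
  then have "prob {x \<in> space \<mu>. 18 * s \<le> \<bar>?l x\<bar>} = prob {x \<in> space \<mu>. (18 * s)\<^sup>2 \<le> (?l x)\<^sup>2}"
    by (simp only:)
  also have "\<dots> \<le> (LINT x|\<mu>. (?l x)\<^sup>2) / (18 * s)\<^sup>2"
    using s by (intro integral_Markov_inequality_measure[OF int, where A="{}"]) auto
  also have "\<dots> \<le> s\<^sup>2 / (18 * s)\<^sup>2" using var by (intro divide_right_mono) auto
  also have "\<dots> = 1 / 324" using s by (simp add: power_mult_distrib)
  finally show "prob {x \<in> space \<mu>. 18 * s \<le> \<bar>?l x\<bar>} \<le> 1 / 324" .
qed (use s in simp)

text \<open>
  Summation over the shells \<open>3 ^ j * 18 \<le> |l| < 3 ^ Suc j * 18\<close> of the functional \<open>l\<close>. From one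
  shell to the next the fourth power grows by \<open>81\<close>, whereas the bound \<open>(1/162) ^ Suc j / 2\<close> on
  the tail drops by \<open>162\<close>, so that a geometric series remains.
\<close>

lemma log_concave_fourth_moment:
  fixes u :: "nat \<Rightarrow> real"
  assumes lc: "log_concave_measure d \<mu>"
    and int: "integrable \<mu> (\<lambda>x. (\<Sum>i<d. u i * x i)\<^sup>2)"
    and var: "(LINT x|\<mu>. (\<Sum>i<d. u i * x i)\<^sup>2) \<le> 1"
  shows "integrable \<mu> (\<lambda>x. (\<Sum>i<d. u i * x i) ^ 4)"
    and "(LINT x|\<mu>. (\<Sum>i<d. u i * x i) ^ 4) \<le> 2 * 18 ^ 4"
proof -
  interpret prob_space \<mu> using lc by (auto simp: log_concave_measure_def)
  have sets: "sets \<mu> = sets (Rd d)" using lc by (auto simp: log_concave_measure_def)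
  let ?l = "\<lambda>x. \<Sum>i<d. u i * x i"
  have l[measurable]: "?l \<in> borel_measurable \<mu>"
    unfolding measurable_cong_sets[OF sets refl] Rd_def by measurable
  define c :: "nat \<Rightarrow> real" where "c j = (3 ^ Suc j * 18) ^ 4" for j
  define A where "A j = {x \<in> space \<mu>. 3 ^ j * (18 * 1) \<le> \<bar>?l x\<bar>}" for j :: nat
  have [measurable]: "A j \<in> sets \<mu>" for j unfolding A_def by measurable
  have ptw: "ennreal (?l x ^ 4) \<le> ennreal (18 ^ 4) + (\<Sum>j. ennreal (c j) * indicator (A j) x)"
    if x: "x \<in> space \<mu>" for x
  proof (cases "\<bar>?l x\<bar> < 18")
    case True
    have "?l x ^ 4 = \<bar>?l x\<bar> ^ 4" by (simp add: power_even_abs)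
    also have "\<dots> \<le> 18 ^ 4" using True by (intro power_mono) auto
    finally have "ennreal (?l x ^ 4) \<le> ennreal (18 ^ 4)" by (rule ennreal_leI)
    then show ?thesis by (rule order_trans) simp
  next
    case False
    obtain n where n: "\<bar>?l x\<bar> < 3 ^ n * 18"
    proof -
      obtain n where "\<bar>?l x\<bar> / 18 < 3 ^ n" using real_arch_pow[of 3 "\<bar>?l x\<bar> / 18"] by auto
      then show ?thesis by (intro that[of n]) (simp add: field_simps)
    qed
    define k where "k = (LEAST n. \<bar>?l x\<bar> < 3 ^ n * 18)"
    have k: "\<bar>?l x\<bar> < 3 ^ k * 18" unfolding k_def by (rule LeastI[of _ n]) (rule n)
    have "k \<noteq> 0" using k False by (intro notI) simp
    then obtain j where j: "k = Suc j" by (cases k) auto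
    have "\<not> \<bar>?l x\<bar> < 3 ^ j * 18"
      using not_less_Least[of j "\<lambda>n. \<bar>?l x\<bar> < 3 ^ n * 18"] j k_def by auto
    then have xA: "x \<in> A j" using x by (simp add: A_def)
    have "?l x ^ 4 = \<bar>?l x\<bar> ^ 4" by (simp add: power_even_abs)
    also have "\<dots> \<le> c j" using k j unfolding c_def by (intro power_mono) auto
    finally have "ennreal (?l x ^ 4) \<le> ennreal (c j)" by (rule ennreal_leI)
    also have "\<dots> = (\<Sum>j\<in>{j}. ennreal (c j) * indicator (A j) x)" using xA by simp
    also have "\<dots> \<le> (\<Sum>j. ennreal (c j) * indicator (A j) x)"
      by (rule sum_le_suminf) auto
    finally show ?thesis by (rule order_trans) simp
  qed
  have tail: "c j * measure \<mu> (A j) \<le> 18 ^ 4 * (1/2) ^ Suc j / 2" for j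
  proof -
    have "Suc j \<le> 2 ^ j" by (simp add: Suc_leI)
    then have "(1/162 :: real) ^ (2 ^ j) \<le> (1/162) ^ Suc j" by (intro power_decreasing) auto
    then have "measure \<mu> (A j) \<le> (1/162) ^ Suc j / 2"
      using log_concave_tail_variance[OF lc, of 1 u j] int var unfolding A_def by simp
    then have "c j * measure \<mu> (A j) \<le> c j * ((1/162) ^ Suc j / 2)"
      by (intro mult_left_mono) (auto simp: c_def)
    also have "c j * ((1/162) ^ Suc j / 2) = 81 ^ Suc j * 18 ^ 4 * ((1/162) ^ Suc j / 2)"
    proof -
      have "((3::real) ^ Suc j) ^ 4 = (3 ^ 4) ^ Suc j"
        by (metis mult.commute power_mult)
      then show ?thesis unfolding c_def power_mult_distrib by simp
    qed
    also have "\<dots> = 18 ^ 4 * ((81 * (1/162)) ^ Suc j) / (2::real)"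
      by (simp only: power_mult_distrib) simp
    finally show ?thesis by simp
  qed
  have "(\<integral>\<^sup>+x. ennreal (?l x ^ 4) \<partial>\<mu>) \<le> (\<integral>\<^sup>+x. ennreal (18 ^ 4) + (\<Sum>j. ennreal (c j) * indicator (A j) x) \<partial>\<mu>)"
    by (intro nn_integral_mono ptw)
  also have "\<dots> = ennreal (18 ^ 4) + (\<integral>\<^sup>+x. (\<Sum>j. ennreal (c j) * indicator (A j) x) \<partial>\<mu>)"
    by (subst nn_integral_add) (auto simp: emeasure_space_1)
  also have "(\<integral>\<^sup>+x. (\<Sum>j. ennreal (c j) * indicator (A j) x) \<partial>\<mu>) = (\<Sum>j. \<integral>\<^sup>+x. ennreal (c j) * indicator (A j) x \<partial>\<mu>)"
    by (intro nn_integral_suminf) auto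
  also have "\<dots> = (\<Sum>j. ennreal (c j * measure \<mu> (A j)))"
    by (simp add: nn_integral_cmult_indicator emeasure_eq_measure ennreal_mult c_def)
  also have "\<dots> \<le> (\<Sum>j. ennreal (18 ^ 4 * (1/2) ^ Suc j / 2))"
    by (intro suminf_le ennreal_leI tail) auto
  also have "\<dots> = ennreal (\<Sum>j. 18 ^ 4 * (1/2) ^ Suc j / 2)"
    by (intro suminf_ennreal2) (auto intro!: summable_divide summable_mult simp: summable_geometric)
  also have "(\<Sum>j. 18 ^ 4 * (1/2) ^ Suc j / 2) = (18 ^ 4 / 2 :: real)"
  proof -
    have "(\<lambda>j. 18 ^ 4 / 2 * (1/2 :: real) ^ Suc j) sums (18 ^ 4 / 2 * 1)"
      by (intro sums_mult power_half_series)
    then have "(\<lambda>j. 18 ^ 4 * (1/2 :: real) ^ Suc j / 2) sums (18 ^ 4 / 2)" by simp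
    then show ?thesis by (rule sums_unique[symmetric])
  qed
  also have "ennreal (18 ^ 4) + ennreal (18 ^ 4 / 2) \<le> ennreal (2 * 18 ^ 4)"
    by (simp flip: ennreal_plus)
  finally have nn: "(\<integral>\<^sup>+x. ennreal (?l x ^ 4) \<partial>\<mu>) \<le> ennreal (2 * 18 ^ 4)" by simp
  show int4: "integrable \<mu> (\<lambda>x. ?l x ^ 4)"
  proof (rule integrableI_bounded)
    have "(\<integral>\<^sup>+x. ennreal (norm (?l x ^ 4)) \<partial>\<mu>) = (\<integral>\<^sup>+x. ennreal (?l x ^ 4) \<partial>\<mu>)" by simp
    also have "\<dots> < \<infinity>" using nn by (rule order_le_less_trans) simp
    finally show "(\<integral>\<^sup>+x. ennreal (norm (?l x ^ 4)) \<partial>\<mu>) < \<infinity>" .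
  qed measurable
  have "ennreal (LINT x|\<mu>. ?l x ^ 4) \<le> ennreal (2 * 18 ^ 4)"
    using nn by (subst nn_integral_eq_integral[OF int4, symmetric]) auto
  then show "(LINT x|\<mu>. ?l x ^ 4) \<le> 2 * 18 ^ 4" by (subst (asm) ennreal_le_iff) auto
qed

lemma isotropic_second_moments:
  assumes iso: "isotropic d \<mu>" and sets: "sets \<mu> = sets (Rd d)" and ij: "i < d" "j < d"
  shows "integrable \<mu> (\<lambda>x. x i * x j)" "(LINT x|\<mu>. x i * x j) = (if i = j then 1 else 0)"
proof -
  have [measurable]: "(\<lambda>x. x k) \<in> borel_measurable \<mu>" if "k < d" for k
    unfolding measurable_cong_sets[OF sets refl] Rd_def using that
    by (intro measurable_component_singleton[of _ _ "\<lambda>_. lborel", simplified]) simp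
  show "integrable \<mu> (\<lambda>x. x i * x j)"
  proof (rule Bochner_Integration.integrable_bound)
    show "integrable \<mu> (\<lambda>x. (x i)\<^sup>2 + (x j)\<^sup>2)"
      using iso ij by (auto simp: isotropic_def)
    have "\<bar>x i * x j\<bar> \<le> (x i)\<^sup>2 + (x j)\<^sup>2" for x :: "nat \<Rightarrow> real"
      using sum_squares_bound[of "\<bar>x i\<bar>" "\<bar>x j\<bar>"] abs_ge_zero[of "x i * x j"]
      unfolding abs_mult power2_abs by linarith
    then show "AE x in \<mu>. norm (x i * x j) \<le> norm ((x i)\<^sup>2 + (x j)\<^sup>2)" by auto
  qed (use ij in measurable)
  show "(LINT x|\<mu>. x i * x j) = (if i = j then 1 else 0)"
    using iso ij by (auto simp: isotropic_def covariance_def)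
qed

lemma isotropic_linear_second_moment:
  fixes u :: "nat \<Rightarrow> real"
  assumes iso: "isotropic d \<mu>" and sets: "sets \<mu> = sets (Rd d)"
  shows "integrable \<mu> (\<lambda>x. (\<Sum>i<d. u i * x i)\<^sup>2)"
    "(LINT x|\<mu>. (\<Sum>i<d. u i * x i)\<^sup>2) = (\<Sum>i<d. (u i)\<^sup>2)"
proof -
  note mom = isotropic_second_moments[OF iso sets]
  have sq: "(\<Sum>i<d. u i * x i)\<^sup>2 = (\<Sum>i<d. \<Sum>j<d. u i * u j * (x i * x j))" for x
    by (simp add: power2_eq_square sum_product mult_ac)
  show "integrable \<mu> (\<lambda>x. (\<Sum>i<d. u i * x i)\<^sup>2)"
    unfolding sq by (intro Bochner_Integration.integrable_sum integrable_mult_right mom) auto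
  have "(LINT x|\<mu>. (\<Sum>i<d. u i * x i)\<^sup>2) = (\<Sum>i<d. \<Sum>j<d. u i * u j * (LINT x|\<mu>. x i * x j))"
    unfolding sq by (subst Bochner_Integration.integral_sum, (intro Bochner_Integration.integrable_sum integrable_mult_right mom; simp),
       intro sum.cong refl, subst Bochner_Integration.integral_sum, (intro integrable_mult_right mom; simp), simp)
  also have "\<dots> = (\<Sum>i<d. (u i)\<^sup>2)"
    by (intro sum.cong refl) (simp add: mom(2) power2_eq_square if_distrib cong: if_cong)
  finally show "(LINT x|\<mu>. (\<Sum>i<d. u i * x i)\<^sup>2) = (\<Sum>i<d. (u i)\<^sup>2)" .
qed

lemma isotropic_log_concave_coordinate_fourth_moment:
  assumes lc: "log_concave_measure d \<mu>" and iso: "isotropic d \<mu>" and i: "i < d"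
  shows "integrable \<mu> (\<lambda>x. x i ^ 4)" "(LINT x|\<mu>. x i ^ 4) \<le> 2 * 18 ^ 4"
proof -
  have sets: "sets \<mu> = sets (Rd d)" using lc by (auto simp: log_concave_measure_def)
  have *: "(\<Sum>j<d. (if j = i then 1 else 0) * x j) = x i" for x :: "nat \<Rightarrow> real"
    using i by (simp add: if_distrib if_distribR cong: if_cong)
  have one: "(\<Sum>j<d. (if j = i then 1 else 0)\<^sup>2) = (1::real)"
    using i by (simp add: if_distrib if_distribR cong: if_cong)
  note lin = isotropic_linear_second_moment[OF iso sets, of "\<lambda>j. if j = i then 1 else 0"]
  show "integrable \<mu> (\<lambda>x. x i ^ 4)" "(LINT x|\<mu>. x i ^ 4) \<le> 2 * 18 ^ 4"
    using log_concave_fourth_moment[OF lc lin(1)] lin(2) unfolding one * by auto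
qed

lemma measurable_Rd_component:
  assumes "sets \<mu> = sets (Rd d)" "i < d"
  shows "(\<lambda>x. x i) \<in> borel_measurable \<mu>"
  unfolding measurable_cong_sets[OF assms(1) refl] Rd_def using assms(2)
  by (intro measurable_component_singleton[of _ _ "\<lambda>_. lborel", simplified]) simp

lemma isotropic_square_norm_moments:
  assumes lc: "log_concave_measure d \<mu>" and iso: "isotropic d \<mu>"
  shows "integrable \<mu> (\<lambda>x. \<Sum>i<d. (x i)\<^sup>2)" "(LINT x|\<mu>. (\<Sum>i<d. (x i)\<^sup>2)) = d"
    "integrable \<mu> (\<lambda>x. (\<Sum>i<d. (x i)\<^sup>2)\<^sup>2)" "(LINT x|\<mu>. (\<Sum>i<d. (x i)\<^sup>2)\<^sup>2) \<le> 2 * 18 ^ 4 * (real d)\<^sup>2"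
    "integrable \<mu> (\<lambda>x. \<Sum>i<d. x i ^ 4)" "(LINT x|\<mu>. (\<Sum>i<d. x i ^ 4)) \<le> 2 * 18 ^ 4 * real d"
proof -
  have sets: "sets \<mu> = sets (Rd d)" using lc by (auto simp: log_concave_measure_def)
  note m2 = isotropic_second_moments[OF iso sets]
  note m4 = isotropic_log_concave_coordinate_fourth_moment[OF lc iso]
  have [measurable]: "(\<lambda>x. \<Sum>i<d. (x i)\<^sup>2) \<in> borel_measurable \<mu>"
    by (intro borel_measurable_sum borel_measurable_power measurable_Rd_component[OF sets]) simp
  show "integrable \<mu> (\<lambda>x. \<Sum>i<d. (x i)\<^sup>2)"
    using m2(1) by (intro Bochner_Integration.integrable_sum) (simp add: power2_eq_square)
  show "(LINT x|\<mu>. (\<Sum>i<d. (x i)\<^sup>2)) = d"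
    using m2 by (subst Bochner_Integration.integral_sum) (simp_all add: power2_eq_square)
  show i4: "integrable \<mu> (\<lambda>x. \<Sum>i<d. x i ^ 4)"
    using m4(1) by (intro Bochner_Integration.integrable_sum) simp
  have "(LINT x|\<mu>. (\<Sum>i<d. x i ^ 4)) = (\<Sum>i<d. (LINT x|\<mu>. x i ^ 4))"
    using m4(1) by (intro Bochner_Integration.integral_sum) simp
  also have "\<dots> \<le> (\<Sum>i<d. 2 * 18 ^ 4)" by (intro sum_mono m4(2)) simp
  finally show e4: "(LINT x|\<mu>. (\<Sum>i<d. x i ^ 4)) \<le> 2 * 18 ^ 4 * real d" by simp
  have cs: "(\<Sum>i<d. (x i)\<^sup>2)\<^sup>2 \<le> real d * (\<Sum>i<d. x i ^ 4)" for x :: "nat \<Rightarrow> real"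
    using sum_squared_le_sum_of_squares[of "\<lambda>i. (x i)\<^sup>2" "{..<d}"]
    by (simp add: power_mult[symmetric] mult.commute)
  have i4': "integrable \<mu> (\<lambda>x. real d * (\<Sum>i<d. x i ^ 4))"
    using i4 by (rule integrable_mult_right)
  show i22: "integrable \<mu> (\<lambda>x. (\<Sum>i<d. (x i)\<^sup>2)\<^sup>2)"
    by (rule Bochner_Integration.integrable_bound[OF i4']) (auto intro!: AE_I2 order_trans[OF cs])
  have "(LINT x|\<mu>. (\<Sum>i<d. (x i)\<^sup>2)\<^sup>2) \<le> (LINT x|\<mu>. (real d * (\<Sum>i<d. x i ^ 4)))"
    by (intro integral_mono i22 i4' cs)
  also have "\<dots> = real d * (LINT x|\<mu>. (\<Sum>i<d. x i ^ 4))" by simp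
  also have "\<dots> \<le> real d * (2 * 18 ^ 4 * real d)" by (intro mult_left_mono e4) simp
  finally show "(LINT x|\<mu>. (\<Sum>i<d. (x i)\<^sup>2)\<^sup>2) \<le> 2 * 18 ^ 4 * (real d)\<^sup>2"
    by (simp add: power2_eq_square mult_ac)
qed

text \<open>
  The Paley-Zygmund argument for the squared norm \<open>q\<close>, which has mean \<open>d\<close> and second moment at
  most \<open>K * d\<^sup>2\<close>: where \<open>q\<close> is large it is bounded by \<open>q\<^sup>2 / (2 K d) + K d / 2\<close>.
\<close>

lemma prob_square_norm_ge_quarter:
  assumes lc: "log_concave_measure d \<mu>" and iso: "isotropic d \<mu>" and d: "d \<ge> 1"
  shows "measure \<mu> {x \<in> space \<mu>. real d / 4 \<le> (\<Sum>i<d. (x i)\<^sup>2)} \<ge> 1 / (4 * 18 ^ 4)"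
proof -
  interpret prob_space \<mu> using lc by (auto simp: log_concave_measure_def)
  note mom = isotropic_square_norm_moments[OF lc iso]
  define K :: real where "K = 2 * 18 ^ 4"
  have K: "K > 0" by (simp add: K_def)
  let ?q = "\<lambda>x. \<Sum>i<d. (x i)\<^sup>2"
  let ?F = "{x \<in> space \<mu>. real d / 4 \<le> ?q x}"
  have [measurable]: "?q \<in> borel_measurable \<mu>" using mom(1) by simp
  have ptw: "?q x \<le> real d / 4 + (?q x)\<^sup>2 / (2 * K * d) + K * d / 2 * indicator ?F x"
    if "x \<in> space \<mu>" for x
  proof (cases "x \<in> ?F")
    case True
    have "0 \<le> (?q x - K * d)\<^sup>2 / (2 * K * d)" using K by simp
    also have "\<dots> = (?q x)\<^sup>2 / (2 * K * d) + K * d / 2 - ?q x"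
      using K d by (simp add: field_simps power2_eq_square)
    finally show ?thesis using True by simp
  next
    case False
    then have "?q x < real d / 4" "indicator ?F x = (0::real)" using that by simp_all
    moreover have "0 \<le> (?q x)\<^sup>2 / (2 * K * d)" using K by simp
    ultimately show ?thesis by simp
  qed
  have intF: "integrable \<mu> (indicator ?F :: _ \<Rightarrow> real)" by (intro integrable_real_indicator) (auto simp: emeasure_eq_measure)
  have "real d = (LINT x|\<mu>. ?q x)" using mom(2) by simp
  also have "\<dots> \<le> (LINT x|\<mu>. (real d / 4 + (?q x)\<^sup>2 / (2 * K * d) + K * d / 2 * indicator ?F x))"
    using ptw by (intro integral_mono mom(1) Bochner_Integration.integrable_add integrable_mult_right intF integrable_divide mom(3)) auto
  also have "\<dots> = real d / 4 + (LINT x|\<mu>. (?q x)\<^sup>2) / (2 * K * d) + K * d / 2 * prob ?F"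
    using intF mom(3) by (simp add: prob_space)
  also have "\<dots> \<le> real d / 4 + (K * (real d)\<^sup>2) / (2 * K * d) + K * d / 2 * prob ?F"
    using mom(4) K by (intro add_mono divide_right_mono) (auto simp: K_def)
  also have "(K * (real d)\<^sup>2) / (2 * K * d) = real d / 2"
    using K d by (simp add: power2_eq_square)
  finally have "real d * (1/4) \<le> real d * (K / 2 * prob ?F)" by (simp add: mult_ac)
  then have "1/4 \<le> K / 2 * prob ?F" using d by (subst (asm) mult_le_cancel_left_pos) auto
  then show ?thesis by (simp add: K_def)
qed

lemma prob_sum_fourth_powers_large:
  assumes lc: "log_concave_measure d \<mu>" and iso: "isotropic d \<mu>" and d: "d \<ge> 1" and C: "C > 0"
  shows "measure \<mu> {x \<in> space \<mu>. C * real d \<le> (\<Sum>i<d. x i ^ 4)} \<le> 2 * 18 ^ 4 / C"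
proof -
  interpret prob_space \<mu> using lc by (auto simp: log_concave_measure_def)
  note mom = isotropic_square_norm_moments[OF lc iso]
  have "measure \<mu> {x \<in> space \<mu>. C * real d \<le> (\<Sum>i<d. x i ^ 4)} \<le> (LINT x|\<mu>. (\<Sum>i<d. x i ^ 4)) / (C * real d)"
    using C d by (intro integral_Markov_inequality_measure[OF mom(5), where A="{}"]) (auto intro!: sum_nonneg)
  also have "\<dots> \<le> (2 * 18 ^ 4 * real d) / (C * real d)"
    using mom(6) C by (intro divide_right_mono) auto
  also have "\<dots> = 2 * 18 ^ 4 / C" using d by simp
  finally show ?thesis .
qed

section \<open>Elementary symmetric polynomials\<close>

definition esym :: "nat \<Rightarrow> 'a set \<Rightarrow> ('a \<Rightarrow> real) \<Rightarrow> real" where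
  "esym m A p = (\<Sum>S | S \<subseteq> A \<and> card S = m. \<Prod>i\<in>S. p i)"

text \<open>
  Sums over subsets are compared with sums over all tuples, which factorise; distinct lists
  mediate between the two.
\<close>

lemma sum_distinct_lists_eq_sum_subsets:
  fixes F :: "'a set \<Rightarrow> real"
  assumes "finite A"
  shows "(\<Sum>xs | distinct xs \<and> length xs = m \<and> set xs \<subseteq> A. F (set xs)) = fact m * (\<Sum>S | S \<subseteq> A \<and> card S = m. F S)"
proof -
  let ?L = "{xs. distinct xs \<and> length xs = m \<and> set xs \<subseteq> A}" and ?S = "{S. S \<subseteq> A \<and> card S = m}"
  have finL: "finite ?L"
    by (rule finite_subset[OF _ finite_lists_length_eq[OF assms, of m]]) auto
  have finS: "finite ?S" using assms by simp
  have "(\<Sum>S\<in>?S. \<Sum>xs | xs \<in> ?L \<and> set xs = S. F (set xs)) = (\<Sum>xs\<in>?L. F (set xs))"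
    by (rule sum.group[OF finL finS]) (auto simp: distinct_card)
  moreover have "(\<Sum>xs | xs \<in> ?L \<and> set xs = S. F (set xs)) = fact m * F S" if "S \<in> ?S" for S
  proof -
    have fS: "finite S" using that assms finite_subset by blast
    have "{xs. xs \<in> ?L \<and> set xs = S} = permutations_of_set S"
      using that by (auto simp: permutations_of_set_def distinct_card)
    then have "(\<Sum>xs | xs \<in> ?L \<and> set xs = S. F (set xs)) = (\<Sum>xs\<in>permutations_of_set S. F (set xs))"
      by simp
    also have "\<dots> = (\<Sum>xs\<in>permutations_of_set S. F S)"
      by (intro sum.cong) (auto simp: permutations_of_set_def)
    finally show ?thesis using that fS by simp
  qed
  then have "(\<Sum>S\<in>?S. \<Sum>xs | xs \<in> ?L \<and> set xs = S. F (set xs)) = fact m * (\<Sum>S\<in>?S. F S)"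
    unfolding sum_distrib_left by (rule sum.cong[OF refl])
  ultimately show ?thesis by (simp only: mem_Collect_eq)
qed

lemma prod_set_distinct_list:
  "distinct xs \<Longrightarrow> (\<Prod>i\<in>set xs. p i) = prod_list (map p xs)" for p :: "'a \<Rightarrow> real"
  by (simp add: prod.distinct_set_conv_list)

lemma sum_lists_Suc:
  fixes f :: "'a list \<Rightarrow> real"
  assumes "finite A"
  shows "(\<Sum>xs | set xs \<subseteq> A \<and> length xs = Suc m. f xs) = (\<Sum>x\<in>A. \<Sum>xs | set xs \<subseteq> A \<and> length xs = m. f (x # xs))"
proof -
  have "{xs. set xs \<subseteq> A \<and> length xs = Suc m} = (\<lambda>(x, xs). x # xs) ` (A \<times> {xs. set xs \<subseteq> A \<and> length xs = m})"
  proof (intro equalityI subsetI)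
    fix zs assume zs: "zs \<in> {xs. set xs \<subseteq> A \<and> length xs = Suc m}"
    then obtain y ys where "zs = y # ys" by (cases zs) auto
    then show "zs \<in> (\<lambda>(x, xs). x # xs) ` (A \<times> {xs. set xs \<subseteq> A \<and> length xs = m})"
      using zs by (intro image_eqI[of _ _ "(y, ys)"]) auto
  qed auto
  then have "(\<Sum>xs | set xs \<subseteq> A \<and> length xs = Suc m. f xs) = (\<Sum>(x, xs)\<in>A \<times> {xs. set xs \<subseteq> A \<and> length xs = m}. f (x # xs))"
    by (simp add: sum.reindex inj_on_def case_prod_beta)
  then show ?thesis by (simp add: sum.cartesian_product)
qed

lemma sum_lists_prod_list:
  fixes p :: "'a \<Rightarrow> real"
  assumes "finite A"
  shows "(\<Sum>xs | set xs \<subseteq> A \<and> length xs = m. prod_list (map p xs)) = (\<Sum>i\<in>A. p i) ^ m"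
proof (induction m)
  case 0
  have "{xs. set xs \<subseteq> A \<and> xs = []} = {[]}" by auto
  then show ?case by simp
next
  case (Suc m)
  then show ?case
    by (simp add: sum_lists_Suc[OF assms] sum_distrib_left[symmetric] sum_distrib_right[symmetric])
qed

text \<open>
  The left factor bounds what is lost when the tuples with a repeated entry are discarded. The
  extra factor on both sides replaces the power \<open>m - 1\<close> on the right.
\<close>

lemma sum_lists_prod_list_times_sum_list:
  fixes p :: "'a \<Rightarrow> real"
  assumes "finite A"
  shows "(\<Sum>xs | set xs \<subseteq> A \<and> length xs = m. prod_list (map p xs) * sum_list (map p xs)) * (\<Sum>i\<in>A. p i)
     = real m * (\<Sum>i\<in>A. (p i)\<^sup>2) * (\<Sum>i\<in>A. p i) ^ m"
proof (induction m)
  case 0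
  have "{xs. set xs \<subseteq> A \<and> xs = []} = {[]}" by auto
  then show ?case by simp
next
  case (Suc m)
  let ?s = "\<Sum>i\<in>A. p i" and ?q = "\<Sum>i\<in>A. (p i)\<^sup>2"
  let ?R = "\<lambda>m. \<Sum>xs | set xs \<subseteq> A \<and> length xs = m. prod_list (map p xs) * sum_list (map p xs)"
  have "?R (Suc m) = (\<Sum>x\<in>A. \<Sum>xs | set xs \<subseteq> A \<and> length xs = m.
      (p x)\<^sup>2 * prod_list (map p xs) + p x * (prod_list (map p xs) * sum_list (map p xs)))"
    by (simp add: sum_lists_Suc[OF assms] algebra_simps power2_eq_square)
  also have "\<dots> = ?q * ?s ^ m + ?s * ?R m"
    by (simp add: sum.distrib sum_distrib_left[symmetric] sum_distrib_right[symmetric] sum_lists_prod_list[OF assms])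
  finally have "?R (Suc m) * ?s = ?q * ?s ^ Suc m + ?s * (?R m * ?s)"
    by (simp add: algebra_simps)
  then show ?case unfolding Suc by (simp add: algebra_simps)
qed

lemma esym_eq_sum_distinct_lists:
  assumes "finite A"
  shows "fact m * esym m A p = (\<Sum>xs | distinct xs \<and> length xs = m \<and> set xs \<subseteq> A. prod_list (map p xs))"
  unfolding esym_def sum_distinct_lists_eq_sum_subsets[OF assms, symmetric]
  by (intro sum.cong) (auto simp: prod_set_distinct_list)

lemma prod_list_map_nonneg: "(\<And>x. x \<in> set xs \<Longrightarrow> 0 \<le> p x) \<Longrightarrow> 0 \<le> prod_list (map p xs)" for p :: "'a \<Rightarrow> real"
  by (induction xs) auto

lemma esym_le_power:
  assumes A: "finite A" and p: "\<And>i. i \<in> A \<Longrightarrow> 0 \<le> p i"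
  shows "fact m * esym m A p \<le> (\<Sum>i\<in>A. p i) ^ m"
  unfolding esym_eq_sum_distinct_lists[OF A] sum_lists_prod_list[OF A, symmetric]
  using p by (intro sum_mono2 finite_lists_length_eq[OF A] prod_list_map_nonneg) auto

text \<open>
  Appending an entry to a distinct list and subtracting the entries that already occur in it
  gives a recursion for \<open>m! * esym m\<close>; the subtracted terms are bounded by the corresponding sum
  over all lists. In terms of independent samples from the weights \<open>p / s\<close>, the lemma says that
  collisions are rare.
\<close>

lemma esym_ge_power:
  assumes A: "finite A" and p: "\<And>i. i \<in> A \<Longrightarrow> 0 \<le> p i" and s: "(\<Sum>i\<in>A. p i) = s" "0 < s"
  shows "fact m * esym m A p \<ge> s ^ m * (1 - (real m)\<^sup>2 * (\<Sum>i\<in>A. (p i)\<^sup>2) / s\<^sup>2)"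
proof (induction m)
  case 0
  have "{S. S \<subseteq> A \<and> card S = 0} = {{}}" using A by (auto simp: card_eq_0_iff dest: finite_subset)
  then show ?case by (simp add: esym_def)
next
  case (Suc m)
  let ?q = "\<Sum>i\<in>A. (p i)\<^sup>2"
  let ?D = "\<lambda>m. {xs. distinct xs \<and> length xs = m \<and> set xs \<subseteq> A}"
  let ?P = "\<lambda>xs. prod_list (map p xs)"
  have finD: "finite (?D m)" for m
    by (rule finite_subset[OF _ finite_lists_length_eq[OF A, of m]]) auto
  have "?D (Suc m) = (\<lambda>(xs, x). x # xs) ` (SIGMA xs:?D m. A - set xs)"
  proof (intro equalityI subsetI)
    fix zs assume zs: "zs \<in> ?D (Suc m)"
    then obtain y ys where "zs = y # ys" by (cases zs) auto
    then show "zs \<in> (\<lambda>(xs, x). x # xs) ` (SIGMA xs:?D m. A - set xs)"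
      using zs by (intro image_eqI[of _ _ "(ys, y)"]) auto
  qed auto
  then have "(\<Sum>xs\<in>?D (Suc m). ?P xs) = (\<Sum>(xs, x)\<in>(SIGMA xs:?D m. A - set xs). p x * ?P xs)"
    by (simp add: sum.reindex inj_on_def case_prod_beta)
  also have "\<dots> = (\<Sum>xs\<in>?D m. \<Sum>x\<in>A - set xs. p x * ?P xs)"
    using finD A by (intro sum.Sigma[symmetric]) auto
  also have "\<dots> = (\<Sum>xs\<in>?D m. s * ?P xs - ?P xs * sum_list (map p xs))"
  proof (intro sum.cong refl)
    fix xs assume xs: "xs \<in> ?D m"
    have "(\<Sum>x\<in>A - set xs. p x) = s - sum_list (map p xs)"
      using xs A s by (subst sum_diff) (auto simp: sum_list_distinct_conv_sum_set)
    then show "(\<Sum>x\<in>A - set xs. p x * ?P xs) = s * ?P xs - ?P xs * sum_list (map p xs)"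
      by (simp add: sum_distrib_right[symmetric] left_diff_distrib right_diff_distrib mult.commute)
  qed
  also have "\<dots> = s * (fact m * esym m A p) - (\<Sum>xs\<in>?D m. ?P xs * sum_list (map p xs))"
    by (simp add: sum_subtractf sum_distrib_left[symmetric] esym_eq_sum_distinct_lists[OF A])
  finally have rec: "fact (Suc m) * esym (Suc m) A p = s * (fact m * esym m A p) - (\<Sum>xs\<in>?D m. ?P xs * sum_list (map p xs))"
    by (simp only: esym_eq_sum_distinct_lists[OF A])
  have "(\<Sum>xs\<in>?D m. ?P xs * sum_list (map p xs)) \<le> (\<Sum>xs | set xs \<subseteq> A \<and> length xs = m. ?P xs * sum_list (map p xs))"
    using p by (intro sum_mono2 finite_lists_length_eq[OF A] mult_nonneg_nonneg prod_list_map_nonneg sum_list_nonneg) auto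
  also have "\<dots> = s ^ Suc m * (real m * ?q / s\<^sup>2)"
    using sum_lists_prod_list_times_sum_list[OF A, where m=m and p=p] s
    by (simp add: field_simps power2_eq_square)
  finally have "fact (Suc m) * esym (Suc m) A p \<ge> s * (s ^ m * (1 - (real m)\<^sup>2 * ?q / s\<^sup>2)) - s ^ Suc m * (real m * ?q / s\<^sup>2)"
    using Suc s(2) unfolding rec by (intro diff_mono mult_left_mono) auto
  also have "s * (s ^ m * (1 - (real m)\<^sup>2 * ?q / s\<^sup>2)) - s ^ Suc m * (real m * ?q / s\<^sup>2)
      = s ^ Suc m * (1 - ((real m)\<^sup>2 + real m) * (?q / s\<^sup>2))"
    by (simp add: algebra_simps add_divide_distrib)
  finally have *: "s ^ Suc m * (1 - ((real m)\<^sup>2 + real m) * (?q / s\<^sup>2)) \<le> fact (Suc m) * esym (Suc m) A p" .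
  have "((real m)\<^sup>2 + real m) * (?q / s\<^sup>2) \<le> (real (Suc m))\<^sup>2 * (?q / s\<^sup>2)"
    by (intro mult_right_mono divide_nonneg_nonneg sum_nonneg) (auto simp: power2_eq_square algebra_simps)
  then have "s ^ Suc m * (1 - (real (Suc m))\<^sup>2 * (?q / s\<^sup>2)) \<le> s ^ Suc m * (1 - ((real m)\<^sup>2 + real m) * (?q / s\<^sup>2))"
    using s(2) by (intro mult_left_mono) auto
  then show ?case using * by simp
qed

section \<open>Rademacher averages\<close>

text \<open>
  The expectation over independent uniform signs indexed by \<open>I\<close>. A choice of signs is given by
  the set of indices with a positive sign.
\<close>

definition rad :: "'a set \<Rightarrow> ('a set \<Rightarrow> real) \<Rightarrow> real" where
  "rad I F = (\<Sum>A\<in>Pow I. F A) / 2 ^ card I"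

definition sg :: "'a set \<Rightarrow> 'a \<Rightarrow> real" where
  "sg A s = (if s \<in> A then 1 else -1)"

lemma rad_insert:
  assumes "finite I" "s \<notin> I"
  shows "rad (insert s I) F = (rad I F + rad I (\<lambda>A. F (insert s A))) / 2"
proof -
  have inj: "inj_on (insert s) (Pow I)" using assms(2) by (auto simp: inj_on_def)
  have "(\<Sum>A\<in>Pow (insert s I). F A) = (\<Sum>A\<in>Pow I. F A) + (\<Sum>A\<in>insert s ` Pow I. F A)"
    unfolding Pow_insert using assms by (intro sum.union_disjoint) auto
  also have "(\<Sum>A\<in>insert s ` Pow I. F A) = (\<Sum>A\<in>Pow I. F (insert s A))"
    by (simp add: sum.reindex[OF inj])
  finally show ?thesis using assms by (simp add: rad_def field_simps)
qed

lemma rad_mono: "(\<And>A. A \<subseteq> I \<Longrightarrow> F A \<le> G A) \<Longrightarrow> rad I F \<le> rad I G"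
  unfolding rad_def by (intro divide_right_mono sum_mono) auto

lemma rad_add: "rad I (\<lambda>A. F A + G A) = rad I F + rad I G"
  by (simp add: rad_def sum.distrib add_divide_distrib)

lemma rad_diff: "rad I (\<lambda>A. F A - G A) = rad I F - rad I G"
  by (simp add: rad_def sum_subtractf diff_divide_distrib)

lemma rad_cmult: "rad I (\<lambda>A. c * F A) = c * rad I F"
  by (simp add: rad_def sum_distrib_left)

lemma rad_divide: "rad I (\<lambda>A. F A / c) = rad I F / c"
  by (simp add: rad_def sum_divide_distrib[symmetric])

lemma rad_const: "finite I \<Longrightarrow> rad I (\<lambda>_. c) = c"
  by (simp add: rad_def card_Pow)

lemma rad_sum: "rad I (\<lambda>A. \<Sum>j\<in>J. F j A) = (\<Sum>j\<in>J. rad I (F j))"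
  unfolding rad_def by (subst sum.swap) (simp add: sum_divide_distrib)

definition radlin :: "'a set \<Rightarrow> ('a \<Rightarrow> real) \<Rightarrow> 'a set \<Rightarrow> real" where
  "radlin I b A = (\<Sum>s\<in>I. sg A s * b s)"

lemma radlin_insert:
  assumes "finite I" "s \<notin> I" "A \<subseteq> I"
  shows "radlin (insert s I) b A = radlin I b A - b s" "radlin (insert s I) b (insert s A) = radlin I b A + b s"
proof -
  have "(\<Sum>t\<in>I. sg (insert s A) t * b t) = (\<Sum>t\<in>I. sg A t * b t)"
    using assms by (intro sum.cong) (auto simp: sg_def)
  then show "radlin (insert s I) b A = radlin I b A - b s" "radlin (insert s I) b (insert s A) = radlin I b A + b s"
    using assms by (auto simp: radlin_def sg_def)
qed

lemma rad_cong: "(\<And>A. A \<subseteq> I \<Longrightarrow> F A = G A) \<Longrightarrow> rad I F = rad I G"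
  unfolding rad_def by (intro arg_cong2[where f="(/)"] sum.cong) auto

lemma rad_insert_radlin:
  assumes "finite I" "s \<notin> I"
  shows "rad (insert s I) (\<lambda>A. \<phi> (radlin (insert s I) b A)) =
    rad I (\<lambda>A. (\<phi> (radlin I b A - b s) + \<phi> (radlin I b A + b s)) / 2)"
proof -
  have "rad I (\<lambda>A. \<phi> (radlin (insert s I) b A)) = rad I (\<lambda>A. \<phi> (radlin I b A - b s))"
    "rad I (\<lambda>A. \<phi> (radlin (insert s I) b (insert s A))) = rad I (\<lambda>A. \<phi> (radlin I b A + b s))"
    using radlin_insert[OF assms] by (auto intro!: rad_cong)
  then show ?thesis
    unfolding rad_insert[OF assms] by (simp add: rad_divide rad_add)
qed

lemma rad_radlin_square: "finite I \<Longrightarrow> rad I (\<lambda>A. (radlin I b A)\<^sup>2) = (\<Sum>s\<in>I. (b s)\<^sup>2)"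
proof (induction I rule: finite_induct)
  case empty
  then show ?case by (simp add: rad_def radlin_def)
next
  case (insert s I)
  have eq: "((x - y)\<^sup>2 + (x + y)\<^sup>2) / 2 = x\<^sup>2 + y\<^sup>2" for x y :: real
    by (simp add: power2_eq_square algebra_simps)
  show ?case
    unfolding rad_insert_radlin[OF insert.hyps, where \<phi>="\<lambda>x. x\<^sup>2"] eq
    using insert by (simp add: rad_add rad_const)
qed

text \<open>
  Khinchine's inequality with its sharp constant, by splitting off one sign at a time.
\<close>

lemma rad_radlin_fourth: "finite I \<Longrightarrow> rad I (\<lambda>A. (radlin I b A) ^ 4) \<le> 3 * (\<Sum>s\<in>I. (b s)\<^sup>2)\<^sup>2"
proof (induction I rule: finite_induct)
  case empty
  then show ?case by (simp add: rad_def radlin_def)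
next
  case (insert s I)
  let ?v = "\<Sum>s\<in>I. (b s)\<^sup>2"
  have eq: "((x - y) ^ 4 + (x + y) ^ 4) / 2 = x ^ 4 + (6 * y\<^sup>2) * x\<^sup>2 + y ^ 4" for x y :: real
    by (simp add: power4_eq_xxxx power2_eq_square algebra_simps)
  have "rad (insert s I) (\<lambda>A. (radlin (insert s I) b A) ^ 4)
      = rad I (\<lambda>A. radlin I b A ^ 4) + 6 * (b s)\<^sup>2 * ?v + b s ^ 4"
    unfolding rad_insert_radlin[OF insert.hyps, where \<phi>="\<lambda>x. x ^ 4"] eq
    using insert by (simp add: rad_add rad_const rad_cmult rad_radlin_square)
  also have "\<dots> \<le> 3 * ?v\<^sup>2 + 6 * (b s)\<^sup>2 * ?v + 3 * b s ^ 4"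
    using insert.IH by (intro add_mono) auto
  also have "\<dots> = 3 * ((b s)\<^sup>2 + ?v)\<^sup>2"
    by (simp add: power4_eq_xxxx power2_eq_square algebra_simps)
  finally show ?case using insert by simp
qed

text \<open>
  Comparison of power series: \<open>2 ^ n * n! \<le> (2 n)!\<close>.
\<close>

lemma cosh_le_exp_half_square: "(exp (- y) + exp y) / 2 \<le> exp (y\<^sup>2 / 2)" for y :: real
proof -
  have *: "fact (2 * n) \<ge> (2 ^ n * fact n :: real)" for n
  proof (induction n)
    case (Suc n)
    have "(2 ^ Suc n * fact (Suc n) :: real) = (2 * (real n + 1)) * (2 ^ n * fact n)" by simp
    also have "\<dots> \<le> ((2 * real n + 2) * (2 * real n + 1)) * fact (2 * n)"
      using Suc by (intro mult_mono) (auto simp: algebra_simps)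
    also have "\<dots> = fact (2 * Suc n)" by (simp add: algebra_simps)
    finally show ?case .
  qed simp
  have s1: "(\<lambda>n. y ^ (2 * n) / fact (2 * n)) sums cosh y"
  proof -
    have "(\<lambda>n. if even n then y ^ n /\<^sub>R fact n else 0) sums cosh y" by (rule cosh_converges)
    then have "(\<lambda>n. if even (2 * n) then y ^ (2 * n) /\<^sub>R fact (2 * n) else 0) sums cosh y"
      by (subst sums_mono_reindex[where g="\<lambda>n. 2 * n"]) (auto simp: strict_mono_def elim!: evenE)
    then show ?thesis by (simp add: divide_inverse mult.commute)
  qed
  have s2: "(\<lambda>n. (y\<^sup>2 / 2) ^ n / fact n) sums exp (y\<^sup>2 / 2)"
    using exp_converges[of "y\<^sup>2 / 2"] by (simp only: real_scaleR_def divide_inverse_commute)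
  have "cosh y \<le> exp (y\<^sup>2 / 2)"
  proof (rule sums_le[OF _ s1 s2])
    fix n
    have "y ^ (2 * n) / fact (2 * n) \<le> y ^ (2 * n) / (2 ^ n * fact n)"
      using *[of n] by (intro divide_left_mono) (auto simp: power_mult)
    also have "\<dots> = (y\<^sup>2 / 2) ^ n / fact n" by (simp add: power_divide power_mult)
    finally show "y ^ (2 * n) / fact (2 * n) \<le> (y\<^sup>2 / 2) ^ n / fact n" .
  qed
  then show ?thesis by (simp add: cosh_def add.commute)
qed

lemma rad_exp_radlin: "finite I \<Longrightarrow> rad I (\<lambda>A. exp (radlin I b A)) \<le> exp ((\<Sum>s\<in>I. (b s)\<^sup>2) / 2)"
proof (induction I rule: finite_induct)
  case empty
  then show ?case by (simp add: rad_def radlin_def)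
next
  case (insert s I)
  have "rad (insert s I) (\<lambda>A. exp (radlin (insert s I) b A))
      = ((exp (- b s) + exp (b s)) / 2) * rad I (\<lambda>A. exp (radlin I b A))"
    unfolding rad_insert_radlin[OF insert.hyps, where \<phi>=exp] rad_cmult[symmetric]
  proof (rule rad_cong)
    fix A
    have "exp (radlin I b A - b s) = exp (radlin I b A) * exp (- b s)"
      by (simp flip: exp_add)
    then show "(exp (radlin I b A - b s) + exp (radlin I b A + b s)) / 2
        = ((exp (- b s) + exp (b s)) / 2) * exp (radlin I b A)"
      by (simp add: exp_add distrib_left mult.commute)
  qed
  also have "\<dots> \<le> exp ((b s)\<^sup>2 / 2) * exp ((\<Sum>s\<in>I. (b s)\<^sup>2) / 2)"
    using insert.IH by (intro mult_mono cosh_le_exp_half_square) (auto simp: rad_def intro!: divide_nonneg_nonneg sum_nonneg)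
  also have "\<dots> = exp ((\<Sum>s\<in>insert s I. (b s)\<^sup>2) / 2)"
    using insert by (simp add: exp_add[symmetric] add_divide_distrib)
  finally show ?case .
qed

section \<open>Random multilinear polynomials\<close>

definition ksub :: "nat \<Rightarrow> nat \<Rightarrow> nat set set" where
  "ksub d m = {S. S \<subseteq> {..<d} \<and> card S = m}"

lemma finite_ksub [simp]: "finite (ksub d m)"
  by (simp add: ksub_def)

lemma finite_mem_ksub: "S \<in> ksub d m \<Longrightarrow> finite S"
  by (auto simp: ksub_def intro: finite_subset)

lemma ksub_0: "ksub d 0 = {{}}"
  by (auto simp: ksub_def card_eq_0_iff dest: finite_subset)

text \<open>
  The normalisation of the random polynomial: an upper bound for the sum of the squared
  monomials of degree \<open>m\<close> on the sphere of radius \<open>sqrt d\<close>.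
\<close>

definition mono_var :: "nat \<Rightarrow> nat \<Rightarrow> real" where
  "mono_var d m = real d ^ m / fact m"

text \<open>
  The coefficient of \<open>\<Prod>i\<in>U. h i\<close> in the expansion of the random polynomial at \<open>h + z\<close>, that is,
  its mixed partial derivative in the directions of \<open>U\<close> at the point \<open>z\<close>; for \<open>U = {}\<close> the
  polynomial itself.
\<close>

definition rpart :: "nat \<Rightarrow> nat \<Rightarrow> nat set \<Rightarrow> nat set set \<Rightarrow> (nat \<Rightarrow> real) \<Rightarrow> real" where
  "rpart d m U A z = radlin (ksub d m) (\<lambda>S. if U \<subseteq> S then (\<Prod>i\<in>S - U. z i) / sqrt (mono_var d m) else 0) A"

abbreviation rpoly :: "nat \<Rightarrow> nat \<Rightarrow> nat set set \<Rightarrow> (nat \<Rightarrow> real) \<Rightarrow> real" where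
  "rpoly d m A z \<equiv> rpart d m {} A z"

lemma rpoly_eq: "rpoly d m A z = radlin (ksub d m) (\<lambda>S. (\<Prod>i\<in>S. z i) / sqrt (mono_var d m)) A"
  by (simp add: rpart_def)

lemma rpoly_taylor:
  "rpoly d m A (\<lambda>i. h i + z i) = (\<Sum>j\<le>m. \<Sum>U\<in>ksub d j. (\<Prod>i\<in>U. h i) * rpart d m U A z)"
proof -
  let ?P = "\<Union>j\<in>{..m}. ksub d j" and ?w = "sqrt (mono_var d m)"
  have expand: "(\<Prod>i\<in>S. h i + z i) / ?w
      = (\<Sum>U\<in>?P. (\<Prod>i\<in>U. h i) * (if U \<subseteq> S then (\<Prod>i\<in>S - U. z i) / ?w else 0))" if S: "S \<in> ksub d m" for S
  proof -
    have "Pow S = {U \<in> ?P. U \<subseteq> S}"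
      using S finite_mem_ksub[OF S] by (auto simp: ksub_def card_mono)
    then have "(\<Prod>i\<in>S. h i + z i) = (\<Sum>U\<in>{U \<in> ?P. U \<subseteq> S}. (\<Prod>i\<in>U. h i) * (\<Prod>i\<in>S - U. z i))"
      using prod_add[OF finite_mem_ksub[OF S], of h z] by simp
    also have "\<dots> = (\<Sum>U\<in>?P. if U \<subseteq> S then (\<Prod>i\<in>U. h i) * (\<Prod>i\<in>S - U. z i) else 0)"
      by (intro sum.inter_filter) auto
    finally have "(\<Prod>i\<in>S. h i + z i) / ?w = (\<Sum>U\<in>?P. (if U \<subseteq> S then (\<Prod>i\<in>U. h i) * (\<Prod>i\<in>S - U. z i) else 0) / ?w)"
      by (simp only: sum_divide_distrib)
    also have "\<dots> = (\<Sum>U\<in>?P. (\<Prod>i\<in>U. h i) * (if U \<subseteq> S then (\<Prod>i\<in>S - U. z i) / ?w else 0))"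
      by (intro sum.cong refl) auto
    finally show ?thesis .
  qed
  have "rpoly d m A (\<lambda>i. h i + z i)
      = (\<Sum>S\<in>ksub d m. sg A S * (\<Sum>U\<in>?P. (\<Prod>i\<in>U. h i) * (if U \<subseteq> S then (\<Prod>i\<in>S - U. z i) / ?w else 0)))"
    unfolding rpoly_eq radlin_def by (intro sum.cong refl arg_cong2[where f="(*)"] expand)
  also have "\<dots> = (\<Sum>S\<in>ksub d m. \<Sum>U\<in>?P. (\<Prod>i\<in>U. h i) * (sg A S * (if U \<subseteq> S then (\<Prod>i\<in>S - U. z i) / ?w else 0)))"
    unfolding sum_distrib_left by (intro sum.cong refl) (simp only: mult.left_commute)
  also have "\<dots> = (\<Sum>U\<in>?P. \<Sum>S\<in>ksub d m. (\<Prod>i\<in>U. h i) * (sg A S * (if U \<subseteq> S then (\<Prod>i\<in>S - U. z i) / ?w else 0)))"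
    by (rule sum.swap)
  also have "\<dots> = (\<Sum>U\<in>?P. (\<Prod>i\<in>U. h i) * rpart d m U A z)"
    unfolding rpart_def radlin_def sum_distrib_left ..
  also have "\<dots> = (\<Sum>j\<le>m. \<Sum>U\<in>ksub d j. (\<Prod>i\<in>U. h i) * rpart d m U A z)"
    by (rule sum.UNION_disjoint) (auto simp: ksub_def)
  finally show ?thesis .
qed

text \<open>
  The squared Hilbert-Schmidt norm of the derivative of order \<open>j\<close>, divided by \<open>j!\<close>: each set \<open>U\<close>
  stands for \<open>j!\<close> orderings, and the derivatives in a repeated direction vanish.
\<close>

definition level_energy :: "nat \<Rightarrow> nat \<Rightarrow> nat \<Rightarrow> nat set set \<Rightarrow> (nat \<Rightarrow> real) \<Rightarrow> real" where
  "level_energy d m j A z = (\<Sum>U\<in>ksub d j. (rpart d m U A z)\<^sup>2)"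

text \<open>
  The factor \<open>m ^ (- j)\<close> amounts to measuring distances in units of \<open>1 / sqrt m\<close>, the scale on
  which the polynomial varies.
\<close>

definition roughness :: "nat \<Rightarrow> nat \<Rightarrow> nat set set \<Rightarrow> (nat \<Rightarrow> real) \<Rightarrow> real" where
  "roughness d m A z = (\<Sum>j=1..m. level_energy d m j A z / real m ^ j)"

lemma level_energy_nonneg: "0 \<le> level_energy d m j A z"
  by (simp add: level_energy_def sum_nonneg)

lemma roughness_nonneg: "0 \<le> roughness d m A z"
  by (simp add: roughness_def sum_nonneg level_energy_nonneg)

lemma sum_inverse_fact_le: "(\<Sum>j=1..m. 1 / fact j) \<le> (2::real)"
proof -
  have s: "(\<lambda>n. 1 ^ n / fact n :: real) sums exp 1"
    using exp_converges[of "1::real"] by (simp add: divide_inverse)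
  have "(\<Sum>j<Suc m. 1 ^ j / fact j :: real) \<le> exp 1"
    unfolding sums_unique[OF s] by (intro sum_le_suminf sums_summable[OF s]) auto
  also have "\<dots> \<le> 3" by (rule exp_le)
  finally have "(\<Sum>j<Suc m. 1 / fact j :: real) \<le> 3" by simp
  moreover have "{..<Suc m} = insert 0 {1..m}" by auto
  ultimately show ?thesis by simp
qed

lemma esym_eq_sum_ksub: "esym j {..<d} p = (\<Sum>U\<in>ksub d j. \<Prod>i\<in>U. p i)"
  by (simp add: esym_def ksub_def)

text \<open>
  A Lipschitz estimate with constant of order \<open>sqrt m\<close> on the ball of radius \<open>1 / sqrt m\<close> around
  \<open>z\<close>, in terms of the derivatives at its centre alone. In every order the terms of the Taylor
  expansion are split by the arithmetic-geometric mean inequality, with the weight \<open>\<alpha>\<close> that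
  matches the scale \<open>m ^ j\<close> of the energies and the length \<open>t / sqrt m\<close> of the increment.
\<close>

lemma rpoly_increment_le:
  assumes m: "m \<ge> 1" and t: "t\<^sup>2 = real m * (\<Sum>i<d. (w i - z i)\<^sup>2)" "0 \<le> t" "t \<le> 1"
  shows "\<bar>rpoly d m A w - rpoly d m A z\<bar> \<le> t * (1 + roughness d m A z / 2)"
proof (cases "t = 0")
  case True
  then have "(\<Sum>i<d. (w i - z i)\<^sup>2) = 0" using t m by simp
  then have "w i = z i" if "i < d" for i
    using that by (subst (asm) sum_nonneg_eq_0_iff) auto
  then have "rpoly d m A w = rpoly d m A z"
    unfolding rpoly_eq radlin_def
    by (intro sum.cong refl arg_cong2[where f="(*)"] arg_cong2[where f="(/)"] prod.cong) (auto simp: ksub_def)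
  then show ?thesis using True by simp
next
  case False
  then have t0: "0 < t" using t by simp
  have m0: "0 < real m" using m by simp
  define h where "h i = w i - z i" for i
  have w: "(\<lambda>i. h i + z i) = w" by (simp add: h_def)
  have level: "\<bar>\<Sum>U\<in>ksub d j. (\<Prod>i\<in>U. h i) * rpart d m U A z\<bar>
      \<le> t * (1 / fact j + level_energy d m j A z / real m ^ j) / 2" if j: "1 \<le> j" for j
  proof -
    define \<alpha> where "\<alpha> = real m ^ j / t ^ j"
    have a0: "0 < \<alpha>" using m0 t0 by (simp add: \<alpha>_def)
    have yng: "\<bar>a * b\<bar> \<le> (\<alpha> * a\<^sup>2 + b\<^sup>2 / \<alpha>) / 2" for a b :: real
    proof -
      have "0 \<le> (\<alpha> * \<bar>a\<bar> - \<bar>b\<bar>)\<^sup>2 / (2 * \<alpha>)" using a0 by simp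
      also have "\<dots> = (\<alpha> * a\<^sup>2 + b\<^sup>2 / \<alpha>) / 2 - \<bar>a * b\<bar>"
        using a0 by (simp add: power2_diff abs_mult field_simps) (simp add: power2_eq_square)
      finally show ?thesis by simp
    qed
    have "\<bar>\<Sum>U\<in>ksub d j. (\<Prod>i\<in>U. h i) * rpart d m U A z\<bar> \<le> (\<Sum>U\<in>ksub d j. \<bar>(\<Prod>i\<in>U. h i) * rpart d m U A z\<bar>)"
      by (rule sum_abs)
    also have "\<dots> \<le> (\<Sum>U\<in>ksub d j. (\<alpha> * (\<Prod>i\<in>U. h i)\<^sup>2 + (rpart d m U A z)\<^sup>2 / \<alpha>) / 2)"
      by (intro sum_mono yng)
    also have "\<dots> = (\<alpha> * esym j {..<d} (\<lambda>i. (h i)\<^sup>2) + level_energy d m j A z / \<alpha>) / 2"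
      unfolding esym_eq_sum_ksub level_energy_def sum_distrib_left sum_divide_distrib[symmetric] sum.distrib
      by (simp add: prod_power_distrib sum_divide_distrib)
    also have "\<alpha> * esym j {..<d} (\<lambda>i. (h i)\<^sup>2) \<le> \<alpha> * ((\<Sum>i<d. (h i)\<^sup>2) ^ j / fact j)"
      using esym_le_power[of "{..<d}" "\<lambda>i. (h i)\<^sup>2" j] a0
      by (intro mult_left_mono) (auto simp: field_simps)
    also have "(\<Sum>i<d. (h i)\<^sup>2) = t\<^sup>2 / real m" using t(1) m0 by (simp add: h_def)
    also have "\<alpha> * ((t\<^sup>2 / real m) ^ j / fact j) = t ^ j / fact j"
      using t0 m0 by (simp add: \<alpha>_def power_divide power2_eq_square power_mult_distrib)
    also have "level_energy d m j A z / \<alpha> = t ^ j * (level_energy d m j A z / real m ^ j)"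
      by (simp add: \<alpha>_def)
    also have "(t ^ j / fact j + t ^ j * (level_energy d m j A z / real m ^ j)) / 2
        = t ^ j * (1 / fact j + level_energy d m j A z / real m ^ j) / 2"
      by (simp add: distrib_left)
    also have "\<dots> \<le> t ^ 1 * (1 / fact j + level_energy d m j A z / real m ^ j) / 2"
      using t t0 j by (intro divide_right_mono mult_right_mono power_decreasing)
         (auto intro!: add_nonneg_nonneg divide_nonneg_nonneg level_energy_nonneg)
    finally show ?thesis by simp
  qed
  have "{..m} = insert 0 {1..m}" by auto
  then have "rpoly d m A w - rpoly d m A z = (\<Sum>j=1..m. \<Sum>U\<in>ksub d j. (\<Prod>i\<in>U. h i) * rpart d m U A z)"
    using rpoly_taylor[of d m A h z] unfolding w by (simp add: ksub_0)
  then have "\<bar>rpoly d m A w - rpoly d m A z\<bar> \<le> (\<Sum>j=1..m. \<bar>\<Sum>U\<in>ksub d j. (\<Prod>i\<in>U. h i) * rpart d m U A z\<bar>)"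
    by (metis sum_abs)
  also have "\<dots> \<le> (\<Sum>j=1..m. t * (1 / fact j + level_energy d m j A z / real m ^ j) / 2)"
    by (intro sum_mono level) simp
  also have "\<dots> = t * ((\<Sum>j=1..m. 1 / fact j) + roughness d m A z) / 2"
    by (simp only: roughness_def sum_distrib_left sum_divide_distrib[symmetric] sum.distrib[symmetric])
  also have "\<dots> \<le> t * (2 + roughness d m A z) / 2"
    using t by (intro divide_right_mono mult_left_mono add_right_mono sum_inverse_fact_le) auto
  finally show ?thesis by (simp add: algebra_simps)
qed

lemma binomial_le_power_div_fact: "real (n choose k) \<le> real n ^ k / fact k"
proof -
  have "real ((n choose k) * fact k) \<le> real (n ^ k)"
    by (intro of_nat_mono binomial_fact_pow)
  then show ?thesis by (simp add: field_simps)
qed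

text \<open>
  Different sets \<open>S\<close> carry independent signs, so the mean square of a derivative is a sum of
  squared monomials. For fixed \<open>U\<close> the sets \<open>S - U\<close> are distinct sets of size \<open>m - j\<close>, and their
  sum is at most \<open>d ^ (m - j) / (m - j)!\<close>.
\<close>

lemma rad_level_energy_le:
  assumes d: "d \<ge> 1" and j: "j \<le> m" and z: "(\<Sum>i<d. (z i)\<^sup>2) = real d"
  shows "rad (ksub d m) (\<lambda>A. level_energy d m j A z) \<le> real m ^ j / fact j"
proof -
  let ?W = "mono_var d m"
  have W: "0 < ?W" using d by (simp add: mono_var_def)
  have inner: "rad (ksub d m) (\<lambda>A. (rpart d m U A z)\<^sup>2) \<le> (real d ^ (m - j) / fact (m - j)) / ?W"
    if U: "U \<in> ksub d j" for U
  proof -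
    let ?B = "{S \<in> ksub d m. U \<subseteq> S}"
    have inj: "inj_on (\<lambda>S. S - U) ?B" by (rule inj_onI) blast
    have img: "(\<lambda>S. S - U) ` ?B \<subseteq> ksub d (m - j)"
      using U finite_mem_ksub[OF U] by (auto simp: ksub_def card_Diff_subset)
    have "rad (ksub d m) (\<lambda>A. (rpart d m U A z)\<^sup>2)
        = (\<Sum>S\<in>ksub d m. (if U \<subseteq> S then (\<Prod>i\<in>S - U. z i) / sqrt ?W else 0)\<^sup>2)"
      unfolding rpart_def by (rule rad_radlin_square) simp
    also have "\<dots> = (\<Sum>S\<in>ksub d m. if U \<subseteq> S then (\<Prod>i\<in>S - U. (z i)\<^sup>2) / ?W else 0)"
      using W by (intro sum.cong refl) (auto simp: power_divide prod_power_distrib)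
    also have "\<dots> = (\<Sum>S\<in>?B. (\<Prod>i\<in>S - U. (z i)\<^sup>2) / ?W)"
      by (rule sum.inter_filter[symmetric]) simp
    also have "\<dots> = (\<Sum>T\<in>(\<lambda>S. S - U) ` ?B. (\<Prod>i\<in>T. (z i)\<^sup>2) / ?W)"
      by (simp add: sum.reindex[OF inj])
    also have "\<dots> \<le> (\<Sum>T\<in>ksub d (m - j). (\<Prod>i\<in>T. (z i)\<^sup>2) / ?W)"
      using W by (intro sum_mono2 img) (auto intro!: divide_nonneg_nonneg prod_nonneg)
    also have "\<dots> = esym (m - j) {..<d} (\<lambda>i. (z i)\<^sup>2) / ?W"
      by (simp add: esym_eq_sum_ksub sum_divide_distrib)
    also have "\<dots> \<le> (real d ^ (m - j) / fact (m - j)) / ?W"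
      using esym_le_power[of "{..<d}" "\<lambda>i. (z i)\<^sup>2" "m - j"] W
      by (intro divide_right_mono) (auto simp: z field_simps)
    finally show ?thesis .
  qed
  have "rad (ksub d m) (\<lambda>A. level_energy d m j A z) = (\<Sum>U\<in>ksub d j. rad (ksub d m) (\<lambda>A. (rpart d m U A z)\<^sup>2))"
    unfolding level_energy_def by (rule rad_sum)
  also have "\<dots> \<le> (\<Sum>U\<in>ksub d j. (real d ^ (m - j) / fact (m - j)) / ?W)"
    by (intro sum_mono inner)
  also have "\<dots> = real (d choose j) * ((real d ^ (m - j) / fact (m - j)) / ?W)"
    using n_subsets[of "{..<d}" j] by (simp add: ksub_def)
  also have "\<dots> \<le> real d ^ j / fact j * ((real d ^ (m - j) / fact (m - j)) / ?W)"
    using W by (intro mult_right_mono binomial_le_power_div_fact) auto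
  also have "\<dots> = (real d ^ j * real d ^ (m - j) / real d ^ m) * (fact m / (fact j * fact (m - j)))"
    by (simp add: mono_var_def mult_ac)
  also have "real d ^ j * real d ^ (m - j) / real d ^ m = 1"
    using d j by (simp add: power_add[symmetric])
  also have "fact m / (fact j * fact (m - j)) = real (m choose j)"
    using j by (simp add: binomial_fact)
  finally show ?thesis using binomial_le_power_div_fact[of m j] by simp
qed

lemma rad_roughness_le:
  assumes d: "d \<ge> 1" and m: "m \<ge> 1" and z: "(\<Sum>i<d. (z i)\<^sup>2) = real d"
  shows "rad (ksub d m) (\<lambda>A. roughness d m A z) \<le> 2"
proof -
  have "rad (ksub d m) (\<lambda>A. roughness d m A z) = (\<Sum>j=1..m. rad (ksub d m) (\<lambda>A. level_energy d m j A z) / real m ^ j)"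
    by (simp add: roughness_def rad_sum rad_divide)
  also have "\<dots> \<le> (\<Sum>j=1..m. 1 / fact j)"
  proof (rule sum_mono)
    fix j assume "j \<in> {1..m}"
    then have "rad (ksub d m) (\<lambda>A. level_energy d m j A z) / real m ^ j \<le> (real m ^ j / fact j) / real m ^ j"
      using d z by (intro divide_right_mono rad_level_energy_le) auto
    then show "rad (ksub d m) (\<lambda>A. level_energy d m j A z) / real m ^ j \<le> 1 / fact j"
      using m by simp
  qed
  finally show ?thesis using sum_inverse_fact_le[of m] by linarith
qed

lemma rad_rpoly_square:
  "rad (ksub d m) (\<lambda>A. (rpoly d m A z)\<^sup>2) = fact m * esym m {..<d} (\<lambda>i. (z i)\<^sup>2) / real d ^ m"
proof -
  have W: "0 \<le> mono_var d m" by (simp add: mono_var_def)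
  have "rad (ksub d m) (\<lambda>A. (rpoly d m A z)\<^sup>2) = (\<Sum>S\<in>ksub d m. ((\<Prod>i\<in>S. z i) / sqrt (mono_var d m))\<^sup>2)"
    unfolding rpoly_eq by (rule rad_radlin_square) simp
  also have "\<dots> = esym m {..<d} (\<lambda>i. (z i)\<^sup>2) / mono_var d m"
    using W by (simp add: power_divide prod_power_distrib esym_eq_sum_ksub sum_divide_distrib)
  finally show ?thesis by (simp add: mono_var_def)
qed

lemma rad_rpoly_fourth: "rad (ksub d m) (\<lambda>A. (rpoly d m A z) ^ 4) \<le> 3 * (rad (ksub d m) (\<lambda>A. (rpoly d m A z)\<^sup>2))\<^sup>2"
  unfolding rpoly_eq by (subst rad_radlin_square, simp, rule rad_radlin_fourth) simp

text \<open>
  This is where \<open>m\<close> has to be at most a small multiple of \<open>sqrt d\<close>: otherwise tuples of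
  coordinates without repetition would carry only a small part of the total weight.
\<close>

lemma rad_rpoly_square_bounds:
  assumes d: "d \<ge> 1" and z: "(\<Sum>i<d. (z i)\<^sup>2) = real d" and z4: "(\<Sum>i<d. z i ^ 4) \<le> C * real d"
    and m: "2 * C * (real m)\<^sup>2 \<le> real d"
  shows "1/2 \<le> rad (ksub d m) (\<lambda>A. (rpoly d m A z)\<^sup>2)" "rad (ksub d m) (\<lambda>A. (rpoly d m A z)\<^sup>2) \<le> 1"
proof -
  have D: "0 < real d ^ m" using d by simp
  show "rad (ksub d m) (\<lambda>A. (rpoly d m A z)\<^sup>2) \<le> 1"
    using esym_le_power[of "{..<d}" "\<lambda>i. (z i)\<^sup>2" m] D by (simp add: rad_rpoly_square z)
  have "(real m)\<^sup>2 * (\<Sum>i<d. z i ^ 4) / (real d)\<^sup>2 \<le> (real m)\<^sup>2 * (C * real d) / (real d)\<^sup>2"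
    by (intro divide_right_mono mult_left_mono z4) auto
  also have "\<dots> = (2 * C * (real m)\<^sup>2) / real d / 2"
    using d by (simp add: power2_eq_square)
  also have "\<dots> \<le> 1 / 2" using m d by simp
  finally have "real d ^ m * (1 / 2) \<le> real d ^ m * (1 - (real m)\<^sup>2 * (\<Sum>i<d. z i ^ 4) / (real d)\<^sup>2)"
    using D by (intro mult_left_mono) auto
  also have "\<dots> \<le> fact m * esym m {..<d} (\<lambda>i. (z i)\<^sup>2)"
    using esym_ge_power[of "{..<d}" "\<lambda>i. (z i)\<^sup>2" "real d" m] z d by (simp add: power_mult[symmetric])
  finally show "1/2 \<le> rad (ksub d m) (\<lambda>A. (rpoly d m A z)\<^sup>2)"
    using D by (simp add: rad_rpoly_square field_simps)
qed

section \<open>Projection to the sphere\<close>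

text \<open>
  Projecting to the sphere of radius \<open>sqrt d\<close> removes the fluctuations of \<open>|x|\<close>, which a
  homogeneous polynomial of degree \<open>m\<close> would amplify to the power \<open>m\<close>.
\<close>

definition zmap :: "nat \<Rightarrow> (nat \<Rightarrow> real) \<Rightarrow> nat \<Rightarrow> real" where
  "zmap d x i = sqrt (real d) * x i / sqrt (\<Sum>i<d. (x i)\<^sup>2)"

lemma zmap_square_sum:
  assumes "0 < (\<Sum>i<d. (x i)\<^sup>2)"
  shows "(\<Sum>i<d. (zmap d x i)\<^sup>2) = real d"
  using assms by (simp add: zmap_def power_mult_distrib power_divide sum_distrib_left[symmetric] sum_divide_distrib[symmetric])

lemma zmap_fourth_sum:
  assumes Q: "real d / 4 \<le> (\<Sum>i<d. (x i)\<^sup>2)" and d: "d \<ge> 1"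
  shows "(\<Sum>i<d. zmap d x i ^ 4) \<le> 16 * (\<Sum>i<d. x i ^ 4)"
proof -
  let ?Q = "\<Sum>i<d. (x i)\<^sup>2"
  have Q0: "0 < ?Q" using Q d by (intro less_le_trans[OF _ Q]) simp
  have sq4: "sqrt a ^ 4 = a\<^sup>2" if "0 \<le> a" for a :: real
    using that by (metis power2_eq_square power4_eq_xxxx mult.assoc real_sqrt_pow2)
  have "(\<Sum>i<d. zmap d x i ^ 4) = (real d)\<^sup>2 / ?Q\<^sup>2 * (\<Sum>i<d. x i ^ 4)"
    using Q0 by (simp add: zmap_def power_mult_distrib power_divide sum_distrib_left[symmetric]
        sum_divide_distrib[symmetric] sq4)
  also have "\<dots> \<le> 16 * (\<Sum>i<d. x i ^ 4)"
  proof (intro mult_right_mono sum_nonneg)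
    have "real d \<le> 4 * ?Q" using Q by simp
    then have "(real d)\<^sup>2 \<le> (4 * ?Q)\<^sup>2" by (intro power_mono) auto
    then show "(real d)\<^sup>2 / ?Q\<^sup>2 \<le> 16" using Q0 by (simp add: field_simps)
  qed auto
  finally show ?thesis .
qed

text \<open>
  With \<open>a = |x|\<close> and \<open>b = |y|\<close>, the squared distance of \<open>x / a\<close> and \<open>y / b\<close> is at most
  \<open>|x - y|\<^sup>2 / (a * b)\<close>, because \<open>2 * a * b \<le> a\<^sup>2 + b\<^sup>2\<close>.
\<close>

lemma zmap_lipschitz:
  assumes d: "d \<ge> 1" and x: "real d / 4 \<le> (\<Sum>i<d. (x i)\<^sup>2)" and y: "real d / 4 \<le> (\<Sum>i<d. (y i)\<^sup>2)"
  shows "(\<Sum>i<d. (zmap d x i - zmap d y i)\<^sup>2) \<le> 4 * (\<Sum>i<d. (x i - y i)\<^sup>2)"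
proof -
  define a b c where "a = sqrt (\<Sum>i<d. (x i)\<^sup>2)" and "b = sqrt (\<Sum>i<d. (y i)\<^sup>2)" and "c = (\<Sum>i<d. x i * y i)"
  have pos: "0 < (\<Sum>i<d. (x i)\<^sup>2)" "0 < (\<Sum>i<d. (y i)\<^sup>2)"
    using d x y by (auto intro: less_le_trans[of 0 "real d / 4"])
  have ab: "0 < a" "0 < b" using pos by (simp_all add: a_def b_def)
  have a2: "a\<^sup>2 = (\<Sum>i<d. (x i)\<^sup>2)" "b\<^sup>2 = (\<Sum>i<d. (y i)\<^sup>2)" using pos by (simp_all add: a_def b_def)
  have dist: "(\<Sum>i<d. (x i - y i)\<^sup>2) = a\<^sup>2 + b\<^sup>2 - 2 * c"
    by (simp add: a2 c_def power2_diff sum.distrib sum_subtractf sum_distrib_left mult.assoc)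
  have "(\<Sum>i<d. (zmap d x i - zmap d y i)\<^sup>2) = (\<Sum>i<d. real d * ((x i)\<^sup>2 / a\<^sup>2 + (y i)\<^sup>2 / b\<^sup>2 - 2 * (x i * y i) / (a * b)))"
  proof (intro sum.cong refl)
    fix i
    have "zmap d x i - zmap d y i = sqrt (real d) * (x i / a - y i / b)"
      by (simp add: zmap_def a_def b_def right_diff_distrib)
    then show "(zmap d x i - zmap d y i)\<^sup>2 = real d * ((x i)\<^sup>2 / a\<^sup>2 + (y i)\<^sup>2 / b\<^sup>2 - 2 * (x i * y i) / (a * b))"
      by (simp add: power_mult_distrib power2_diff power_divide)
  qed
  also have "\<dots> = real d * (a\<^sup>2 / a\<^sup>2 + b\<^sup>2 / b\<^sup>2 - 2 * c / (a * b))"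
    by (simp add: sum_distrib_left[symmetric] sum.distrib sum_subtractf sum_divide_distrib[symmetric] a2[symmetric] c_def[symmetric])
  also have "\<dots> = real d * (2 * (a * b) - 2 * c) / (a * b)"
    using ab by (simp add: field_simps)
  also have "\<dots> \<le> real d * (a\<^sup>2 + b\<^sup>2 - 2 * c) / (a * b)"
    using ab sum_squares_bound[of a b] by (intro divide_right_mono mult_left_mono) auto
  also have "\<dots> = (real d / (a * b)) * (\<Sum>i<d. (x i - y i)\<^sup>2)" by (simp add: dist)
  also have "\<dots> \<le> 4 * (\<Sum>i<d. (x i - y i)\<^sup>2)"
  proof (intro mult_right_mono sum_nonneg)
    have "sqrt (real d / 4) * sqrt (real d / 4) \<le> a * b"
      unfolding a_def b_def using x y by (intro mult_mono real_sqrt_le_mono) auto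
    then show "real d / (a * b) \<le> 4" using ab by (simp add: field_simps)
  qed auto
  finally show ?thesis .
qed

section \<open>Lipschitz functions and packings\<close>

lemma Rd_dist_nonneg: "0 \<le> Rd_dist d x y"
  by (simp add: Rd_dist_def L2_set_nonneg)

lemma Rd_dist_self: "Rd_dist d x x = 0"
  by (simp add: Rd_dist_def L2_set_def)

lemma Rd_dist_commute: "Rd_dist d x y = Rd_dist d y x"
  by (simp add: Rd_dist_def L2_set_def power2_commute)

lemma Rd_dist_triangle: "Rd_dist d x z \<le> Rd_dist d x y + Rd_dist d y z"
proof -
  have "Rd_dist d x z = L2_set (\<lambda>i. (x i - y i) + (y i - z i)) {..<d}" by (simp add: Rd_dist_def)
  also have "\<dots> \<le> Rd_dist d x y + Rd_dist d y z"
    unfolding Rd_dist_def by (rule L2_set_triangle_ineq)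
  finally show ?thesis .
qed

lemma Rd_dist_square: "(Rd_dist d x y)\<^sup>2 = (\<Sum>i<d. (x i - y i)\<^sup>2)"
  by (simp add: Rd_dist_def L2_set_def sum_nonneg)

definition clip :: "real \<Rightarrow> real \<Rightarrow> real" where
  "clip K t = max (- K) (min K t)"

lemma abs_clip_le: "0 \<le> K \<Longrightarrow> \<bar>clip K t\<bar> \<le> K"
  by (auto simp: clip_def)

lemma clip_lipschitz: "\<bar>clip K s - clip K t\<bar> \<le> \<bar>s - t\<bar>"
  by (auto simp: clip_def max_def min_def)

lemma clip_eq: "\<bar>t\<bar> \<le> K \<Longrightarrow> clip K t = t"
  by (auto simp: clip_def)

lemma clip_times_self_le: "0 \<le> K \<Longrightarrow> \<bar>clip K t * t\<bar> \<le> K * \<bar>t\<bar>"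
  unfolding abs_mult by (intro mult_right_mono abs_clip_le) auto

text \<open>
  Clipping loses at most the fourth power divided by \<open>K\<^sup>2\<close>, so second and fourth moments suffice
  to bound the correlation of a variable with its clipped value from below.
\<close>

lemma clip_times_self_ge:
  assumes "0 < K"
  shows "t\<^sup>2 - t ^ 4 / K\<^sup>2 \<le> clip K t * t"
proof (cases "\<bar>t\<bar> \<le> K")
  case True
  then show ?thesis by (simp add: clip_eq power2_eq_square)
next
  case False
  then have "K\<^sup>2 \<le> t\<^sup>2" using assms by (subst abs_le_square_iff[symmetric]) simp
  then have "t\<^sup>2 * K\<^sup>2 \<le> t\<^sup>2 * t\<^sup>2" by (intro mult_left_mono) auto
  then have "t\<^sup>2 - t ^ 4 / K\<^sup>2 \<le> 0"
    using assms by (simp add: field_simps power4_eq_xxxx power2_eq_square)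
  also have "0 \<le> clip K t * t"
    using assms by (auto simp: clip_def max_def min_def zero_le_mult_iff)
  finally show ?thesis .
qed

text \<open>
  McShane's extension, clipped in order to keep the bound on the values.
\<close>

lemma lipschitz_extension:
  fixes F :: "(nat \<Rightarrow> real) \<Rightarrow> real"
  assumes K: "0 < K" and L: "0 < L" and bnd: "\<And>x. x \<in> G \<Longrightarrow> \<bar>F x\<bar> \<le> K"
    and lip: "\<And>x y. x \<in> G \<Longrightarrow> y \<in> G \<Longrightarrow> \<bar>F x - F y\<bar> \<le> L * Rd_dist d x y"
    and G: "G \<subseteq> space (Rd d)"
  shows "\<exists>f\<in>extensional (space (Rd d)). (\<forall>x\<in>space (Rd d). \<forall>y\<in>space (Rd d). \<bar>f x - f y\<bar> \<le> Rd_dist d x y) \<and>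
     (\<forall>x\<in>space (Rd d). \<bar>f x\<bar> \<le> K / L) \<and> (\<forall>x\<in>G. f x = F x / L)"
proof (cases "G = {}")
  case True
  then show ?thesis using K L
    by (intro bexI[of _ "\<lambda>x\<in>space (Rd d). 0"]) (auto simp: Rd_dist_nonneg)
next
  case False
  define h where "h x = (INF y\<in>G. F y / L + Rd_dist d x y)" for x
  have lb: "- (K / L) \<le> F y / L + Rd_dist d x y" if "y \<in> G" for x y
  proof -
    have "- (K / L) \<le> F y / L" using bnd[OF that] L
      by (simp add: divide_right_mono flip: divide_minus_left)
    then show ?thesis using Rd_dist_nonneg[of d x y] by linarith
  qed
  have bdd: "bdd_below ((\<lambda>y. F y / L + Rd_dist d x y) ` G)" for x
    using lb by (intro bdd_belowI2[where m="- (K / L)"])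
  have hle: "h x \<le> h y + Rd_dist d x y" for x y
  proof -
    have "h x - Rd_dist d x y \<le> F w / L + Rd_dist d y w" if "w \<in> G" for w
    proof -
      have "h x \<le> F w / L + Rd_dist d x w"
        unfolding h_def by (rule cINF_lower[OF bdd that])
      then show ?thesis using Rd_dist_triangle[of d x w y] by linarith
    qed
    then have "h x - Rd_dist d x y \<le> h y"
      unfolding h_def[of y] by (intro cINF_greatest[OF False])
    then show ?thesis by linarith
  qed
  have hG: "h x = F x / L" if "x \<in> G" for x
  proof (rule antisym)
    show "h x \<le> F x / L"
      using cINF_lower[OF bdd that, of x] by (simp add: h_def Rd_dist_self)
    have "F x / L \<le> F y / L + Rd_dist d x y" if "y \<in> G" for y
    proof -
      have "F x - F y \<le> L * Rd_dist d x y" using lip[OF \<open>x \<in> G\<close> that] by linarith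
      then have "(F x - F y) / L \<le> Rd_dist d x y" using L by (simp add: field_simps)
      then show ?thesis by (simp add: diff_divide_distrib)
    qed
    then show "F x / L \<le> h x" unfolding h_def by (intro cINF_greatest[OF False])
  qed
  have "\<bar>h x - h y\<bar> \<le> Rd_dist d x y" for x y
    using hle[of x y] hle[of y x] by (auto simp: Rd_dist_commute[of d y x])
  then have "\<bar>clip (K / L) (h x) - clip (K / L) (h y)\<bar> \<le> Rd_dist d x y" for x y
    by (rule order_trans[OF clip_lipschitz])
  moreover have "clip (K / L) (h x) = F x / L" if "x \<in> G" for x
    using hG[OF that] bnd[OF that] L by (subst clip_eq) (auto simp: divide_right_mono)
  ultimately show ?thesis using G K L
    by (intro bexI[of _ "\<lambda>x\<in>space (Rd d). clip (K / L) (h x)"]) (auto simp: abs_clip_le subset_iff)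
qed

text \<open>
  A Lipschitz function of finitely many coordinates is continuous for the product topology on
  all sequences, whose Borel sets are generated by the coordinates.
\<close>

lemma borel_measurable_lipschitz:
  fixes f :: "(nat \<Rightarrow> real) \<Rightarrow> real"
  assumes lip: "\<And>x y. x \<in> space (Rd d) \<Longrightarrow> y \<in> space (Rd d) \<Longrightarrow> \<bar>f x - f y\<bar> \<le> Rd_dist d x y"
  shows "f \<in> borel_measurable (Rd d)"
proof -
  define f' where "f' y = f (restrict y {..<d})" for y :: "nat \<Rightarrow> real"
  have sp: "restrict y {..<d} \<in> space (Rd d)" for y :: "nat \<Rightarrow> real" by (auto simp: space_Rd)
  have "isCont f' y" for y
    unfolding isCont_def
  proof (rule Lim_null_comparison[where g="\<lambda>w. Rd_dist d w y", THEN Lim_null[THEN iffD2]])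
    have "Rd_dist d (restrict w {..<d}) (restrict y {..<d}) = Rd_dist d w y" for w
      unfolding Rd_dist_def by (intro L2_set_cong) auto
    then have "\<bar>f' w - f' y\<bar> \<le> Rd_dist d w y" for w
      using lip[OF sp sp, of w y] by (simp add: f'_def)
    then show "\<forall>\<^sub>F w in at y. norm (f' w - f' y) \<le> Rd_dist d w y" by simp
    have "continuous_on UNIV (\<lambda>w. Rd_dist d w y)"
      unfolding Rd_dist_def L2_set_def
      by (intro continuous_on_real_sqrt continuous_on_sum continuous_on_power continuous_on_diff
          continuous_on_const continuous_on_product_coordinates)
    then have "isCont (\<lambda>w. Rd_dist d w y) y" by (simp add: continuous_on_eq_continuous_at)
    then show "((\<lambda>w. Rd_dist d w y) \<longlongrightarrow> 0) (at y)" by (simp add: isCont_def Rd_dist_self)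
  qed
  then have "continuous_on UNIV f'" by (simp add: continuous_at_imp_continuous_on)
  then have f': "f' \<in> borel_measurable borel" by (rule borel_measurable_continuous_onI)
  have "(\<lambda>x. x) \<in> measurable (Rd d) (\<Pi>\<^sub>M i\<in>UNIV. borel)"
  proof (rule measurable_PiM_single')
    fix i :: nat
    show "(\<lambda>x. x i) \<in> borel_measurable (Rd d)"
    proof (cases "i < d")
      case True
      then show ?thesis by (intro measurable_Rd_component[OF refl])
    next
      case False
      have "(\<lambda>x. x i) \<in> borel_measurable (Rd d) \<longleftrightarrow> (\<lambda>x. undefined :: real) \<in> borel_measurable (Rd d)"
        using False by (intro measurable_cong) (auto simp: space_Rd PiE_def extensional_def)
      then show ?thesis by simp
    qed
  qed auto
  moreover have "measurable (Rd d) (\<Pi>\<^sub>M i\<in>(UNIV::nat set). borel :: real measure) = measurable (Rd d) borel"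
    by (intro measurable_cong_sets refl sets_PiM_equal_borel)
  ultimately have "(\<lambda>x. x) \<in> measurable (Rd d) borel" by blast
  then have "(\<lambda>x. f' x) \<in> borel_measurable (Rd d)" using f' by (rule measurable_compose)
  moreover have "f' x = f x" if "x \<in> space (Rd d)" for x
    using that by (simp add: f'_def space_Rd PiE_restrict)
  ultimately show ?thesis by (simp cong: measurable_cong)
qed

text \<open>
  A maximal separated set is also a net of the same radius.
\<close>

lemma maximal_separated_subset:
  assumes fin: "finite F" and sym: "\<And>f g. \<delta> f g = \<delta> g f" and self: "\<And>f. \<delta> f f = 0" and eps: "0 < \<epsilon>"
  shows "\<exists>S\<subseteq>F. eps_separated \<delta> \<epsilon> S \<and> (\<forall>f\<in>F. \<exists>g\<in>S. \<delta> f g < \<epsilon>)"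
proof -
  define C where "C = {S. S \<subseteq> F \<and> eps_separated \<delta> \<epsilon> S}"
  have "finite C" using fin by (simp add: C_def)
  moreover have "{} \<in> C" by (simp add: C_def eps_separated_def)
  ultimately obtain S where S: "S \<in> C" and max: "\<And>T. T \<in> C \<Longrightarrow> S \<subseteq> T \<Longrightarrow> S = T"
    using finite_has_maximal2[of C "{}"] by blast
  have "\<exists>g\<in>S. \<delta> f g < \<epsilon>" if f: "f \<in> F" for f
  proof (rule ccontr)
    assume "\<not> ?thesis"
    then have far: "\<epsilon> \<le> \<delta> f g" if "g \<in> S" for g using that by (auto simp: not_less)
    have "eps_separated \<delta> \<epsilon> (insert f S)"
      unfolding eps_separated_def
    proof (intro ballI impI)
      fix a b assume ab: "a \<in> insert f S" "b \<in> insert f S" "a \<noteq> b"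
      consider "a = f" "b \<in> S" | "a \<in> S" "b = f" | "a \<in> S" "b \<in> S" using ab by blast
      then show "\<epsilon> \<le> \<delta> a b"
      proof cases
        case 1
        then show ?thesis using far by simp
      next
        case 2
        then show ?thesis using far[of a] sym[of a f] by simp
      next
        case 3
        then show ?thesis using S ab(3) by (simp add: C_def eps_separated_def)
      qed
    qed
    then have "insert f S \<in> C" using S f by (simp add: C_def)
    then have "f \<in> S" using max[of "insert f S"] by blast
    then show False using far[of f] self eps by simp
  qed
  then show ?thesis using S by (auto simp: C_def)
qed

lemma H_Lip_ge_ln_card:
  assumes "S \<subseteq> B_Lip d \<mu>" "finite S" "S \<noteq> {}" "eps_separated (L2_dist \<mu>) \<epsilon> S"
  shows "ereal (ln (real (card S))) \<le> H_Lip d \<mu> \<epsilon>"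
proof -
  have le: "enat (card S) \<le> packing_number (B_Lip d \<mu>) \<epsilon> (L2_dist \<mu>)"
    unfolding packing_number_def using assms by (intro SUP_upper) auto
  have pos: "0 < card S" using assms by (simp add: card_gt_0_iff)
  show ?thesis
  proof (cases "packing_number (B_Lip d \<mu>) \<epsilon> (L2_dist \<mu>)")
    case (enat n)
    then have "card S \<le> n" using le by simp
    then have "ln (real (card S)) \<le> ln (real n)" using pos by (intro ln_mono) auto
    then show ?thesis by (simp add: H_Lip_def enat)
  next
    case infinity
    then show ?thesis by (simp add: H_Lip_def)
  qed
qed

text \<open>
  Jensen's inequality, from the tangent of the exponential function at the mean.
\<close>

lemma exp_rad_le:
  assumes "finite I"
  shows "exp (rad I F) \<le> rad I (\<lambda>A. exp (F A))"
proof -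
  have "exp (rad I F) = rad I (\<lambda>A. exp (rad I F) * (1 - rad I F) + exp (rad I F) * F A)"
    unfolding rad_add rad_cmult rad_const[OF assms] by (simp add: algebra_simps)
  also have "\<dots> \<le> rad I (\<lambda>A. exp (F A))"
  proof (rule rad_mono)
    fix A
    have "exp (rad I F) * (1 + (F A - rad I F)) \<le> exp (rad I F) * exp (F A - rad I F)"
      by (intro mult_left_mono exp_ge_add_one_self) auto
    then show "exp (rad I F) * (1 - rad I F) + exp (rad I F) * F A \<le> exp (F A)"
      by (simp add: exp_diff algebra_simps)
  qed
  finally show ?thesis .
qed

text \<open>
  This makes every polynomial in \<open>zmap d x\<close> bounded, hence integrable.
\<close>

lemma abs_zmap_le: "i < d \<Longrightarrow> \<bar>zmap d x i\<bar> \<le> sqrt (real d)"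
proof -
  assume i: "i < d"
  let ?Q = "\<Sum>i<d. (x i)\<^sup>2"
  have "(x i)\<^sup>2 \<le> ?Q" using i by (intro member_le_sum) auto
  then have "\<bar>x i\<bar> \<le> sqrt ?Q" by (simp add: real_le_rsqrt)
  moreover have "a / b \<le> 1" if "a \<le> b" "0 \<le> b" for a b :: real
    using that by (cases "b = 0") (auto simp: divide_le_eq)
  ultimately have "\<bar>x i\<bar> / sqrt ?Q \<le> 1" by (simp add: sum_nonneg)
  then have "sqrt (real d) * (\<bar>x i\<bar> / sqrt ?Q) \<le> sqrt (real d) * 1" by (intro mult_left_mono) auto
  then show ?thesis by (simp add: zmap_def abs_mult sum_nonneg)
qed

lemma borel_measurable_zmap:
  assumes sets: "sets \<mu> = sets (Rd d)" and i: "i < d"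
  shows "(\<lambda>x. zmap d x i) \<in> borel_measurable \<mu>"
proof -
  have [measurable]: "(\<lambda>x. x i) \<in> borel_measurable \<mu>" "(\<lambda>x. \<Sum>i<d. (x i)\<^sup>2) \<in> borel_measurable \<mu>"
    by (intro borel_measurable_sum borel_measurable_power measurable_Rd_component[OF sets] i; simp)+
  show ?thesis unfolding zmap_def by measurable
qed

abbreviation gram_sum :: "nat \<Rightarrow> nat \<Rightarrow> (nat \<Rightarrow> real) measure \<Rightarrow> (nat \<Rightarrow> real) set \<Rightarrow> ((nat \<Rightarrow> real) \<Rightarrow> real) \<Rightarrow> real" where
  "gram_sum d m \<mu> E g \<equiv> (\<Sum>S\<in>ksub d m. (LINT x|\<mu>. g x * (indicator E x * (\<Prod>i\<in>S. zmap d x i)))\<^sup>2)"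

section \<open>Entropy from a bound on the Gram operator\<close>

text \<open>
  The heart of the proof. The event \<open>E\<close> collects the points at which the random polynomial
  behaves well, and \<open>v\<close> bounds the variance of the correlation of the random polynomial with a
  fixed bounded function. The random polynomial, clipped to \<open>[-3, 3]\<close> and divided by
  \<open>5186 * sqrt m\<close>, is \<open>1\<close>-Lipschitz where its roughness is at most \<open>5184\<close>. The extensions from
  this set correlate with their polynomials, so a net of radius \<open>\<epsilon>\<close> for them must contain
  functions that correlate with the polynomials on average, and sub-Gaussian tails of these
  correlations force the net to be large.
\<close>

lemma entropy_lower_bound:
  fixes E :: "(nat \<Rightarrow> real) set"
  assumes prob: "prob_space \<mu>" and sets: "sets \<mu> = sets (Rd d)" and d: "d \<ge> 1" and m: "m \<ge> 1"
    and E: "E \<in> sets \<mu>" and E2: "\<And>x. x \<in> E \<Longrightarrow> real d / 4 \<le> (\<Sum>i<d. (x i)\<^sup>2)"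
    and E4: "\<And>x. x \<in> E \<Longrightarrow> (\<Sum>i<d. x i ^ 4) \<le> C * real d"
    and Cm: "32 * C * (real m)\<^sup>2 \<le> real d"
    and p0: "0 < p0" "p0 \<le> measure \<mu> E" and eps: "0 < \<epsilon>" "5186 * sqrt (real m) * \<epsilon> \<le> p0 / 8"
    and v: "0 < v"
    and gram: "\<And>g. g \<in> borel_measurable \<mu> \<Longrightarrow> (\<And>x. x \<in> space \<mu> \<Longrightarrow> \<bar>g x\<bar> \<le> 3) \<Longrightarrow>
       gram_sum d m \<mu> E g \<le> v * mono_var d m"
  shows "ereal (p0\<^sup>2 / (128 * v)) \<le> H_Lip d \<mu> \<epsilon>"
proof -
  interpret prob_space \<mu> by (rule prob)
  have sp: "space \<mu> = space (Rd d)" by (rule sets_eq_imp_space_eq[OF sets])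
  have Esp: "E \<subseteq> space (Rd d)" using sets.sets_into_space[OF E] sp by simp
  note [measurable] = E
  define I where "I = ksub d m"
  have finI: "finite I" by (simp add: I_def)
  define \<Lambda> where "\<Lambda> = 5186 * sqrt (real m)"
  have L0: "0 < \<Lambda>" using m by (simp add: \<Lambda>_def)
  have L6: "3 / \<Lambda> \<le> 1"
  proof -
    have "1 \<le> sqrt (real m)" using m by simp
    then have "3 \<le> \<Lambda>" unfolding \<Lambda>_def by linarith
    then show ?thesis using L0 by simp
  qed
  define p where "p A x = rpoly d m A (zmap d x)" for A x
  define D where "D A x = roughness d m A (zmap d x)" for A x
  define G where "G A = {x \<in> E. D A x \<le> 5184}" for A
  have lip: "\<bar>clip 3 (p A y) - clip 3 (p A x)\<bar> \<le> \<Lambda> * Rd_dist d y x" if x: "x \<in> G A" and y: "y \<in> E" for A x y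
  proof -
    (* The length t of the increment, in units of 1 / sqrt m, decides between the Taylor
       estimate, with constant 1 + 5184 / 2 = 2593, and the trivial bound 6 for clipped values.
       *)
    define t where "t = sqrt (real m * (\<Sum>i<d. (zmap d y i - zmap d x i)\<^sup>2))"
    have t2: "t\<^sup>2 = real m * (\<Sum>i<d. (zmap d y i - zmap d x i)\<^sup>2)" "0 \<le> t"
      by (simp_all add: t_def sum_nonneg)
    have xE: "x \<in> E" and Dx: "D A x \<le> 5184" using x by (auto simp: G_def)
    have "t \<le> sqrt (real m * (4 * (Rd_dist d y x)\<^sup>2))"
      unfolding t_def Rd_dist_square
      by (intro real_sqrt_le_mono mult_left_mono zmap_lipschitz E2 d xE y) simp
    also have "\<dots> = 2 * sqrt (real m) * Rd_dist d y x"
      by (simp add: real_sqrt_mult Rd_dist_nonneg)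
    finally have t: "t \<le> 2 * sqrt (real m) * Rd_dist d y x" .
    have "\<bar>clip 3 (p A y) - clip 3 (p A x)\<bar> \<le> 2593 * t"
    proof (cases "t \<le> 1")
      case True
      have "\<bar>clip 3 (p A y) - clip 3 (p A x)\<bar> \<le> \<bar>p A y - p A x\<bar>" by (rule clip_lipschitz)
      also have "\<dots> \<le> t * (1 + D A x / 2)"
        unfolding p_def D_def using m t2 True by (rule rpoly_increment_le)
      also have "\<dots> \<le> t * 2593" using Dx t2(2) by (intro mult_left_mono) auto
      finally show ?thesis by simp
    next
      case False
      have "\<bar>clip 3 (p A y) - clip 3 (p A x)\<bar> \<le> 3 + 3"
        using abs_clip_le[of 3 "p A y"] abs_clip_le[of 3 "p A x"] by linarith
      also have "\<dots> \<le> 2593 * t" using False by simp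
      finally show ?thesis .
    qed
    also have "2593 * t \<le> 2593 * (2 * sqrt (real m) * Rd_dist d y x)" using t by simp
    finally show ?thesis by (simp add: \<Lambda>_def)
  qed
  have "\<exists>f. f \<in> extensional (space (Rd d)) \<and> (\<forall>x\<in>space (Rd d). \<forall>y\<in>space (Rd d). \<bar>f x - f y\<bar> \<le> Rd_dist d x y) \<and>
     (\<forall>x\<in>space (Rd d). \<bar>f x\<bar> \<le> 3 / \<Lambda>) \<and> (\<forall>x\<in>G A. f x = clip 3 (p A x) / \<Lambda>)" for A
    using lipschitz_extension[of 3 \<Lambda> "G A" "\<lambda>x. clip 3 (p A x)" d] lip L0 Esp
    by (auto simp: abs_clip_le G_def Bex_def subset_iff)
  then obtain f where f: "\<And>A. f A \<in> extensional (space (Rd d))"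
    "\<And>A x y. x \<in> space (Rd d) \<Longrightarrow> y \<in> space (Rd d) \<Longrightarrow> \<bar>f A x - f A y\<bar> \<le> Rd_dist d x y"
    "\<And>A x. x \<in> space (Rd d) \<Longrightarrow> \<bar>f A x\<bar> \<le> 3 / \<Lambda>" "\<And>A x. x \<in> G A \<Longrightarrow> f A x = clip 3 (p A x) / \<Lambda>"
    by metis
  have f_meas [measurable]: "f A \<in> borel_measurable \<mu>" for A
    unfolding measurable_cong_sets[OF sets refl] using f(2) by (rule borel_measurable_lipschitz)
  have f_le1: "\<bar>f A x\<bar> \<le> 1" if "x \<in> space \<mu>" for A x
    using f(3)[of x A] that L6 sp by simp
  have fB: "f A \<in> B_Lip d \<mu>" for A
  proof -
    have sq: "(f A x)\<^sup>2 \<le> 1" if "x \<in> space \<mu>" for x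
      using f_le1[OF that, of A] by (simp add: abs_square_le_1)
    have int: "integrable \<mu> (\<lambda>x. (f A x)\<^sup>2)"
      using sq by (intro integrable_const_bound[where B=1]) auto
    have "(LINT x|\<mu>. (f A x)\<^sup>2) \<le> (LINT x|\<mu>. 1)"
      using sq by (intro integral_mono int) auto
    then show ?thesis using f int by (auto simp: B_Lip_def prob_space)
  qed

  note z_meas = borel_measurable_zmap[OF sets]
  have mono_meas [measurable]: "(\<lambda>x. \<Prod>i\<in>S. zmap d x i) \<in> borel_measurable \<mu>" if "S \<in> I" for S
    using that by (intro borel_measurable_prod z_meas) (auto simp: I_def ksub_def)
  have mono_le: "\<bar>\<Prod>i\<in>S. zmap d x i\<bar> \<le> sqrt (real d) ^ m" if "S \<in> I" for S x
  proof -
    have "\<bar>\<Prod>i\<in>S. zmap d x i\<bar> \<le> (\<Prod>i\<in>S. sqrt (real d))"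
      unfolding abs_prod using that by (intro prod_mono) (auto simp: I_def ksub_def intro!: abs_zmap_le)
    then show ?thesis using that by (simp add: I_def ksub_def)
  qed
  have p_eq: "p A x = (\<Sum>S\<in>I. sg A S * ((\<Prod>i\<in>S. zmap d x i) / sqrt (mono_var d m)))" for A x
    by (simp add: p_def rpoly_eq radlin_def I_def)
  have p_meas [measurable]: "p A \<in> borel_measurable \<mu>" for A
    unfolding p_eq[abs_def] by (intro borel_measurable_sum borel_measurable_times borel_measurable_divide mono_meas) auto
  define B where "B = real (card I) * (sqrt (real d) ^ m / sqrt (mono_var d m))"
  have p_le: "\<bar>p A x\<bar> \<le> B" for A x
  proof -
    have "\<bar>p A x\<bar> \<le> (\<Sum>S\<in>I. \<bar>sg A S * ((\<Prod>i\<in>S. zmap d x i) / sqrt (mono_var d m))\<bar>)"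
      unfolding p_eq by (rule sum_abs)
    also have "\<dots> \<le> (\<Sum>S\<in>I. sqrt (real d) ^ m / sqrt (mono_var d m))"
    proof (rule sum_mono)
      fix S assume "S \<in> I"
      have "\<bar>sg A S * ((\<Prod>i\<in>S. zmap d x i) / sqrt (mono_var d m))\<bar> = \<bar>\<Prod>i\<in>S. zmap d x i\<bar> / sqrt (mono_var d m)"
        by (simp add: abs_mult sg_def mono_var_def)
      also have "\<dots> \<le> sqrt (real d) ^ m / sqrt (mono_var d m)"
        using mono_le[OF \<open>S \<in> I\<close>] by (intro divide_right_mono) (auto simp: mono_var_def)
      finally show "\<bar>sg A S * ((\<Prod>i\<in>S. zmap d x i) / sqrt (mono_var d m))\<bar> \<le> sqrt (real d) ^ m / sqrt (mono_var d m)" .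
    qed
    finally show ?thesis by (simp add: B_def)
  qed
  have B0: "0 \<le> B" using p_le[of "{}" undefined] by linarith

  have rad_p: "1/2 \<le> rad I (\<lambda>A. (p A x)\<^sup>2)" "rad I (\<lambda>A. (p A x)\<^sup>2) \<le> 1"
    "rad I (\<lambda>A. p A x ^ 4) \<le> 3 * (rad I (\<lambda>A. (p A x)\<^sup>2))\<^sup>2" "rad I (\<lambda>A. D A x) \<le> 2" if x: "x \<in> E" for x
  proof -
    have "0 < (\<Sum>i<d. (x i)\<^sup>2)" using E2[OF x] d by (intro less_le_trans[OF _ E2[OF x]]) simp
    then have z2: "(\<Sum>i<d. (zmap d x i)\<^sup>2) = real d" by (rule zmap_square_sum)
    have z4: "(\<Sum>i<d. zmap d x i ^ 4) \<le> (16 * C) * real d"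
      using zmap_fourth_sum[OF E2[OF x] d] E4[OF x] by linarith
    show "1/2 \<le> rad I (\<lambda>A. (p A x)\<^sup>2)" "rad I (\<lambda>A. (p A x)\<^sup>2) \<le> 1"
      using rad_rpoly_square_bounds[OF d z2 z4] Cm by (simp_all add: p_def I_def)
    show "rad I (\<lambda>A. p A x ^ 4) \<le> 3 * (rad I (\<lambda>A. (p A x)\<^sup>2))\<^sup>2"
      unfolding p_def I_def by (rule rad_rpoly_fourth)
    show "rad I (\<lambda>A. D A x) \<le> 2"
      unfolding D_def I_def by (rule rad_roughness_le[OF d m z2])
  qed

  (* Where the roughness is small, the fourth power accounts for the clipping. Elsewhere |Lambda
     f p| and p^2 - p^4 / 9 are at most 3 |p|, so the former falls short of the latter by at
     most 6 |p|, which is at most p^2 / 12 + 108, and 108 = 5184 / 48. *)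
  have ptw: "(11/12) * (p A x)\<^sup>2 - p A x ^ 4 / 9 - D A x / 48 \<le> \<Lambda> * f A x * p A x" if x: "x \<in> E" for A x
  proof (cases "x \<in> G A")
    case True
    have "\<Lambda> * f A x * p A x = clip 3 (p A x) * p A x" using f(4)[OF True] L0 by simp
    moreover have "(p A x)\<^sup>2 - p A x ^ 4 / 9 \<le> clip 3 (p A x) * p A x"
      using clip_times_self_ge[of 3 "p A x"] by simp
    moreover have "0 \<le> D A x" unfolding D_def by (rule roughness_nonneg)
    moreover have "0 \<le> (p A x)\<^sup>2" by simp
    ultimately show ?thesis by linarith
  next
    case False
    have "5184 < D A x" using False x by (simp add: G_def)
    have "\<bar>\<Lambda> * f A x * p A x\<bar> \<le> 3 * \<bar>p A x\<bar>"
    proof -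
      have "\<Lambda> * \<bar>f A x\<bar> \<le> \<Lambda> * (3 / \<Lambda>)" using f(3)[of x A] x Esp L0 by (intro mult_left_mono) auto
      then have "\<Lambda> * \<bar>f A x\<bar> \<le> 3" using L0 by simp
      then show ?thesis using L0 by (simp add: abs_mult mult_right_mono)
    qed
    moreover have "(p A x)\<^sup>2 - p A x ^ 4 / 9 \<le> 3 * \<bar>p A x\<bar>"
      using clip_times_self_ge[of 3 "p A x"] clip_times_self_le[of 3 "p A x"] by simp
    moreover have "6 * \<bar>p A x\<bar> \<le> (p A x)\<^sup>2 / 12 + 108"
    proof -
      have "0 \<le> (\<bar>p A x\<bar> / 6 - 6)\<^sup>2 * 3" by simp
      also have "\<dots> = (p A x)\<^sup>2 / 12 + 108 - 6 * \<bar>p A x\<bar>"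
        by (simp add: power2_diff power_divide)
      finally show ?thesis by simp
    qed
    ultimately show ?thesis using \<open>5184 < D A x\<close> by linarith
  qed
  have rad_fp: "1/4 \<le> rad I (\<lambda>A. \<Lambda> * f A x * p A x)" if x: "x \<in> E" for x
  proof -
    let ?q = "rad I (\<lambda>A. (p A x)\<^sup>2)"
    have q: "1/2 \<le> ?q" "?q \<le> 1" "?q\<^sup>2 \<le> ?q"
      using rad_p(1,2)[OF x] by (auto simp: power2_eq_square intro: mult_left_le)
    have "rad I (\<lambda>A. (11/12) * (p A x)\<^sup>2 - p A x ^ 4 / 9 - D A x / 48)
        = (11/12) * ?q - rad I (\<lambda>A. p A x ^ 4) / 9 - rad I (\<lambda>A. D A x) / 48"
      by (simp only: rad_diff rad_cmult rad_divide)
    also have "\<dots> \<ge> 1/4" using q rad_p(3,4)[OF x] by linarith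
    finally have "1/4 \<le> rad I (\<lambda>A. (11/12) * (p A x)\<^sup>2 - p A x ^ 4 / 9 - D A x / 48)" .
    also have "\<dots> \<le> rad I (\<lambda>A. \<Lambda> * f A x * p A x)" by (intro rad_mono ptw x)
    finally show ?thesis .
  qed

  (* Passing from f A to its neighbour in S costs at most tau in the mean correlation, which is
     half of what is available. *)
  define \<tau> where "\<tau> = p0 / 8"
  have tau: "0 < \<tau>" "\<Lambda> * \<epsilon> \<le> \<tau>" using p0 eps by (simp_all add: \<tau>_def \<Lambda>_def)
  obtain S where S: "S \<subseteq> f ` Pow I" "eps_separated (L2_dist \<mu>) \<epsilon> S"
    "\<And>h. h \<in> f ` Pow I \<Longrightarrow> \<exists>g\<in>S. L2_dist \<mu> h g < \<epsilon>"
  proof -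
    have sym: "L2_dist \<mu> h g = L2_dist \<mu> g h" for h g by (simp only: L2_dist_def power2_commute)
    have self: "L2_dist \<mu> h h = 0" for h by (simp add: L2_dist_def)
    from maximal_separated_subset[OF finite_imageI[OF finite_Pow_iff[THEN iffD2, OF finI], of f], where \<delta>="L2_dist \<mu>", OF sym self eps(1)]
    obtain S where S: "S \<subseteq> f ` Pow I" "eps_separated (L2_dist \<mu>) \<epsilon> S"
      "\<forall>h\<in>f ` Pow I. \<exists>g\<in>S. L2_dist \<mu> h g < \<epsilon>" by (elim exE conjE)
    show thesis by (rule that[OF S(1,2) S(3)[rule_format]])
  qed
  have finS: "finite S" using S(1) finI by (auto intro: finite_subset)
  have neS: "S \<noteq> {}" using S(3)[of "f {}"] by auto
  have SB: "S \<subseteq> B_Lip d \<mu>" using S(1) fB by blast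
  have S_meas: "g \<in> borel_measurable \<mu>" and S_le: "x \<in> space \<mu> \<Longrightarrow> \<Lambda> * \<bar>g x\<bar> \<le> 3" if gS: "g \<in> S" for g x
  proof -
    obtain A where A: "g = f A" using S(1) gS by auto
    show "g \<in> borel_measurable \<mu>" using A by simp
    show "\<Lambda> * \<bar>g x\<bar> \<le> 3" if "x \<in> space \<mu>"
      using f(3)[of x A] that sp A L0 by (simp add: field_simps)
  qed
  have "\<exists>g\<in>S. L2_dist \<mu> (f A) g < \<epsilon>" if "A \<subseteq> I" for A using S(3) that by blast
  then obtain c where c: "\<And>A. A \<subseteq> I \<Longrightarrow> c A \<in> S" "\<And>A. A \<subseteq> I \<Longrightarrow> L2_dist \<mu> (f A) (c A) < \<epsilon>"
    by metis

  have bint: "integrable \<mu> h" if "h \<in> borel_measurable \<mu>" "\<And>x. x \<in> space \<mu> \<Longrightarrow> \<bar>h x\<bar> \<le> b" for h :: "_ \<Rightarrow> real" and b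
    using that by (intro integrable_const_bound[where B=b]) auto
  define Z where "Z g A = (LINT x|\<mu>. \<Lambda> * g x * p A x * indicator E x)" for g A
  have Zint: "integrable \<mu> (\<lambda>x. \<Lambda> * g x * p A x * indicator E x)"
    if [measurable]: "g \<in> borel_measurable \<mu>" and "\<And>x. x \<in> space \<mu> \<Longrightarrow> \<Lambda> * \<bar>g x\<bar> \<le> 3" for g A
  proof (rule bint)
    fix x assume "x \<in> space \<mu>"
    then have "(\<Lambda> * \<bar>g x\<bar>) * (\<bar>p A x\<bar> * \<bar>indicator E x\<bar>) \<le> 3 * (B * 1)"
      using that(2) p_le B0 by (intro mult_mono) (auto simp: indicator_def)
    then show "\<bar>\<Lambda> * g x * p A x * indicator E x\<bar> \<le> 3 * B" using L0 by (simp add: abs_mult mult_ac)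
  qed measurable
  have p2int: "integrable \<mu> (\<lambda>x. (p A x)\<^sup>2 * indicator E x)" for A
  proof (rule bint)
    fix x
    have "(p A x)\<^sup>2 \<le> B\<^sup>2" using p_le[of A x] B0 by (subst abs_le_square_iff[symmetric]) simp
    then show "\<bar>(p A x)\<^sup>2 * indicator E x\<bar> \<le> B\<^sup>2" by (auto simp: indicator_def)
  qed measurable
  have L_le: "\<Lambda> * \<bar>f A x\<bar> \<le> 3" if "x \<in> space \<mu>" for A x
    using f(3)[of x A] that sp L0 by (simp add: field_simps)
  have rad_int: "rad I (\<lambda>A. LINT x|\<mu>. F A x) = (LINT x|\<mu>. rad I (\<lambda>A. F A x))"
    if "\<And>A. integrable \<mu> (F A)" for F :: "nat set set \<Rightarrow> (nat \<Rightarrow> real) \<Rightarrow> real"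
    using that unfolding rad_def by (simp add: Bochner_Integration.integral_sum)
  have radY: "p0 / 4 \<le> rad I (\<lambda>A. Z (f A) A)"
  proof -
    have i1: "integrable \<mu> (\<lambda>x. \<Lambda> * f A x * p A x * indicator E x)" for A
      by (rule Zint) (auto simp: L_le)
    have "p0 / 4 \<le> (LINT x|\<mu>. (1/4) * indicator E x)" using p0 E by simp
    also have "\<dots> \<le> (LINT x|\<mu>. rad I (\<lambda>A. \<Lambda> * f A x * p A x * indicator E x))"
    proof (rule integral_mono)
      show "integrable \<mu> (\<lambda>x. (1/4) * indicator E x :: real)" using E by (intro bint[of _ 1]) (auto simp: indicator_def)
      show "integrable \<mu> (\<lambda>x. rad I (\<lambda>A. \<Lambda> * f A x * p A x * indicator E x))"
        unfolding rad_def using i1 by (intro integrable_divide Bochner_Integration.integrable_sum)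
      show "(1/4) * indicator E x \<le> rad I (\<lambda>A. \<Lambda> * f A x * p A x * indicator E x)" for x
        using rad_fp[of x] by (cases "x \<in> E") (auto simp: rad_const[OF finI])
    qed
    also have "\<dots> = rad I (\<lambda>A. Z (f A) A)" unfolding Z_def using i1 by (intro rad_int[symmetric])
    finally show ?thesis .
  qed
  have radp2: "rad I (\<lambda>A. LINT x|\<mu>. (p A x)\<^sup>2 * indicator E x) \<le> 1"
  proof -
    have "rad I (\<lambda>A. LINT x|\<mu>. (p A x)\<^sup>2 * indicator E x) = (LINT x|\<mu>. rad I (\<lambda>A. (p A x)\<^sup>2 * indicator E x))"
      by (intro rad_int p2int)
    also have "\<dots> \<le> (LINT x|\<mu>. 1)"
    proof (rule integral_mono)
      show "integrable \<mu> (\<lambda>x. rad I (\<lambda>A. (p A x)\<^sup>2 * indicator E x))"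
        unfolding rad_def using p2int by (intro integrable_divide Bochner_Integration.integrable_sum)
      show "rad I (\<lambda>A. (p A x)\<^sup>2 * indicator E x) \<le> 1" for x
        using rad_p(2)[of x] by (cases "x \<in> E") (auto simp: rad_const[OF finI])
    qed simp
    finally show ?thesis by (simp add: prob_space)
  qed
  have near: "Z (f A) A - (\<tau> / 2) * (1 + (LINT x|\<mu>. (p A x)\<^sup>2 * indicator E x)) \<le> Z (c A) A" if A: "A \<subseteq> I" for A
  proof -
    note cS = c(1)[OF A]
    note [measurable] = S_meas[OF cS]
    have i2: "integrable \<mu> (\<lambda>x. (f A x - c A x)\<^sup>2)"
    proof (rule bint)
      fix x assume x: "x \<in> space \<mu>"
      have "\<Lambda> * \<bar>f A x - c A x\<bar> \<le> \<Lambda> * \<bar>f A x\<bar> + \<Lambda> * \<bar>c A x\<bar>"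
        using L0 by (simp add: distrib_left[symmetric])
      then have "\<bar>f A x - c A x\<bar> \<le> \<bar>6 / \<Lambda>\<bar>"
        using L_le[OF x, of A] S_le[OF cS x] L0 by (simp add: field_simps)
      then have "(f A x - c A x)\<^sup>2 \<le> (6 / \<Lambda>)\<^sup>2" by (rule abs_le_square_iff[THEN iffD1])
      then show "\<bar>(f A x - c A x)\<^sup>2\<bar> \<le> (6 / \<Lambda>)\<^sup>2" by simp
    qed measurable
    have "L2_dist \<mu> (f A) (c A) \<le> \<epsilon>" using c(2)[OF A] by simp
    then have "(LINT x|\<mu>. (f A x - c A x)\<^sup>2) \<le> \<epsilon>\<^sup>2"
      unfolding L2_dist_def using eps(1) by (simp add: sqrt_le_D)
    then have "\<Lambda>\<^sup>2 / (2 * \<tau>) * (LINT x|\<mu>. (f A x - c A x)\<^sup>2) \<le> \<Lambda>\<^sup>2 / (2 * \<tau>) * \<epsilon>\<^sup>2"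
      using tau by (intro mult_left_mono) auto
    also have "\<dots> = (\<Lambda> * \<epsilon>)\<^sup>2 / (2 * \<tau>)" by (simp add: power_mult_distrib)
    also have "\<dots> \<le> \<tau>\<^sup>2 / (2 * \<tau>)"
      using tau L0 eps(1) by (intro divide_right_mono power_mono) auto
    also have "\<dots> = \<tau> / 2" using tau by (simp add: power2_eq_square)
    finally have d2: "\<Lambda>\<^sup>2 / (2 * \<tau>) * (LINT x|\<mu>. (f A x - c A x)\<^sup>2) \<le> \<tau> / 2" .
    have "Z (f A) A - Z (c A) A = (LINT x|\<mu>. \<Lambda> * f A x * p A x * indicator E x - \<Lambda> * c A x * p A x * indicator E x)"
      unfolding Z_def using L_le S_le[OF cS]
      by (intro Bochner_Integration.integral_diff[symmetric] Zint) auto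
    also have "\<dots> \<le> (LINT x|\<mu>. \<Lambda>\<^sup>2 / (2 * \<tau>) * (f A x - c A x)\<^sup>2 + (\<tau> / 2) * ((p A x)\<^sup>2 * indicator E x))"
    proof (rule integral_mono)
      show "integrable \<mu> (\<lambda>x. \<Lambda> * f A x * p A x * indicator E x - \<Lambda> * c A x * p A x * indicator E x)"
        using L_le S_le[OF cS] by (intro Bochner_Integration.integrable_diff Zint) auto
      show "integrable \<mu> (\<lambda>x. \<Lambda>\<^sup>2 / (2 * \<tau>) * (f A x - c A x)\<^sup>2 + (\<tau> / 2) * ((p A x)\<^sup>2 * indicator E x))"
        by (intro Bochner_Integration.integrable_add integrable_mult_right i2 p2int)
      fix x
      define a b where "a = \<Lambda> * (f A x - c A x)" and "b = p A x"
      have "0 \<le> (a - \<tau> * b)\<^sup>2 / (2 * \<tau>)" using tau by simp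
      also have "\<dots> = a\<^sup>2 / (2 * \<tau>) + (\<tau> / 2) * b\<^sup>2 - a * b"
        using tau by (simp add: power2_diff field_simps) (simp add: power2_eq_square)
      finally have "a * b \<le> a\<^sup>2 / (2 * \<tau>) + (\<tau> / 2) * b\<^sup>2" by simp
      moreover have "0 \<le> a\<^sup>2 / (2 * \<tau>)" using tau by simp
      moreover have "a\<^sup>2 / (2 * \<tau>) = \<Lambda>\<^sup>2 / (2 * \<tau>) * (f A x - c A x)\<^sup>2"
        by (simp add: a_def power_mult_distrib)
      moreover have "a * b = \<Lambda> * f A x * p A x - \<Lambda> * c A x * p A x"
        by (simp add: a_def b_def algebra_simps)
      ultimately show "\<Lambda> * f A x * p A x * indicator E x - \<Lambda> * c A x * p A x * indicator E x
          \<le> \<Lambda>\<^sup>2 / (2 * \<tau>) * (f A x - c A x)\<^sup>2 + (\<tau> / 2) * ((p A x)\<^sup>2 * indicator E x)"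
        by (cases "x \<in> E") (simp_all add: b_def)
    qed
    also have "\<dots> = \<Lambda>\<^sup>2 / (2 * \<tau>) * (LINT x|\<mu>. (f A x - c A x)\<^sup>2) + (\<tau> / 2) * (LINT x|\<mu>. (p A x)\<^sup>2 * indicator E x)"
      using i2 p2int by (subst Bochner_Integration.integral_add) (auto intro: integrable_mult_right)
    finally show ?thesis using d2 by (simp add: distrib_left)
  qed
  have radZ: "p0 / 8 \<le> rad I (\<lambda>A. Z (c A) A)"
  proof -
    have "p0 / 4 - (\<tau> / 2) * (1 + 1)
        \<le> rad I (\<lambda>A. Z (f A) A) - (\<tau> / 2) * (1 + rad I (\<lambda>A. LINT x|\<mu>. (p A x)\<^sup>2 * indicator E x))"
      using tau radY radp2 by (intro diff_mono mult_left_mono add_left_mono) auto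
    also have "\<dots> = rad I (\<lambda>A. Z (f A) A - (\<tau> / 2) * (1 + (LINT x|\<mu>. (p A x)\<^sup>2 * indicator E x)))"
      by (simp only: rad_diff rad_cmult rad_add rad_const[OF finI])
    also have "\<dots> \<le> rad I (\<lambda>A. Z (c A) A)" by (intro rad_mono near)
    finally show ?thesis by (simp add: \<tau>_def)
  qed
  (* This value of l maximises l * p0 / 8 - l^2 * v / 2. *)
  define l where "l = p0 / (8 * v)"
  have l0: "0 < l" using p0 v by (simp add: l_def)
  have expZ: "rad I (\<lambda>A. exp (l * Z g A)) \<le> exp (l\<^sup>2 * v / 2)" if g: "g \<in> S" for g
  proof -
    note [measurable] = S_meas[OF g]
    define \<beta> where "\<beta> S = (LINT x|\<mu>. (\<Lambda> * g x) * (indicator E x * (\<Prod>i\<in>S. zmap d x i)))" for S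
    have W: "0 < mono_var d m" using d by (simp add: mono_var_def)
    have bi: "integrable \<mu> (\<lambda>x. (\<Lambda> * g x) * (indicator E x * (\<Prod>i\<in>S. zmap d x i)))" if "S \<in> I" for S
    proof (rule bint)
      fix x assume "x \<in> space \<mu>"
      then have "(\<Lambda> * \<bar>g x\<bar>) * (\<bar>indicator E x\<bar> * \<bar>\<Prod>i\<in>S. zmap d x i\<bar>) \<le> 3 * (1 * sqrt (real d) ^ m)"
        using S_le[OF g] mono_le[OF that] by (intro mult_mono) (auto simp: indicator_def)
      then show "\<bar>(\<Lambda> * g x) * (indicator E x * (\<Prod>i\<in>S. zmap d x i))\<bar> \<le> 3 * sqrt (real d) ^ m"
        using L0 by (simp add: abs_mult)
    qed (use that in measurable)
    have "l * Z g A = radlin I (\<lambda>S. l * \<beta> S / sqrt (mono_var d m)) A" for A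
    proof -
      have "Z g A = (LINT x|\<mu>. (\<Sum>S\<in>I. sg A S / sqrt (mono_var d m) * ((\<Lambda> * g x) * (indicator E x * (\<Prod>i\<in>S. zmap d x i)))))"
        unfolding Z_def p_eq by (intro Bochner_Integration.integral_cong refl) (simp add: sum_distrib_left sum_distrib_right mult_ac)
      also have "\<dots> = (\<Sum>S\<in>I. sg A S / sqrt (mono_var d m) * \<beta> S)"
        unfolding \<beta>_def using bi by (subst Bochner_Integration.integral_sum) auto
      finally show ?thesis unfolding radlin_def by (simp add: sum_distrib_left mult_ac)
    qed
    then have "rad I (\<lambda>A. exp (l * Z g A)) \<le> exp ((\<Sum>S\<in>I. (l * \<beta> S / sqrt (mono_var d m))\<^sup>2) / 2)"
      using rad_exp_radlin[OF finI] by simp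
    also have "(\<Sum>S\<in>I. (l * \<beta> S / sqrt (mono_var d m))\<^sup>2) = l\<^sup>2 / mono_var d m * (\<Sum>S\<in>I. (\<beta> S)\<^sup>2)"
      using W by (simp add: power_mult_distrib power_divide sum_distrib_left)
    also have "l\<^sup>2 / mono_var d m * (\<Sum>S\<in>I. (\<beta> S)\<^sup>2) \<le> l\<^sup>2 / mono_var d m * (v * mono_var d m)"
      unfolding \<beta>_def I_def using S_le[OF g] W L0
      by (intro mult_left_mono gram) (auto simp: abs_mult)
    also have "\<dots> = l\<^sup>2 * v" using W by simp
    finally show ?thesis by simp
  qed
  have "exp (l * (p0 / 8)) \<le> exp (rad I (\<lambda>A. l * Z (c A) A))"
    using radZ l0 by (simp add: rad_cmult mult_left_mono)
  also have "\<dots> \<le> rad I (\<lambda>A. exp (l * Z (c A) A))" by (rule exp_rad_le[OF finI])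
  also have "\<dots> \<le> rad I (\<lambda>A. \<Sum>g\<in>S. exp (l * Z g A))"
    using c(1) finS by (intro rad_mono member_le_sum) auto
  also have "\<dots> = (\<Sum>g\<in>S. rad I (\<lambda>A. exp (l * Z g A)))" by (rule rad_sum)
  also have "\<dots> \<le> (\<Sum>g\<in>S. exp (l\<^sup>2 * v / 2))" by (intro sum_mono expZ)
  also have "\<dots> = real (card S) * exp (l\<^sup>2 * v / 2)" by simp
  finally have "exp (l * (p0 / 8) - l\<^sup>2 * v / 2) \<le> real (card S)"
    unfolding exp_diff by (subst pos_divide_le_eq) simp_all
  then have "l * (p0 / 8) - l\<^sup>2 * v / 2 \<le> ln (real (card S))"
    by (subst ln_ge_iff) (use finS neS in \<open>auto simp: card_gt_0_iff\<close>)
  moreover have "l * (p0 / 8) - l\<^sup>2 * v / 2 = p0\<^sup>2 / (128 * v)"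
    using v by (simp add: l_def power2_eq_square field_simps)
  ultimately have "ereal (p0\<^sup>2 / (128 * v)) \<le> ereal (ln (real (card S)))" by simp
  also have "\<dots> \<le> H_Lip d \<mu> \<epsilon>"
    by (rule H_Lip_ge_ln_card[OF SB finS neS S(2)])
  finally show ?thesis .
qed

section \<open>Product measures\<close>

lemma bessel_inequality:
  fixes e :: "'s \<Rightarrow> 'a \<Rightarrow> real"
  assumes fin: "finite I"
    and ee: "\<And>S T. S \<in> I \<Longrightarrow> T \<in> I \<Longrightarrow> integrable M (\<lambda>x. e S x * e T x)"
    and on: "\<And>S T. S \<in> I \<Longrightarrow> T \<in> I \<Longrightarrow> (LINT x|M. e S x * e T x) = (if S = T then 1 else 0)"
    and g2: "integrable M (\<lambda>x. (g x)\<^sup>2)" and ge: "\<And>S. S \<in> I \<Longrightarrow> integrable M (\<lambda>x. g x * e S x)"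
  shows "(\<Sum>S\<in>I. (LINT x|M. g x * e S x)\<^sup>2) \<le> (LINT x|M. (g x)\<^sup>2)"
proof -
  define c where "c S = (LINT x|M. g x * e S x)" for S
  have sq: "(g x - (\<Sum>S\<in>I. c S * e S x))\<^sup>2
      = (g x)\<^sup>2 - 2 * (\<Sum>S\<in>I. c S * (g x * e S x)) + (\<Sum>S\<in>I. \<Sum>T\<in>I. (c S * c T) * (e S x * e T x))" for x
    unfolding power2_diff by (simp add: power2_eq_square sum_product sum_distrib_left mult_ac)
  have i1: "integrable M (\<lambda>x. \<Sum>S\<in>I. c S * (g x * e S x))"
    by (intro Bochner_Integration.integrable_sum integrable_mult_right ge)
  have i2: "integrable M (\<lambda>x. \<Sum>T\<in>I. (c S * c T) * (e S x * e T x))" if "S \<in> I" for S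
    by (intro Bochner_Integration.integrable_sum integrable_mult_right ee that)
  have e1: "(LINT x|M. (\<Sum>S\<in>I. c S * (g x * e S x))) = (\<Sum>S\<in>I. (c S)\<^sup>2)"
    by (subst Bochner_Integration.integral_sum) (auto intro!: integrable_mult_right ge simp: c_def power2_eq_square)
  have e2: "(LINT x|M. (\<Sum>T\<in>I. (c S * c T) * (e S x * e T x))) = (c S)\<^sup>2" if S: "S \<in> I" for S
  proof -
    have "(LINT x|M. (\<Sum>T\<in>I. (c S * c T) * (e S x * e T x))) = (\<Sum>T\<in>I. (LINT x|M. (c S * c T) * (e S x * e T x)))"
      by (intro Bochner_Integration.integral_sum integrable_mult_right ee S)
    also have "\<dots> = (\<Sum>T\<in>I. if T = S then (c S)\<^sup>2 else 0)"
      by (intro sum.cong refl) (auto simp: on[OF S] power2_eq_square)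
    finally show ?thesis using S fin by simp
  qed
  have "0 \<le> (LINT x|M. (g x - (\<Sum>S\<in>I. c S * e S x))\<^sup>2)" by (intro Bochner_Integration.integral_nonneg) auto
  also have "\<dots> = (LINT x|M. (g x)\<^sup>2) - 2 * (\<Sum>S\<in>I. (c S)\<^sup>2) + (\<Sum>S\<in>I. (c S)\<^sup>2)"
    unfolding sq using i1 i2 g2 e1 e2
    by (subst Bochner_Integration.integral_add, (auto)[2], subst Bochner_Integration.integral_diff, (auto)[2],
        subst Bochner_Integration.integral_sum) auto
  finally show ?thesis by (simp add: c_def)
qed

text \<open>
  Exponents up to \<open>2\<close> suffice both for the products of two multilinear monomials and for the
  variance of the squared norm.
\<close>

lemma product_measure_moments:
  assumes prob: "prob_space \<mu>" and sets: "sets \<mu> = sets (Rd d)" and iso: "isotropic d \<mu>"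
    and pr: "product_measure d \<mu>" and a: "\<And>i. i < d \<Longrightarrow> a i \<le> 2"
  shows "integrable \<mu> (\<lambda>x. \<Prod>i<d. x i ^ a i)"
    "(LINT x|\<mu>. (\<Prod>i<d. x i ^ a i)) = (\<Prod>i<d. if a i = 1 then 0 else 1)"
proof -
  interpret prob_space \<mu> by (rule prob)
  have ind: "indep_vars (\<lambda>_. borel) (\<lambda>i x. x i) {..<d}" using pr by (simp add: product_measure_def)
  have ind': "indep_vars (\<lambda>_. borel) (\<lambda>i x. x i ^ a i) {..<d}"
    by (rule indep_vars_compose2[OF ind]) simp
  have cases3: "a i = 0 \<or> a i = 1 \<or> a i = 2" if "i < d" for i using a[OF that] by arith
  have int: "integrable \<mu> (\<lambda>x. x i ^ a i)" if "i < d" for i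
    using cases3[OF that] iso that by (auto simp: isotropic_def)
  have ex: "(LINT x|\<mu>. x i ^ a i) = (if a i = 1 then 0 else 1)" if "i < d" for i
    using cases3[OF that] iso that isotropic_second_moments(2)[OF iso sets that that]
    by (auto simp: isotropic_def prob_space power2_eq_square)
  show "integrable \<mu> (\<lambda>x. \<Prod>i<d. x i ^ a i)"
    by (rule indep_vars_integrable[OF _ ind']) (auto intro: int)
  have "(LINT x|\<mu>. (\<Prod>i<d. x i ^ a i)) = (\<Prod>i<d. (LINT x|\<mu>. x i ^ a i))"
    by (rule indep_vars_lebesgue_integral[OF _ ind']) (auto intro: int)
  also have "\<dots> = (\<Prod>i<d. if a i = 1 then 0 else 1)"
    by (intro prod.cong refl ex) simp
  finally show "(LINT x|\<mu>. (\<Prod>i<d. x i ^ a i)) = (\<Prod>i<d. if a i = 1 then 0 else 1)" .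
qed

lemma product_monomials_orthonormal:
  assumes prob: "prob_space \<mu>" and sets: "sets \<mu> = sets (Rd d)" and iso: "isotropic d \<mu>"
    and pr: "product_measure d \<mu>" and S: "S \<subseteq> {..<d}" and T: "T \<subseteq> {..<d}"
  shows "integrable \<mu> (\<lambda>x. (\<Prod>i\<in>S. x i) * (\<Prod>i\<in>T. x i))"
    "(LINT x|\<mu>. (\<Prod>i\<in>S. x i) * (\<Prod>i\<in>T. x i)) = (if S = T then 1 else 0)"
proof -
  define a :: "nat \<Rightarrow> nat" where "a i = of_bool (i \<in> S) + of_bool (i \<in> T)" for i
  have one: "(\<Prod>i\<in>R. x i) = (\<Prod>i<d. x i ^ (of_bool (i \<in> R)))" if "R \<subseteq> {..<d}" for R and x :: "nat \<Rightarrow> real"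
  proof -
    have "(\<Prod>i\<in>R. x i) = (\<Prod>i\<in>R. x i ^ (of_bool (i \<in> R)))" by simp
    also have "\<dots> = (\<Prod>i<d. x i ^ (of_bool (i \<in> R)))" using that by (intro prod.mono_neutral_left) auto
    finally show ?thesis .
  qed
  have eq: "(\<Prod>i\<in>S. x i) * (\<Prod>i\<in>T. x i) = (\<Prod>i<d. x i ^ a i)" for x :: "nat \<Rightarrow> real"
    unfolding one[OF S] one[OF T] a_def power_add prod.distrib ..
  have a2: "a i \<le> 2" for i by (simp add: a_def)
  note mom = product_measure_moments[OF prob sets iso pr a2]
  show "integrable \<mu> (\<lambda>x. (\<Prod>i\<in>S. x i) * (\<Prod>i\<in>T. x i))" unfolding eq by (rule mom(1))
  have "(\<Prod>i<d. if a i = 1 then 0 else 1) = (if S = T then 1 else (0::real))"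
  proof (cases "S = T")
    case True
    then have "a i \<noteq> 1" for i by (simp add: a_def)
    then show ?thesis using True by simp
  next
    case False
    then obtain i where i: "i \<in> (S - T) \<union> (T - S)" by blast
    then have "i < d" "a i = 1" using S T by (auto simp: a_def)
    then have "\<exists>i\<in>{..<d}. (if a i = 1 then 0 else 1) = (0::real)" by (intro bexI[of _ i]) auto
    then show ?thesis using False by (subst prod_zero) auto
  qed
  then show "(LINT x|\<mu>. (\<Prod>i\<in>S. x i) * (\<Prod>i\<in>T. x i)) = (if S = T then 1 else 0)"
    unfolding eq mom(2) .
qed

lemma prod_zmap:
  "card S = m \<Longrightarrow> (\<Prod>i\<in>S. zmap d x i) = (sqrt (real d) / sqrt (\<Sum>i<d. (x i)\<^sup>2)) ^ m * (\<Prod>i\<in>S. x i)"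
proof -
  assume "card S = m"
  have "(\<Prod>i\<in>S. zmap d x i) = (\<Prod>i\<in>S. (sqrt (real d) / sqrt (\<Sum>i<d. (x i)\<^sup>2)) * x i)"
    by (simp add: zmap_def)
  also have "\<dots> = (sqrt (real d) / sqrt (\<Sum>i<d. (x i)\<^sup>2)) ^ m * (\<Prod>i\<in>S. x i)"
    using \<open>card S = m\<close> by (simp only: prod.distrib prod_constant)
  finally show ?thesis .
qed

text \<open>
  On the sphere a monomial of degree \<open>m\<close> is the monomial in \<open>x\<close> times the \<open>m\<close>-th power of
  \<open>sqrt d / |x|\<close>. This power is bounded on \<open>E\<close> and can be moved to \<open>g\<close>, after which Bessel's
  inequality applies.
\<close>

lemma product_gram:
  assumes prob: "prob_space \<mu>" and sets: "sets \<mu> = sets (Rd d)" and iso: "isotropic d \<mu>"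
    and pr: "product_measure d \<mu>" and E: "E \<in> sets \<mu>"
    and w: "\<And>x. x \<in> E \<Longrightarrow> (real d / (\<Sum>i<d. (x i)\<^sup>2)) ^ m \<le> 3"
    and g: "g \<in> borel_measurable \<mu>" and g3: "\<And>x. x \<in> space \<mu> \<Longrightarrow> \<bar>g x\<bar> \<le> 3"
  shows "gram_sum d m \<mu> E g \<le> 27"
proof -
  interpret prob_space \<mu> by (rule prob)
  note [measurable] = E g
  define q where "q x = (\<Sum>i<d. (x i)\<^sup>2)" for x :: "nat \<Rightarrow> real"
  have [measurable]: "q \<in> borel_measurable \<mu>"
    unfolding q_def by (intro borel_measurable_sum borel_measurable_power measurable_Rd_component[OF sets]) simp
  define h where "h x = g x * indicator E x * (sqrt (real d) / sqrt (q x)) ^ m" for x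
  have h_meas [measurable]: "h \<in> borel_measurable \<mu>" unfolding h_def by measurable
  have h2: "(h x)\<^sup>2 \<le> 27" if "x \<in> space \<mu>" for x
  proof (cases "x \<in> E")
    case True
    have "((sqrt (real d) / sqrt (q x)) ^ m)\<^sup>2 = ((sqrt (real d) / sqrt (q x))\<^sup>2) ^ m"
      by (metis mult.commute power_mult)
    also have "\<dots> = (real d / q x) ^ m" by (simp add: power_divide q_def sum_nonneg)
    finally have "(h x)\<^sup>2 = (g x)\<^sup>2 * (real d / q x) ^ m"
      using True by (simp add: h_def power_mult_distrib)
    also have "\<dots> \<le> 3\<^sup>2 * 3"
      using g3[OF that] w[OF True] by (intro mult_mono abs_le_square_iff[THEN iffD1]) (auto simp: q_def sum_nonneg)
    finally show ?thesis by simp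
  next
    case False
    then show ?thesis by (simp add: h_def)
  qed
  have mono_meas: "(\<lambda>x. \<Prod>i\<in>S. x i) \<in> borel_measurable \<mu>" if "S \<in> ksub d m" for S
    using that by (intro borel_measurable_prod measurable_Rd_component[OF sets]) (auto simp: ksub_def)
  note on = product_monomials_orthonormal[OF prob sets iso pr]
  have sub: "S \<subseteq> {..<d}" if "S \<in> ksub d m" for S using that by (simp add: ksub_def)
  have ih2: "integrable \<mu> (\<lambda>x. (h x)\<^sup>2)"
    using h2 by (intro integrable_const_bound[where B=27]) auto
  have ihe: "integrable \<mu> (\<lambda>x. h x * (\<Prod>i\<in>S. x i))" if S: "S \<in> ksub d m" for S
  proof (rule Bochner_Integration.integrable_bound)
    show "integrable \<mu> (\<lambda>x. (h x)\<^sup>2 + (\<Prod>i\<in>S. x i) * (\<Prod>i\<in>S. x i))"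
      using ih2 on(1)[OF sub[OF S] sub[OF S]] by (rule Bochner_Integration.integrable_add)
    show "(\<lambda>x. h x * (\<Prod>i\<in>S. x i)) \<in> borel_measurable \<mu>" using mono_meas[OF S] by measurable
    have "\<bar>a * b\<bar> \<le> a\<^sup>2 + b * b" for a b :: real
      using sum_squares_bound[of "\<bar>a\<bar>" "\<bar>b\<bar>"] abs_ge_zero[of "a * b"]
      unfolding abs_mult power2_abs power2_eq_square by linarith
    then show "AE x in \<mu>. norm (h x * (\<Prod>i\<in>S. x i)) \<le> norm ((h x)\<^sup>2 + (\<Prod>i\<in>S. x i) * (\<Prod>i\<in>S. x i))"
      by (intro AE_I2) (simp add: order_trans[OF _ abs_ge_self])
  qed
  have "gram_sum d m \<mu> E g
      = (\<Sum>S\<in>ksub d m. (LINT x|\<mu>. h x * (\<Prod>i\<in>S. x i))\<^sup>2)"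
    by (intro sum.cong refl arg_cong2[where f=power] Bochner_Integration.integral_cong)
       (simp add: h_def q_def prod_zmap[where m=m] ksub_def)
  also have "\<dots> \<le> (LINT x|\<mu>. (h x)\<^sup>2)"
  proof (rule bessel_inequality[where e="\<lambda>S x. \<Prod>i\<in>S. x i"])
    show "integrable \<mu> (\<lambda>x. (\<Prod>i\<in>S. x i) * (\<Prod>i\<in>T. x i))"
      "(LINT x|\<mu>. (\<Prod>i\<in>S. x i) * (\<Prod>i\<in>T. x i)) = (if S = T then 1 else 0)"
      if "S \<in> ksub d m" "T \<in> ksub d m" for S T
      by (rule on[OF sub[OF that(1)] sub[OF that(2)]])+
  qed (simp_all add: ih2 ihe)
  also have "\<dots> \<le> (LINT x|\<mu>. 27)" using h2 by (intro integral_mono ih2) auto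
  finally show ?thesis by (simp add: prob_space)
qed

text \<open>
  The summands \<open>(x i)\<^sup>2 - 1\<close> are uncorrelated with bounded variance, so the squared norm
  deviates from \<open>d\<close> by \<open>O(sqrt d)\<close>.
\<close>

lemma product_norm_concentration:
  assumes lc: "log_concave_measure d \<mu>" and iso: "isotropic d \<mu>" and pr: "product_measure d \<mu>" and d: "d \<ge> 1"
  shows "measure \<mu> {x \<in> space \<mu>. 1000 * sqrt (real d) \<le> \<bar>(\<Sum>i<d. (x i)\<^sup>2) - real d\<bar>} \<le> 1/4"
proof -
  interpret prob_space \<mu> using lc by (auto simp: log_concave_measure_def)
  have sets: "sets \<mu> = sets (Rd d)" using lc by (auto simp: log_concave_measure_def)
  note mom = isotropic_square_norm_moments[OF lc iso]
  note m4 = isotropic_log_concave_coordinate_fourth_moment[OF lc iso]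
  let ?q = "\<lambda>x. \<Sum>i<d. (x i)\<^sup>2"
  have cross: "integrable \<mu> (\<lambda>x. (x i)\<^sup>2 * (x j)\<^sup>2)" "(LINT x|\<mu>. (x i)\<^sup>2 * (x j)\<^sup>2) = 1"
    if ij: "i < d" "j < d" "i \<noteq> j" for i j
  proof -
    define a :: "nat \<Rightarrow> nat" where "a k = (if k = i \<or> k = j then 2 else 0)" for k
    have eq: "(x i)\<^sup>2 * (x j)\<^sup>2 = (\<Prod>k<d. x k ^ a k)" for x :: "nat \<Rightarrow> real"
    proof -
      have "(\<Prod>k<d. x k ^ a k) = (\<Prod>k\<in>{i, j}. x k ^ a k)"
        using ij by (intro prod.mono_neutral_right) (auto simp: a_def)
      then show ?thesis using ij by (simp add: a_def)
    qed
    have a2: "a k \<le> 2" for k by (simp add: a_def)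
    note mm = product_measure_moments[OF prob_space_axioms sets iso pr a2]
    show "integrable \<mu> (\<lambda>x. (x i)\<^sup>2 * (x j)\<^sup>2)" unfolding eq by (rule mm(1))
    show "(LINT x|\<mu>. (x i)\<^sup>2 * (x j)\<^sup>2) = 1" 
    proof -
      have "a k \<noteq> 1" for k by (simp add: a_def)
      then show ?thesis unfolding eq mm(2) by (intro prod.neutral) simp
    qed
  qed
  have "(LINT x|\<mu>. (?q x)\<^sup>2) = (\<Sum>i<d. \<Sum>j<d. (LINT x|\<mu>. (x i)\<^sup>2 * (x j)\<^sup>2))"
  proof -
    have "integrable \<mu> (\<lambda>x. (x i)\<^sup>2 * (x j)\<^sup>2)" if "i < d" "j < d" for i j
      using cross(1) that m4(1)[OF that(1)] by (cases "i = j") (auto simp: power4_eq_xxxx power2_eq_square mult.assoc)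
    note ijint = this
    have "(LINT x|\<mu>. (?q x)\<^sup>2) = (LINT x|\<mu>. (\<Sum>i<d. \<Sum>j<d. (x i)\<^sup>2 * (x j)\<^sup>2))"
      unfolding power2_eq_square[of "?q _"] sum_product ..
    also have "\<dots> = (\<Sum>i<d. (LINT x|\<mu>. (\<Sum>j<d. (x i)\<^sup>2 * (x j)\<^sup>2)))"
      by (intro Bochner_Integration.integral_sum Bochner_Integration.integrable_sum ijint) auto
    also have "\<dots> = (\<Sum>i<d. \<Sum>j<d. (LINT x|\<mu>. (x i)\<^sup>2 * (x j)\<^sup>2))"
      by (intro sum.cong refl Bochner_Integration.integral_sum ijint) auto
    finally show ?thesis .
  qed
  also have "\<dots> \<le> (\<Sum>i<d. \<Sum>j<d. 1 + (if j = i then 2 * 18 ^ 4 else 0))"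
  proof (intro sum_mono)
    fix i j assume ij: "i \<in> {..<d}" "j \<in> {..<d}"
    show "(LINT x|\<mu>. (x i)\<^sup>2 * (x j)\<^sup>2) \<le> 1 + (if j = i then 2 * 18 ^ 4 else 0)"
    proof (cases "i = j")
      case True
      have "(x i)\<^sup>2 * (x i)\<^sup>2 = x i ^ 4" for x :: "nat \<Rightarrow> real" by (simp add: power4_eq_xxxx power2_eq_square)
      then show ?thesis using True m4(2)[of i] ij by simp
    next
      case False
      then show ?thesis using cross(2)[of i j] ij by simp
    qed
  qed
  also have "\<dots> = (real d)\<^sup>2 + 2 * 18 ^ 4 * real d" by (simp add: sum.distrib power2_eq_square distrib_left)
  finally have q2: "(LINT x|\<mu>. (?q x)\<^sup>2) \<le> (real d)\<^sup>2 + 2 * 18 ^ 4 * real d" .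
  have sq: "(?q x - real d)\<^sup>2 = (?q x)\<^sup>2 - 2 * real d * ?q x + (real d)\<^sup>2" for x
    by (simp add: power2_diff)
  have iv: "integrable \<mu> (\<lambda>x. (?q x - real d)\<^sup>2)"
    unfolding sq using mom(1,3) by (intro Bochner_Integration.integrable_add Bochner_Integration.integrable_diff integrable_mult_right) auto
  have "(LINT x|\<mu>. (?q x - real d)\<^sup>2) = (LINT x|\<mu>. (?q x)\<^sup>2) - 2 * real d * real d + (real d)\<^sup>2"
    unfolding sq using mom(1,2,3) by (simp add: prob_space)
  also have "\<dots> \<le> 2 * 18 ^ 4 * real d" using q2 by (simp add: power2_eq_square)
  finally have var: "(LINT x|\<mu>. (?q x - real d)\<^sup>2) \<le> 2 * 18 ^ 4 * real d" .
  have "1000 * sqrt (real d) \<le> \<bar>t\<bar> \<longleftrightarrow> 1000000 * real d \<le> t\<^sup>2" for t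
  proof -
    have "1000 * sqrt (real d) \<le> \<bar>t\<bar> \<longleftrightarrow> (1000 * sqrt (real d))\<^sup>2 \<le> t\<^sup>2"
      by (subst abs_le_square_iff[symmetric]) simp
    then show ?thesis by (simp add: power_mult_distrib)
  qed
  then have "measure \<mu> {x \<in> space \<mu>. 1000 * sqrt (real d) \<le> \<bar>?q x - real d\<bar>}
      = measure \<mu> {x \<in> space \<mu>. 1000000 * real d \<le> (?q x - real d)\<^sup>2}"
    by (simp only:)
  also have "\<dots> \<le> (LINT x|\<mu>. (?q x - real d)\<^sup>2) / (1000000 * real d)"
    using d by (intro integral_Markov_inequality_measure[OF iv, where A="{}"]) auto
  also have "\<dots> \<le> (2 * 18 ^ 4 * real d) / (1000000 * real d)" using var by (intro divide_right_mono) auto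
  also have "\<dots> \<le> 1/4" using d by simp
  finally show ?thesis .
qed

section \<open>General log-concave measures\<close>

lemma prod_list_map_mult: "prod_list (map (\<lambda>i. f i * g i) xs) = prod_list (map f xs) * prod_list (map g xs)"
  for f g :: "'a \<Rightarrow> real"
  by (induction xs) (simp_all add: mult_ac)

text \<open>
  The sum over subsets is at most the sum over all tuples of coordinates divided by \<open>m!\<close>, and
  the latter is the double integral of \<open>G x * G y\<close> against the \<open>m\<close>-th power of the inner product
  of \<open>zmap d x\<close> and \<open>zmap d y\<close>. For fixed \<open>x\<close> the inner product of \<open>x\<close> and \<open>y\<close> is a linear
  functional of \<open>y\<close> with standard deviation \<open>|x|\<close>. So on \<open>E\<close> the inner product on the sphere is
  at most \<open>36 * 3 ^ j * sqrt d\<close> outside an event of probability \<open>(1/162) ^ (2 ^ j)\<close>, and never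
  exceeds \<open>d\<close>.
\<close>

lemma log_concave_gram:
  assumes lc: "log_concave_measure d \<mu>" and iso: "isotropic d \<mu>" and d: "d \<ge> 1" and E: "E \<in> sets \<mu>"
    and E2: "\<And>x. x \<in> E \<Longrightarrow> real d / 4 \<le> (\<Sum>i<d. (x i)\<^sup>2)"
    and g: "g \<in> borel_measurable \<mu>" and g3: "\<And>x. x \<in> space \<mu> \<Longrightarrow> \<bar>g x\<bar> \<le> 3"
  shows "gram_sum d m \<mu> E g
     \<le> 9 * ((36 * 3 ^ j / sqrt (real d)) ^ m + (1/162) ^ (2 ^ j)) * mono_var d m"
proof -
  interpret prob_space \<mu> using lc by (auto simp: log_concave_measure_def)
  have sets: "sets \<mu> = sets (Rd d)" using lc by (auto simp: log_concave_measure_def)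
  note [measurable] = E g
  have comp [measurable]: "(\<lambda>x. x i) \<in> borel_measurable \<mu>" if "i < d" for i
    by (rule measurable_Rd_component[OF sets that])
  note z_meas = borel_measurable_zmap[OF sets]
  define G where "G x = g x * indicator E x" for x
  have [measurable]: "G \<in> borel_measurable \<mu>" unfolding G_def by measurable
  have G3: "\<bar>G x\<bar> \<le> 3 * indicator E x" if "x \<in> space \<mu>" for x
    using g3[OF that] by (simp add: G_def indicator_def)
  let ?L = "{xs. set xs \<subseteq> {..<d} \<and> length xs = m}"
  define P where "P xs x = prod_list (map (zmap d x) xs)" for xs x
  have finL: "finite ?L" by (rule finite_lists_length_eq) simp
  have P_meas: "P xs \<in> borel_measurable \<mu>" if "set xs \<subseteq> {..<d}" for xs
    using that unfolding P_def
    by (induction xs) (auto intro!: borel_measurable_times z_meas)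
  have P_le: "\<bar>P xs x\<bar> \<le> sqrt (real d) ^ length xs" if "set xs \<subseteq> {..<d}" for xs x
    using that unfolding P_def
    by (induction xs) (auto simp: abs_mult intro!: mult_mono abs_zmap_le)
  have bint: "integrable \<mu> h" if "h \<in> borel_measurable \<mu>" "\<And>x. x \<in> space \<mu> \<Longrightarrow> \<bar>h x\<bar> \<le> b" for h :: "_ \<Rightarrow> real" and b
    using that by (intro integrable_const_bound[where B=b]) auto
  have GP: "integrable \<mu> (\<lambda>x. G x * P xs x)" if xs: "xs \<in> ?L" for xs
  proof (rule bint)
    show "(\<lambda>x. G x * P xs x) \<in> borel_measurable \<mu>" using P_meas xs by simp
    fix x assume "x \<in> space \<mu>"
    then have "\<bar>G x\<bar> \<le> 3" using G3[of x] by (cases "x \<in> E") auto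
    then have "\<bar>G x\<bar> * \<bar>P xs x\<bar> \<le> 3 * sqrt (real d) ^ m"
      using P_le[of xs x] xs by (intro mult_mono) auto
    then show "\<bar>G x * P xs x\<bar> \<le> 3 * sqrt (real d) ^ m" by (simp add: abs_mult)
  qed
  define a where "a xs = (LINT x|\<mu>. G x * P xs x)" for xs
  define ip where "ip x y = (\<Sum>i<d. zmap d x i * zmap d y i)" for x y
  have kern: "(\<Sum>xs\<in>?L. P xs x * P xs y) = ip x y ^ m" for x y
    using sum_lists_prod_list[of "{..<d}" "\<lambda>i. zmap d x i * zmap d y i" m]
    by (simp add: P_def ip_def prod_list_map_mult)
  have inner_eq: "(\<Sum>xs\<in>?L. P xs x * a xs) = (LINT y|\<mu>. G y * ip x y ^ m)" for x
  proof -
    have "(\<Sum>xs\<in>?L. P xs x * a xs) = (LINT y|\<mu>. (\<Sum>xs\<in>?L. P xs x * (G y * P xs y)))"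
      unfolding a_def using GP
      by (subst Bochner_Integration.integral_sum) (auto intro!: sum.cong integrable_mult_right)
    also have "(\<lambda>y. \<Sum>xs\<in>?L. P xs x * (G y * P xs y)) = (\<lambda>y. G y * ip x y ^ m)"
      unfolding kern[symmetric] sum_distrib_left by (simp add: mult_ac)
    finally show ?thesis .
  qed
  have "(\<Sum>xs\<in>?L. (a xs)\<^sup>2) = (\<Sum>xs\<in>?L. (LINT x|\<mu>. a xs * (G x * P xs x)))"
    by (simp add: a_def power2_eq_square)
  also have "\<dots> = (LINT x|\<mu>. (\<Sum>xs\<in>?L. a xs * (G x * P xs x)))"
    using GP by (intro Bochner_Integration.integral_sum[symmetric] integrable_mult_right)
  also have "(\<lambda>x. \<Sum>xs\<in>?L. a xs * (G x * P xs x)) = (\<lambda>x. G x * (LINT y|\<mu>. G y * ip x y ^ m))"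
    unfolding inner_eq[symmetric] sum_distrib_left by (simp add: mult_ac)
  finally have sum_a: "(\<Sum>xs\<in>?L. (a xs)\<^sup>2) = (LINT x|\<mu>. G x * (LINT y|\<mu>. G y * ip x y ^ m))" .
  have int_outer: "integrable \<mu> (\<lambda>x. G x * (LINT y|\<mu>. G y * ip x y ^ m))"
  proof -
    have "integrable \<mu> (\<lambda>x. \<Sum>xs\<in>?L. a xs * (G x * P xs x))"
      using GP by (intro Bochner_Integration.integrable_sum integrable_mult_right)
    also have "(\<lambda>x. \<Sum>xs\<in>?L. a xs * (G x * P xs x)) = (\<lambda>x. G x * (LINT y|\<mu>. G y * ip x y ^ m))"
      unfolding inner_eq[symmetric] sum_distrib_left by (simp add: mult_ac)
    finally show ?thesis .
  qed

  define b where "b = 36 * 3 ^ j * sqrt (real d)"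
  define R where "R = b ^ m + real d ^ m * (1/162) ^ (2 ^ j)"
  have Epos: "0 < (\<Sum>i<d. (x i)\<^sup>2)" if "x \<in> E" for x
    using E2[OF that] d by (intro less_le_trans[OF _ E2[OF that]]) simp
  have inner_le: "\<bar>LINT y|\<mu>. G y * ip x y ^ m\<bar> \<le> 3 * R" if x: "x \<in> E" for x
  proof -
    define s where "s = sqrt (\<Sum>i<d. (x i)\<^sup>2)"
    have s0: "0 < s" using Epos[OF x] by (simp add: s_def)
    have s2: "s\<^sup>2 = (\<Sum>i<d. (x i)\<^sup>2)" using Epos[OF x] by (simp add: s_def)
    define T where "T = {y \<in> space \<mu>. 3 ^ j * (18 * s) \<le> \<bar>\<Sum>i<d. x i * y i\<bar>}"
    have l_meas [measurable]: "(\<lambda>y. \<Sum>i<d. x i * y i) \<in> borel_measurable \<mu>"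
      by (intro borel_measurable_sum borel_measurable_times borel_measurable_const comp) simp
    have T_meas [measurable]: "T \<in> sets \<mu>" unfolding T_def by measurable
    note lin = isotropic_linear_second_moment[OF iso sets, of x]
    have "2 * measure \<mu> T \<le> (1/162) ^ (2 ^ j)"
      unfolding T_def by (rule log_concave_tail_variance[OF lc s0 lin(1)]) (simp add: lin(2) s2)
    then have T_le: "measure \<mu> T \<le> (1/162) ^ (2 ^ j)" using measure_nonneg[of \<mu> T] by linarith
    have ip_le: "\<bar>ip x y\<bar> ^ m \<le> b ^ m + real d ^ m * indicator T y" if y: "y \<in> E" for y
    proof (cases "y \<in> T")
      case True
      have "(ip x y)\<^sup>2 \<le> (\<Sum>i<d. (zmap d x i)\<^sup>2) * (\<Sum>i<d. (zmap d y i)\<^sup>2)"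
        unfolding ip_def by (rule Cauchy_Schwarz_ineq_sum)
      also have "\<dots> = (real d)\<^sup>2"
        using zmap_square_sum[OF Epos[OF x]] zmap_square_sum[OF Epos[OF y]] by (simp add: power2_eq_square)
      finally have "\<bar>ip x y\<bar> \<le> real d" by (subst (asm) abs_le_square_iff[symmetric]) simp
      then have "\<bar>ip x y\<bar> ^ m \<le> real d ^ m" by (intro power_mono) auto
      moreover have "0 \<le> b ^ m" by (simp add: b_def)
      ultimately show ?thesis using True by simp
    next
      case False
      define t where "t = sqrt (\<Sum>i<d. (y i)\<^sup>2)"
      have "y \<in> space \<mu>" using y sets.sets_into_space[OF E] by auto
      then have small: "\<bar>\<Sum>i<d. x i * y i\<bar> \<le> 3 ^ j * (18 * s)" using False by (simp add: T_def not_le)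
      have "sqrt (real d / 4) \<le> t" unfolding t_def by (intro real_sqrt_le_mono E2 y)
      then have t: "sqrt (real d) / 2 \<le> t" by (simp add: real_sqrt_divide)
      have sd: "0 < sqrt (real d)" using d by simp
      have t0: "0 < t" using t sd by linarith
      have "ip x y = real d / (s * t) * (\<Sum>i<d. x i * y i)"
        unfolding ip_def zmap_def s_def[symmetric] t_def[symmetric] sum_distrib_left
        by (intro sum.cong refl) (simp add: field_simps)
      then have "\<bar>ip x y\<bar> = real d / (s * t) * \<bar>\<Sum>i<d. x i * y i\<bar>"
        using s0 t0 by (simp add: abs_mult)
      also have "\<dots> \<le> real d / (s * t) * (3 ^ j * (18 * s))"
        using s0 t0 by (intro mult_left_mono small) auto
      also have "\<dots> = 18 * 3 ^ j * (real d / t)" using s0 by simp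
      also have "\<dots> \<le> 18 * 3 ^ j * (2 * sqrt (real d))"
      proof (intro mult_left_mono)
        have "real d = sqrt (real d) * sqrt (real d)" by simp
        also have "\<dots> \<le> sqrt (real d) * (2 * t)" using t by (intro mult_left_mono) auto
        also have "\<dots> = 2 * sqrt (real d) * t" by simp
        finally show "real d / t \<le> 2 * sqrt (real d)" using t0 by (simp add: divide_le_eq)
      qed simp
      finally have "\<bar>ip x y\<bar> \<le> b" by (simp add: b_def)
      then have "\<bar>ip x y\<bar> ^ m \<le> b ^ m" by (intro power_mono) auto
      then show ?thesis using False by simp
    qed
    have iT: "integrable \<mu> (\<lambda>y. 3 * (b ^ m + real d ^ m * indicator T y))"
      by (rule bint[of _ "3 * (b ^ m + real d ^ m)"]) (auto simp: indicator_def b_def)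
    have "\<bar>LINT y|\<mu>. G y * ip x y ^ m\<bar> \<le> (LINT y|\<mu>. \<bar>G y * ip x y ^ m\<bar>)"
      by (rule integral_abs_bound)
    also have "\<dots> \<le> (LINT y|\<mu>. 3 * (b ^ m + real d ^ m * indicator T y))"
    proof (rule integral_mono)
      have "integrable \<mu> (\<lambda>y. G y * ip x y ^ m)"
      proof -
        have "integrable \<mu> (\<lambda>y. \<Sum>xs\<in>?L. P xs x * (G y * P xs y))"
          using GP by (intro Bochner_Integration.integrable_sum integrable_mult_right)
        also have "(\<lambda>y. \<Sum>xs\<in>?L. P xs x * (G y * P xs y)) = (\<lambda>y. G y * ip x y ^ m)"
          unfolding kern[symmetric] sum_distrib_left by (simp add: mult_ac)
        finally show ?thesis .
      qed
      then show "integrable \<mu> (\<lambda>y. \<bar>G y * ip x y ^ m\<bar>)" by (rule integrable_abs)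
      show "integrable \<mu> (\<lambda>y. 3 * (b ^ m + real d ^ m * indicator T y))" by (rule iT)
      fix y assume y: "y \<in> space \<mu>"
      show "\<bar>G y * ip x y ^ m\<bar> \<le> 3 * (b ^ m + real d ^ m * indicator T y)"
      proof (cases "y \<in> E")
        case True
        have "\<bar>G y\<bar> * \<bar>ip x y\<bar> ^ m \<le> 3 * (b ^ m + real d ^ m * indicator T y)"
          using G3[OF y] True by (intro mult_mono ip_le) auto
        then show ?thesis by (simp add: abs_mult power_abs)
      next
        case False
        then show ?thesis by (simp add: G_def b_def)
      qed
    qed
    also have "\<dots> = 3 * (b ^ m + real d ^ m * measure \<mu> T)"
    proof -
      have "integrable \<mu> (indicator T :: _ \<Rightarrow> real)" by (rule bint[of _ 1]) (auto simp: indicator_def)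
      then show ?thesis by (simp add: prob_space)
    qed
    also have "\<dots> \<le> 3 * R" unfolding R_def using T_le by (intro mult_left_mono add_left_mono) auto
    finally show ?thesis .
  qed
  have R0: "0 \<le> R" by (simp add: R_def b_def)
  have "(LINT x|\<mu>. G x * (LINT y|\<mu>. G y * ip x y ^ m)) \<le> (LINT x|\<mu>. 9 * R)"
  proof (rule integral_mono[OF int_outer])
    fix x assume x: "x \<in> space \<mu>"
    show "G x * (LINT y|\<mu>. G y * ip x y ^ m) \<le> 9 * R"
    proof (cases "x \<in> E")
      case True
      have "\<bar>G x\<bar> * \<bar>LINT y|\<mu>. G y * ip x y ^ m\<bar> \<le> 3 * (3 * R)"
        using G3[OF x] True by (intro mult_mono inner_le) auto
      then show ?thesis by (simp add: abs_mult[symmetric])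
    next
      case False
      then show ?thesis using R0 by (simp add: G_def)
    qed
  qed simp
  then have all: "(\<Sum>xs\<in>?L. (a xs)\<^sup>2) \<le> 9 * R" unfolding sum_a by (simp add: prob_space)
  have "fact m * gram_sum d m \<mu> E g
      = (\<Sum>xs | distinct xs \<and> length xs = m \<and> set xs \<subseteq> {..<d}. (LINT x|\<mu>. g x * (indicator E x * (\<Prod>i\<in>set xs. zmap d x i)))\<^sup>2)"
    unfolding ksub_def by (rule sum_distinct_lists_eq_sum_subsets[symmetric]) simp
  also have "\<dots> = (\<Sum>xs | distinct xs \<and> length xs = m \<and> set xs \<subseteq> {..<d}. (a xs)\<^sup>2)"
    by (intro sum.cong refl) (auto simp: a_def G_def P_def prod_set_distinct_list mult.assoc)
  also have "\<dots> \<le> (\<Sum>xs\<in>?L. (a xs)\<^sup>2)" by (intro sum_mono2 finL) auto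
  also have "\<dots> \<le> 9 * R" by (rule all)
  also have "R = ((36 * 3 ^ j / sqrt (real d)) ^ m + (1/162) ^ (2 ^ j)) * real d ^ m"
  proof -
    have "b = 36 * 3 ^ j / sqrt (real d) * real d"
      using d by (simp add: b_def field_simps)
    then have "b ^ m = (36 * 3 ^ j / sqrt (real d)) ^ m * real d ^ m" by (metis power_mult_distrib)
    then show ?thesis by (simp add: R_def algebra_simps)
  qed
  finally show ?thesis by (simp add: mono_var_def field_simps)
qed

section \<open>The entropy bounds\<close>

text \<open>
  The constant functions \<open>1\<close> and \<open>-1\<close>. This settles the values of \<open>\<epsilon>\<close> for which the degree is
  zero.
\<close>

lemma H_Lip_ge_ln_2:
  assumes prob: "prob_space \<mu>" and sets: "sets \<mu> = sets (Rd d)" and eps: "\<epsilon> \<le> 2"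
  shows "ereal (ln 2) \<le> H_Lip d \<mu> \<epsilon>"
proof -
  interpret prob_space \<mu> by (rule prob)
  have sp: "space \<mu> = space (Rd d)" by (rule sets_eq_imp_space_eq[OF sets])
  define k :: "real \<Rightarrow> (nat \<Rightarrow> real) \<Rightarrow> real" where "k t = (\<lambda>x\<in>space (Rd d). t)" for t
  have kB: "k t \<in> B_Lip d \<mu>" if "t\<^sup>2 = 1" for t
  proof -
    have "integrable \<mu> (\<lambda>x. (k t x)\<^sup>2) \<longleftrightarrow> integrable \<mu> (\<lambda>x. 1 :: real)"
      "(LINT x|\<mu>. (k t x)\<^sup>2) = (LINT x|\<mu>. 1)"
      using that by (intro Bochner_Integration.integrable_cong Bochner_Integration.integral_cong; simp add: k_def sp)+
    then show ?thesis by (auto simp: B_Lip_def k_def Rd_dist_nonneg prob_space)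
  qed
  have dist: "L2_dist \<mu> (k s) (k t) = \<bar>s - t\<bar>" for s t
  proof -
    have "(LINT x|\<mu>. (k s x - k t x)\<^sup>2) = (LINT x|\<mu>. (s - t)\<^sup>2)"
      by (intro Bochner_Integration.integral_cong) (simp_all add: k_def sp)
    then show ?thesis by (simp add: L2_dist_def prob_space)
  qed
  have ne: "k 1 \<noteq> k (- 1)"
  proof
    obtain x where "x \<in> space (Rd d)" using not_empty sp by auto
    moreover assume "k 1 = k (- 1)"
    then have "k 1 x = k (- 1) x" by simp
    ultimately show False by (simp add: k_def)
  qed
  have "ereal (ln (real (card {k 1, k (- 1)}))) \<le> H_Lip d \<mu> \<epsilon>"
    by (rule H_Lip_ge_ln_card) (use kB eps in \<open>auto simp: eps_separated_def dist\<close>)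
  then show ?thesis using ne by simp
qed

text \<open>
  The first event has probability at least \<open>1 / (4 * 18 ^ 4)\<close>, and the threshold for the fourth
  powers is chosen so that at most half of this is lost.
\<close>

lemma good_event_bounds:
  assumes lc: "log_concave_measure d \<mu>" and iso: "isotropic d \<mu>" and d: "d \<ge> 1"
  defines "E \<equiv> {x \<in> space \<mu>. real d / 4 \<le> (\<Sum>i<d. (x i)\<^sup>2)} - {x \<in> space \<mu>. 16 * 18 ^ 8 * real d \<le> (\<Sum>i<d. x i ^ 4)}"
  shows "E \<in> sets \<mu>" "1 / (8 * 18 ^ 4) \<le> measure \<mu> E"
proof -
  interpret prob_space \<mu> using lc by (auto simp: log_concave_measure_def)
  have sets: "sets \<mu> = sets (Rd d)" using lc by (auto simp: log_concave_measure_def)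
  let ?F = "{x \<in> space \<mu>. real d / 4 \<le> (\<Sum>i<d. (x i)\<^sup>2)}" and ?B = "{x \<in> space \<mu>. 16 * 18 ^ 8 * real d \<le> (\<Sum>i<d. x i ^ 4)}"
  have [measurable]: "(\<lambda>x. \<Sum>i<d. (x i)\<^sup>2) \<in> borel_measurable \<mu>" "(\<lambda>x. \<Sum>i<d. x i ^ 4) \<in> borel_measurable \<mu>"
    by (intro borel_measurable_sum borel_measurable_power measurable_Rd_component[OF sets]; simp)+
  have FB: "?F \<in> sets \<mu>" "?B \<in> sets \<mu>" by measurable
  then show "E \<in> sets \<mu>" unfolding E_def by (rule sets.Diff)
  have "measure \<mu> ?F \<le> measure \<mu> (E \<union> ?B)"
    unfolding E_def using FB by (intro finite_measure_mono) auto
  also have "\<dots> \<le> measure \<mu> E + measure \<mu> ?B"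
    using FB unfolding E_def by (intro measure_Un_le) auto
  finally have "measure \<mu> ?F - measure \<mu> ?B \<le> measure \<mu> E" by simp
  moreover have "measure \<mu> ?B \<le> 2 * 18 ^ 4 / (16 * 18 ^ 8)"
    by (rule prob_sum_fourth_powers_large[OF lc iso d]) simp
  ultimately show "1 / (8 * 18 ^ 4) \<le> measure \<mu> E"
    using prob_square_norm_ge_quarter[OF lc iso d] by simp
qed

text \<open>
  The polynomials have degree \<open>8 n\<close>. In terms of \<open>w\<close>, the sixteenth root of \<open>d\<close>, the level \<open>j\<close>
  is chosen with \<open>3 ^ j\<close> of order \<open>w ^ 6\<close>, so that inner products on the sphere, divided by \<open>d\<close>,
  are at most \<open>w ^ (-2)\<close>, with \<open>8 n\<close>-th power \<open>w ^ (- 16 n) = d ^ (- n)\<close>. Then \<open>2 ^ j\<close> is at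
  least of order \<open>w ^ 3\<close>, which exceeds \<open>n * ln d\<close> as \<open>n\<close> is at most a small multiple of \<open>w\<^sup>2\<close>,
  and the exceptional event is negligible.
\<close>

lemma log_concave_entropy:
  assumes lc: "log_concave_measure d \<mu>" and iso: "isotropic d \<mu>" and d: "d \<ge> 1"
    and n: "n \<ge> 1" and w: "0 < w" "w ^ 16 = real d" and nw: "10 ^ 20 * real n \<le> w\<^sup>2"
    and eps: "0 < \<epsilon>" "5186 * sqrt (real (8 * n)) * \<epsilon> \<le> 1 / (64 * 18 ^ 4)"
  shows "ereal ((1 / (8 * 18 ^ 4))\<^sup>2 / (128 * 18) * real d ^ n) \<le> H_Lip d \<mu> \<epsilon>"
proof -
  define E where "E = {x \<in> space \<mu>. real d / 4 \<le> (\<Sum>i<d. (x i)\<^sup>2)} - {x \<in> space \<mu>. 16 * 18 ^ 8 * real d \<le> (\<Sum>i<d. x i ^ 4)}"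
  note E = good_event_bounds[OF lc iso d, folded E_def]
  have w2: "10 ^ 20 \<le> w\<^sup>2"
  proof -
    have "10 ^ 20 * 1 \<le> 10 ^ 20 * real n" using n by (intro mult_left_mono) auto
    then show ?thesis using nw by linarith
  qed
  have w10: "10 ^ 10 \<le> w"
  proof -
    have "(10 ^ 10)\<^sup>2 \<le> w\<^sup>2" using w2 by simp
    then show ?thesis using w(1) by (intro power2_le_imp_le[of "10 ^ 10" w]) auto
  qed
  have w1: "1 \<le> w" using w10 by simp
  have sd: "sqrt (real d) = w ^ 8"
  proof -
    have "(w ^ 8)\<^sup>2 = real d" using w(2) by (simp flip: power_mult)
    then show ?thesis using w(1) by (intro real_sqrt_unique) auto
  qed
  define y where "y = w ^ 6 / 36"
  have y1: "1 \<le> y"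
  proof -
    have "w ^ 1 \<le> w ^ 6" using w1 by (intro power_increasing) auto
    then show ?thesis using w10 by (simp add: y_def)
  qed
  obtain j where j: "3 ^ j \<le> y" "y < 3 ^ Suc j"
  proof -
    define k where "k = (LEAST k. y < 3 ^ k)"
    obtain k0 where "y < 3 ^ k0" using real_arch_pow[of 3 y] by auto
    then have k: "y < 3 ^ k" unfolding k_def by (rule LeastI)
    have "k \<noteq> 0" using k y1 by (intro notI) simp
    then obtain i where i: "k = Suc i" by (cases k) auto
    have "\<not> y < 3 ^ i" using not_less_Least[of i "\<lambda>k. y < 3 ^ k"] i k_def by auto
    then show thesis using that[of i] k i by simp
  qed
  have two_j: "w ^ 3 / 11 \<le> 2 ^ j"
  proof -
    have "(w ^ 3 / 11)\<^sup>2 \<le> (2 ^ j)\<^sup>2"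
    proof -
      have "(w ^ 3 / 11)\<^sup>2 = w ^ 6 / 121" by (simp add: power_divide flip: power_mult)
      also have "\<dots> \<le> y / 3" using w(1) by (simp add: y_def)
      also have "\<dots> \<le> 3 ^ j" using j(2) by simp
      also have "\<dots> \<le> 4 ^ j" by (intro power_mono) auto
      also have "(4 :: real) ^ j = (2 ^ j)\<^sup>2" by (metis mult.commute numeral_Bit0 one_add_one power2_eq_square mult_2 power_mult)
      finally show ?thesis .
    qed
    then show ?thesis by (rule power2_le_imp_le) simp
  qed
  have term1: "(36 * 3 ^ j / sqrt (real d)) ^ (8 * n) \<le> 1 / real d ^ n"
  proof -
    have "36 * 3 ^ j / sqrt (real d) \<le> w ^ 6 / w ^ 8"
      unfolding sd using j(1) w(1) by (intro divide_right_mono) (auto simp: y_def)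
    also have "\<dots> = 1 / w\<^sup>2" using w(1) by (simp add: field_simps flip: power_add)
    finally have "(36 * 3 ^ j / sqrt (real d)) ^ (8 * n) \<le> (1 / w\<^sup>2) ^ (8 * n)"
      by (intro power_mono) auto
    also have "\<dots> = 1 / (w ^ 16) ^ n"
      by (simp add: power_divide flip: power_mult)
    finally show ?thesis unfolding w(2) .
  qed
  have term2: "(1/162) ^ (2 ^ j) \<le> 1 / real d ^ n"
  proof -
    have "real n * ln (real d) = real n * (16 * ln w)"
      using w by (simp flip: w(2) add: ln_realpow)
    also have "\<dots> \<le> real n * (16 * w)"
      using w ln_le_minus_one[of w] by (intro mult_left_mono) auto
    also have "\<dots> \<le> (w\<^sup>2 / 10 ^ 20) * (16 * w)"
      using nw w(1) by (intro mult_right_mono) auto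
    also have "\<dots> = w ^ 3 * (16 / 10 ^ 20)" by (simp add: power3_eq_cube power2_eq_square)
    also have "\<dots> \<le> w ^ 3 * (1 / 11)" using w(1) by (intro mult_left_mono) auto
    also have "\<dots> \<le> 2 ^ j" using two_j by simp
    finally have "real n * ln (real d) \<le> 2 ^ j" .
    then have "exp (real n * ln (real d)) \<le> exp (2 ^ j)" by simp
    also have "exp (real n * ln (real d)) = real d ^ n"
      using d by (simp add: exp_of_nat_mult)
    also have "exp (2 ^ j) = exp (1::real) ^ (2 ^ j)"
      by (simp add: exp_of_nat_mult[symmetric])
    also have "\<dots> \<le> 162 ^ (2 ^ j)"
      using exp_le by (intro power_mono) auto
    finally have "real d ^ n \<le> 162 ^ (2 ^ j)" .
    then have "1 / 162 ^ (2 ^ j) \<le> 1 / real d ^ n" using d by (intro divide_left_mono) auto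
    then show ?thesis by (simp add: power_divide)
  qed
  define v where "v = 18 / real d ^ n"
  have v0: "0 < v" using d by (simp add: v_def)
  have "ereal ((1 / (8 * 18 ^ 4))\<^sup>2 / (128 * v)) \<le> H_Lip d \<mu> \<epsilon>"
  proof (rule entropy_lower_bound[where m="8 * n" and E=E and C="16 * 18 ^ 8"])
    show "prob_space \<mu>" "sets \<mu> = sets (Rd d)" using lc by (auto simp: log_concave_measure_def)
    show "32 * (16 * 18 ^ 8) * (real (8 * n))\<^sup>2 \<le> real d"
    proof -
      have "32 * (16 * 18 ^ 8) * (real (8 * n))\<^sup>2 \<le> (10 ^ 20 * real n)\<^sup>2"
        by (simp add: power_mult_distrib)
      also have "\<dots> \<le> (w\<^sup>2)\<^sup>2" using nw by (intro power_mono) auto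
      also have "\<dots> = w ^ 4" by (simp flip: power_mult)
      also have "\<dots> \<le> w ^ 16" using w1 by (intro power_increasing) auto
      finally show ?thesis using w(2) by simp
    qed
    show "gram_sum d (8 * n) \<mu> E g \<le> v * mono_var d (8 * n)"
      if "g \<in> borel_measurable \<mu>" "\<And>x. x \<in> space \<mu> \<Longrightarrow> \<bar>g x\<bar> \<le> 3" for g
    proof -
      have "gram_sum d (8 * n) \<mu> E g
        \<le> 9 * ((36 * 3 ^ j / sqrt (real d)) ^ (8 * n) + (1/162) ^ (2 ^ j)) * mono_var d (8 * n)"
        by (rule log_concave_gram[OF lc iso d E(1) _ that]) (auto simp: E_def)
      also have "\<dots> \<le> 9 * (1 / real d ^ n + 1 / real d ^ n) * mono_var d (8 * n)"
        by (intro mult_right_mono mult_left_mono add_mono term1 term2) (auto simp: mono_var_def)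
      finally show ?thesis by (simp add: v_def)
    qed
  qed (use d n eps v0 E in \<open>auto simp: E_def\<close>)
  moreover have "(1 / (8 * 18 ^ 4))\<^sup>2 / (128 * v) = (1 / (8 * 18 ^ 4))\<^sup>2 / (128 * 18) * real d ^ n"
    by (simp add: v_def)
  ultimately show ?thesis by metis
qed

text \<open>
  On the good event \<open>|x|\<^sup>2 \<ge> d * (1 - u)\<close> with \<open>u\<close> of order \<open>1 / sqrt d\<close>, so the factor
  \<open>(d / |x|\<^sup>2) ^ m\<close> stays bounded for \<open>m\<close> up to a small multiple of \<open>sqrt d\<close>.
\<close>

lemma product_entropy:
  assumes lc: "log_concave_measure d \<mu>" and iso: "isotropic d \<mu>" and pr: "product_measure d \<mu>" and d: "d \<ge> 1"
    and m: "m \<ge> 1" and md: "10 ^ 20 * real m \<le> sqrt (real d)"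
    and eps: "0 < \<epsilon>" "5186 * sqrt (real m) * \<epsilon> \<le> 1 / (64 * 18 ^ 4)"
  shows "ereal ((1 / (8 * 18 ^ 4))\<^sup>2 / (128 * 27) * mono_var d m) \<le> H_Lip d \<mu> \<epsilon>"
proof -
  interpret prob_space \<mu> using lc by (auto simp: log_concave_measure_def)
  have sets: "sets \<mu> = sets (Rd d)" using lc by (auto simp: log_concave_measure_def)
  have sd: "10 ^ 20 \<le> sqrt (real d)"
  proof -
    have "10 ^ 20 * 1 \<le> 10 ^ 20 * real m" using m by (intro mult_left_mono) auto
    then show ?thesis using md by linarith
  qed
  have dd: "real d = sqrt (real d) * sqrt (real d)" by simp
  define u where "u = 1000 / sqrt (real d)"
  have sd0: "0 < sqrt (real d)" using d by simp
  have u: "0 < u" "u \<le> 1 / 2" using sd sd0 by (auto simp: u_def divide_le_eq)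
  have du: "real d * u = 1000 * sqrt (real d)"
    using sd0 by (subst dd) (simp add: u_def del: real_sqrt_mult_self)
  let ?q = "\<lambda>x. \<Sum>i<d. (x i)\<^sup>2"
  let ?F = "{x \<in> space \<mu>. 1000 * sqrt (real d) \<le> \<bar>?q x - real d\<bar>}"
  let ?B = "{x \<in> space \<mu>. 16 * 18 ^ 8 * real d \<le> (\<Sum>i<d. x i ^ 4)}"
  define E where "E = space \<mu> - (?F \<union> ?B)"
  have [measurable]: "?q \<in> borel_measurable \<mu>" "(\<lambda>x. \<Sum>i<d. x i ^ 4) \<in> borel_measurable \<mu>"
    by (intro borel_measurable_sum borel_measurable_power measurable_Rd_component[OF sets]; simp)+
  have FB: "?F \<in> sets \<mu>" "?B \<in> sets \<mu>" by measurable
  have E: "E \<in> sets \<mu>" unfolding E_def using FB by auto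
  have pE: "1 / (8 * 18 ^ 4) \<le> measure \<mu> E"
  proof -
    have "measure \<mu> (?F \<union> ?B) \<le> measure \<mu> ?F + measure \<mu> ?B"
      using FB by (intro measure_Un_le)
    moreover have "measure \<mu> ?F \<le> 1/4" by (rule product_norm_concentration[OF lc iso pr d])
    moreover have "measure \<mu> ?B \<le> 2 * 18 ^ 4 / (16 * 18 ^ 8)"
      by (rule prob_sum_fourth_powers_large[OF lc iso d]) simp
    moreover have "measure \<mu> E = 1 - measure \<mu> (?F \<union> ?B)"
      unfolding E_def using FB by (intro prob_compl) auto
    ultimately show ?thesis by simp
  qed
  have qE: "real d * (1 - u) \<le> ?q x" if "x \<in> E" for x
  proof -
    have "real d * (1 - u) = real d - 1000 * sqrt (real d)" using du by (simp add: right_diff_distrib)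
    then show ?thesis using that by (auto simp: E_def)
  qed
  have mv: "0 < mono_var d m" using d by (simp add: mono_var_def)
  have w3: "(real d / ?q x) ^ m \<le> 3" if x: "x \<in> E" for x
  proof -
    have pos: "0 < real d * (1 - u)" using d u by simp
    then have q0: "0 < ?q x" using qE[OF x] by linarith
    have "real d / ?q x \<le> real d / (real d * (1 - u))"
      using pos q0 by (intro divide_left_mono qE[OF x]) auto
    also have "\<dots> = 1 / (1 - u)" using d by simp
    also have "\<dots> \<le> 1 + 2 * u"
    proof -
      have "u * u \<le> u * (1 / 2)" using u by (intro mult_left_mono) auto
      then have "1 \<le> (1 + 2 * u) * (1 - u)" by (simp add: algebra_simps)
      then show ?thesis using u by (simp add: divide_le_eq)
    qed
    also have "\<dots> \<le> exp (2 * u)" by (rule exp_ge_add_one_self)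
    finally have "(real d / ?q x) ^ m \<le> exp (2 * u) ^ m"
      using q0 by (intro power_mono) auto
    also have "\<dots> = exp (real m * (2 * u))" by (simp add: exp_of_nat_mult)
    also have "\<dots> \<le> exp 1"
    proof -
      have "real m * (2 * u) = 2000 * real m / sqrt (real d)" by (simp add: u_def)
      also have "\<dots> \<le> 1" using md sd0 by (simp add: divide_le_eq)
      finally show ?thesis by simp
    qed
    also have "\<dots> \<le> 3" by (rule exp_le)
    finally show ?thesis .
  qed
  define v where "v = 27 / mono_var d m"
  have v0: "0 < v" using mv by (simp add: v_def)
  have "ereal ((1 / (8 * 18 ^ 4))\<^sup>2 / (128 * v)) \<le> H_Lip d \<mu> \<epsilon>"
  proof (rule entropy_lower_bound[where m=m and E=E and C="16 * 18 ^ 8"])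
    show "prob_space \<mu>" by (rule prob_space_axioms)
    show "real d / 4 \<le> ?q x" if "x \<in> E" for x
    proof -
      have "real d * (1 / 4) \<le> real d * (1 - u)" using u by (intro mult_left_mono) auto
      then show ?thesis using qE[OF that] by linarith
    qed
    show "32 * (16 * 18 ^ 8) * (real m)\<^sup>2 \<le> real d"
    proof -
      have "32 * (16 * 18 ^ 8) * (real m)\<^sup>2 \<le> (10 ^ 20 * real m)\<^sup>2"
        by (simp add: power_mult_distrib)
      also have "\<dots> \<le> (sqrt (real d))\<^sup>2" using md by (intro power_mono) auto
      finally show ?thesis by simp
    qed
    show "gram_sum d m \<mu> E g \<le> v * mono_var d m"
      if "g \<in> borel_measurable \<mu>" "\<And>x. x \<in> space \<mu> \<Longrightarrow> \<bar>g x\<bar> \<le> 3" for g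
      using product_gram[OF prob_space_axioms sets iso pr E w3 that] mv by (simp add: v_def)
  qed (use d m eps v0 E pE sets in \<open>auto simp: E_def\<close>)
  moreover have "(1 / (8 * 18 ^ 4))\<^sup>2 / (128 * v) = (1 / (8 * 18 ^ 4))\<^sup>2 / (128 * 27) * mono_var d m"
    using mv by (simp add: v_def)
  ultimately show ?thesis by metis
qed

lemma binomial_le_mono_var: "real (d choose m) \<le> mono_var d m"
  unfolding mono_var_def by (rule binomial_le_power_div_fact)

lemma binomial_le_power: "real (d choose m) \<le> real d ^ m"
proof -
  have "real d ^ m / fact m \<le> real d ^ m / 1" by (intro divide_left_mono) (auto simp: fact_ge_1)
  then show ?thesis using binomial_le_power_div_fact[of d m] by linarith
qed

text \<open>
  In the range \<open>\<epsilon> > d ^ (-1/16)\<close> the square of \<open>\<lfloor>c / \<epsilon>\<rfloor>\<close> is at most \<open>c\<^sup>2 * d ^ (1/8)\<close>, as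
  required for general log-concave measures, and for \<open>\<epsilon> > d ^ (-1/4)\<close> it is at most
  \<open>c\<^sup>2 * sqrt d\<close>, as required for product measures.
\<close>

theorem theorem1p5:
  shows "\<exists>\<eta> c c' :: real. 0 < \<eta> \<and> \<eta> < 1/4 \<and> 0 < c \<and> 0 < c' \<and>
    (\<forall>d\<ge>1. \<forall>\<mu>. log_concave_measure d \<mu> \<and> isotropic d \<mu> \<longrightarrow>
       (\<forall>\<epsilon>. real d powr (-\<eta>) < \<epsilon> \<and> \<epsilon> < 1 \<longrightarrow>
          ereal (c' * real (d choose (nat \<lfloor>c / \<epsilon>\<rfloor>)\<^sup>2)) \<le> H_Lip d \<mu> \<epsilon>) \<and>
       (product_measure d \<mu> \<longrightarrow>
         (\<forall>\<epsilon>. real d powr (-1/4) < \<epsilon> \<and> \<epsilon> < 1 \<longrightarrow>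
            ereal (c' * real (d choose (nat \<lfloor>c / \<epsilon>\<rfloor>)\<^sup>2)) \<le> H_Lip d \<mu> \<epsilon>)))"
proof -
  (* The constant c makes Lambda * epsilon small in entropy_lower_bound, and makes the degree
     small compared with a power of d. *)
  define c c' :: real where "c = 1 / 10 ^ 12" and "c' = (1 / (8 * 18 ^ 4))\<^sup>2 / (128 * 27)"
  have c0: "0 < c" "0 < c'" by (simp_all add: c_def c'_def)
  have trivial: "ereal (c' * real (d choose 0\<^sup>2)) \<le> H_Lip d \<mu> \<epsilon>"
    if "log_concave_measure d \<mu>" "\<epsilon> < 1" for d \<mu> \<epsilon>
  proof -
    have "c' \<le> 1 / 2" by (simp add: c'_def power2_eq_square)
    also have "\<dots> \<le> ln 2" using ln_le_minus_one[of "1 / 2"] by (simp add: ln_div)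
    finally have "ereal (c' * real (d choose 0\<^sup>2)) \<le> ereal (ln 2)" by simp
    also have "\<dots> \<le> H_Lip d \<mu> \<epsilon>"
      using that by (intro H_Lip_ge_ln_2) (auto simp: log_concave_measure_def)
    finally show ?thesis .
  qed
  have k: "1 \<le> k" "real k * \<epsilon> \<le> c" "real (k\<^sup>2) * \<epsilon>\<^sup>2 \<le> c\<^sup>2" "sqrt (real (k\<^sup>2)) * \<epsilon> \<le> c"
    if "k = nat \<lfloor>c / \<epsilon>\<rfloor>" "k \<noteq> 0" "0 < \<epsilon>" for k \<epsilon>
  proof -
    show "1 \<le> k" using that(2) by simp
    have "real k \<le> c / \<epsilon>" using that by linarith
    then show ke: "real k * \<epsilon> \<le> c" using that(3) by (simp add: le_divide_eq)
    then have "(real k * \<epsilon>)\<^sup>2 \<le> c\<^sup>2" using that(3) by (intro power_mono) auto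
    then show "real (k\<^sup>2) * \<epsilon>\<^sup>2 \<le> c\<^sup>2" by (simp add: power_mult_distrib)
    show "sqrt (real (k\<^sup>2)) * \<epsilon> \<le> c" using ke by simp
  qed
  have general: "ereal (c' * real (d choose (nat \<lfloor>c / \<epsilon>\<rfloor>)\<^sup>2)) \<le> H_Lip d \<mu> \<epsilon>"
    if d: "1 \<le> d" and lc: "log_concave_measure d \<mu>" and iso: "isotropic d \<mu>"
      and eps: "real d powr (- (1/16)) < \<epsilon>" "\<epsilon> < 1" for d \<mu> \<epsilon>
  proof (cases "nat \<lfloor>c / \<epsilon>\<rfloor> = 0")
    case True
    then show ?thesis using trivial[OF lc eps(2)] by simp
  next
    case False
    define k where "k = nat \<lfloor>c / \<epsilon>\<rfloor>"
    have e0: "0 < \<epsilon>" by (rule le_less_trans[OF powr_ge_zero eps(1)])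
    note k = k[OF k_def False[folded k_def] e0]
    define w where "w = real d powr (1/16)"
    have w: "0 < w" "w ^ 16 = real d"
    proof -
      show w0: "0 < w" using d by (simp add: w_def)
      have "w ^ 16 = w powr (real 16)" using w0 by (rule powr_realpow[symmetric])
      also have "\<dots> = real d powr (1/16 * real 16)" unfolding w_def by (rule powr_powr)
      finally show "w ^ 16 = real d" using d by simp
    qed
    have ew: "1 \<le> w * \<epsilon>"
    proof -
      have "1 / w < \<epsilon>" using eps(1) by (simp add: w_def powr_minus_divide)
      then show ?thesis using w(1) by (simp add: divide_less_eq mult.commute)
    qed
    have "1 * real (k\<^sup>2) \<le> (w * \<epsilon>)\<^sup>2 * real (k\<^sup>2)"
      using ew by (intro mult_right_mono) (auto intro: one_le_power)
    also have "\<dots> = w\<^sup>2 * (real (k\<^sup>2) * \<epsilon>\<^sup>2)" by (simp add: power_mult_distrib)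
    also have "\<dots> \<le> w\<^sup>2 * c\<^sup>2" by (intro mult_left_mono k(3)) auto
    finally have "real (k\<^sup>2) \<le> w\<^sup>2 * (1 / 10 ^ 24)" by (simp add: c_def power_divide)
    then have "10 ^ 24 * real (k\<^sup>2) \<le> w\<^sup>2" by simp
    moreover have "10 ^ 20 * real (k\<^sup>2) \<le> 10 ^ 24 * real (k\<^sup>2)" by (intro mult_right_mono) simp_all
    ultimately have nw: "10 ^ 20 * real (k\<^sup>2) \<le> w\<^sup>2" by (rule order_trans[rotated])
    have "sqrt (real (8 * k\<^sup>2)) * \<epsilon> = sqrt 8 * (sqrt (real (k\<^sup>2)) * \<epsilon>)"
      by (simp add: real_sqrt_mult)
    also have "\<dots> \<le> 3 * (sqrt (real (k\<^sup>2)) * \<epsilon>)"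
      using e0 by (intro mult_right_mono real_le_lsqrt) auto
    also have "\<dots> \<le> 3 * c" using k(4) by simp
    finally have "5186 * sqrt (real (8 * k\<^sup>2)) * \<epsilon> \<le> 1 / (64 * 18 ^ 4)" by (simp add: c_def)
    then have H: "ereal ((1 / (8 * 18 ^ 4))\<^sup>2 / (128 * 18) * real d ^ (k\<^sup>2)) \<le> H_Lip d \<mu> \<epsilon>"
      using k(1) by (intro log_concave_entropy[OF lc iso d _ w nw e0]) auto
    have "c' * real (d choose k\<^sup>2) \<le> c' * real d ^ (k\<^sup>2)"
      using c0 by (intro mult_left_mono binomial_le_power) auto
    also have "\<dots> \<le> (1 / (8 * 18 ^ 4))\<^sup>2 / (128 * 18) * real d ^ (k\<^sup>2)"
      by (intro mult_right_mono) (auto simp: c'_def)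
    finally have "ereal (c' * real (d choose k\<^sup>2)) \<le> ereal ((1 / (8 * 18 ^ 4))\<^sup>2 / (128 * 18) * real d ^ (k\<^sup>2))" by simp
    then show ?thesis unfolding k_def[symmetric] using H by (rule order_trans)
  qed
  have product: "ereal (c' * real (d choose (nat \<lfloor>c / \<epsilon>\<rfloor>)\<^sup>2)) \<le> H_Lip d \<mu> \<epsilon>"
    if d: "1 \<le> d" and lc: "log_concave_measure d \<mu>" and iso: "isotropic d \<mu>" and pr: "product_measure d \<mu>"
      and eps: "real d powr (-1/4) < \<epsilon>" "\<epsilon> < 1" for d \<mu> \<epsilon>
  proof (cases "nat \<lfloor>c / \<epsilon>\<rfloor> = 0")
    case True
    then show ?thesis using trivial[OF lc eps(2)] by simp
  next
    case False
    define k where "k = nat \<lfloor>c / \<epsilon>\<rfloor>"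
    have e0: "0 < \<epsilon>" by (rule le_less_trans[OF powr_ge_zero eps(1)])
    note k = k[OF k_def False[folded k_def] e0]
    define w where "w = real d powr (1/4)"
    have w: "0 < w" "w\<^sup>2 = sqrt (real d)"
    proof -
      show w0: "0 < w" using d by (simp add: w_def)
      have "w\<^sup>2 = w powr (real 2)" using w0 by (rule powr_realpow[symmetric])
      also have "\<dots> = real d powr (1/4 * real 2)" unfolding w_def by (rule powr_powr)
      also have "\<dots> = sqrt (real d)" by (simp add: powr_half_sqrt)
      finally show "w\<^sup>2 = sqrt (real d)" .
    qed
    have ew: "1 \<le> w * \<epsilon>"
    proof -
      have "1 / w < \<epsilon>" using eps(1) powr_minus_divide[of "real d" "1/4"] by (simp add: w_def)
      then show ?thesis using w(1) by (simp add: divide_less_eq mult.commute)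
    qed
    have "1 * real (k\<^sup>2) \<le> (w * \<epsilon>)\<^sup>2 * real (k\<^sup>2)"
      using ew by (intro mult_right_mono) (auto intro: one_le_power)
    also have "\<dots> = w\<^sup>2 * (real (k\<^sup>2) * \<epsilon>\<^sup>2)" by (simp add: power_mult_distrib)
    also have "\<dots> \<le> w\<^sup>2 * c\<^sup>2" by (intro mult_left_mono k(3)) auto
    finally have "real (k\<^sup>2) \<le> w\<^sup>2 * (1 / 10 ^ 24)" by (simp add: c_def power_divide)
    then have "10 ^ 24 * real (k\<^sup>2) \<le> w\<^sup>2" by simp
    moreover have "10 ^ 20 * real (k\<^sup>2) \<le> 10 ^ 24 * real (k\<^sup>2)" by (intro mult_right_mono) simp_all
    ultimately have nw: "10 ^ 20 * real (k\<^sup>2) \<le> sqrt (real d)" unfolding w(2)[symmetric] by (rule order_trans[rotated])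
    have "5186 * sqrt (real (k\<^sup>2)) * \<epsilon> \<le> 1 / (64 * 18 ^ 4)" using k(4) by (simp add: c_def)
    then have H: "ereal (c' * mono_var d (k\<^sup>2)) \<le> H_Lip d \<mu> \<epsilon>"
      unfolding c'_def using k(1) by (intro product_entropy[OF lc iso pr d _ nw e0]) auto
    have "ereal (c' * real (d choose k\<^sup>2)) \<le> ereal (c' * mono_var d (k\<^sup>2))"
      using c0 by (simp add: binomial_le_mono_var mult_left_mono)
    then show ?thesis unfolding k_def[symmetric] using H by (rule order_trans)
  qed
  show ?thesis
    by (rule exI[of _ "1/16"], rule exI[of _ c], rule exI[of _ c'])
       (use c0 general product in auto)
qed

end
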